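(* Let $m\ge 2$ be an integer, let $T_n$ be a random binary search tree with $n$ vertices, and let $\mathbf X^{(m)}=\mathbf X^{(m)}(T_n)=(X^{(m)}_0,\dots,X^{(m)}_{m-1})$, where $X^{(m)}_j$ is the number of vertices of $T_n$ whose depth is congruent to $j$ modulo $m$. Then the following holds as $n\to\infty$. (i) If $2\le m\le 8$, then $$n^{-1/2}\Bigl(\mathbf X^{(m)}-\frac nm\mathbf 1\Bigr)\overset{\mathrm d}{\longrightarrow} N(0,\Sigma_m),$$ where $\Sigma_m$ is the $m\times m$ circulant matrix (invariant under a simultaneous cyclic shift of rows and columns) with first row - $m=2$: $\tfrac1{28}(1,-1)$; - $m=3$: $\tfrac1{45}(2,-1,-1)$; - $m=4$: $\tfrac1{336}(17,-3,-11,-3)$; - $m=5$: $\tfrac1{275}(16,1,-9,-9,1)$; - $m=6$: $\tfrac1{1260}(89,23,-37,-61,-37,23)$; - $m=7$: $\tfrac1{637}(62,27,-15,-43,-43,-15,27)$; - $m=8$: $\tfrac1{1344}(269,165,-11,-171,-235,-171,-11,165)$. (ii) If $m\ge 9$, let $\alpha=2\cos(2\pi/m)-1>1/2$ and $\beta=2\sin(2\pi/m)$. Then $$n^{-\alpha}\Bigl(\mathbf X^{(m)}-\frac nm\mathbf 1\Bigr)-\operatorname{Re}\bigl(n^{\mathrm i\beta}\widetilde W_m\bigr)\overset{\mathrm{a.s.}}{\longrightarrow}0$$ for some complex random vector $\widetilde W_m=\bigl(\widetilde Z_m e^{-2\pi j\mathrm i/m}\bigr)_{j=0}^{m-1}$,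 where $\widetilde Z_m$ is a complex random variable. In particular, along any subsequence of $n$ such that $\beta\ln n\bmod 2\pi\to\gamma$ for some $\gamma\in[0,2\pi]$, $$n^{-\alpha}\Bigl(X^{(m)}_j-\frac nm\Bigr)\overset{\mathrm d}{\longrightarrow}\operatorname{Re}\bigl(e^{\mathrm i(\gamma-2\pi j/m)}\widetilde Z_m\bigr),$$ jointly in $j=0,\dots,m-1$.
   Context: The binary search tree of a sequence $x_1,\dots,x_n$ of distinct reals is empty if $n=0$; otherwise it has a root, whose left subtree is the binary search tree of the subsequence of those $x_i$ with $x_i<x_1$ and whose right subtree is the binary search tree of the subsequence of those $x_i$ with $x_i>x_1$. It has $n$ vertices. A random binary search tree with $n$ vertices is obtained by applying this to a sequence in uniformly random order (e.g. i.i.d. random variables with a common continuous distribution). Equivalently, the trees $T_1,T_2,\dots$ are grown by a Markov process: given the binary tree $T_n$ with $n$ vertices, there are $n+1$ possible positions for a new vertex, and one of them is chosen uniformly at random. The trees $T_n$ are the successive states of this growth process, on one probability space (this is the meaning of the almost sure convergence). The depth of a vertex is its distance from the root. $\mathbf 1=(1,\dots,1)$ is the $m$-dimensional all-ones vector, $\mathrm i$ is the imaginary unit, $\operatorname{Re}$ of a vector is taken componentwise, $N(0,\Sigma)$ is the (possibly degenerate) multivariate normal distribution with mean $0$ and covariance matrix $\Sigma$, and $\overset{\mathrm d}{\longrightarrow}$, $\overset{\mathrm{a.s.}}{\longrightarrow}$ denote convergence in distribution and almost surely. *)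

theory Defs
  imports
    "HOL-Probability.Probability"
    "HOL-Library.Tree"
    "HOL-Library.Multiset"
    "HOL-Library.Real_Mod"
    "HOL-Combinatorics.Multiset_Permutations"
begin

subsection \<open>Random binary search trees\<close>

fun bst_of_list :: "'a::linorder list \<Rightarrow> 'a tree" where
  "bst_of_list [] = Leaf"
| "bst_of_list (x # xs) =
     Node (bst_of_list [y\<leftarrow>xs. y < x]) x (bst_of_list [y\<leftarrow>xs. y > x])"

text \<open>
  Binary trees without labels are represented by the type \<^typ>\<open>unit tree\<close>; the vertices are
  the \<^const>\<open>Node\<close>s.
\<close>

definition shape :: "'a tree \<Rightarrow> unit tree" where
  "shape = map_tree (\<lambda>_. ())"

definition random_bst_pmf :: "nat \<Rightarrow> unit tree pmf" where
  "random_bst_pmf n =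
     map_pmf (\<lambda>xs. shape (bst_of_list xs)) (pmf_of_set (permutations_of_set {..<n}))"

definition random_bst :: "'w measure \<Rightarrow> nat \<Rightarrow> ('w \<Rightarrow> unit tree) \<Rightarrow> bool" where
  "random_bst M n T \<longleftrightarrow>
     T \<in> measurable M (count_space UNIV) \<and>
     distr M (count_space UNIV) T = measure_pmf (random_bst_pmf n)"

text \<open>
  The trees obtained by placing a new vertex at one of the free positions, i.e. the
  \<^const>\<open>Leaf\<close> occurrences. A tree with \<open>n\<close> vertices has \<open>n + 1\<close> of them, and different positions
  give different trees, so the uniform distribution on the set \<open>grow t\<close> is the same
  as the uniform distribution on positions.
\<close>

fun grow :: "unit tree \<Rightarrow> unit tree set" where
  "grow Leaf = {Node Leaf () Leaf}"
| "grow (Node l a r) = (\<lambda>l'. Node l' a r) ` grow l \<union> (\<lambda>r'. Node l a r') ` grow r"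

text \<open>
  Given the history \<open>T 0, \<dots>, T n\<close>, the next tree is uniformly distributed on \<open>grow (T n)\<close>.
  The conditional probabilities are written in multiplied-out form.
\<close>

definition bst_growth_process :: "'w measure \<Rightarrow> (nat \<Rightarrow> 'w \<Rightarrow> unit tree) \<Rightarrow> bool" where
  "bst_growth_process M T \<longleftrightarrow>
     prob_space M \<and>
     (\<forall>n. T n \<in> measurable M (count_space UNIV)) \<and>
     (AE \<omega> in M. T 0 \<omega> = Leaf) \<and>
     (\<forall>n h. measure M {\<omega> \<in> space M. \<forall>i\<le>Suc n. T i \<omega> = h i} =
            measure M {\<omega> \<in> space M. \<forall>i\<le>n. T i \<omega> = h i} *
            pmf (pmf_of_set (grow (h n))) (h (Suc n)))"


subsection \<open>Depth counts\<close>

fun depths :: "'a tree \<Rightarrow> nat multiset" where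
  "depths Leaf = {#}"
| "depths (Node l a r) = add_mset 0 (image_mset Suc (depths l + depths r))"

definition depth_count :: "nat \<Rightarrow> nat \<Rightarrow> 'a tree \<Rightarrow> nat" where
  "depth_count m j t = size {#d \<in># depths t. d mod m = j#}"

text \<open>
  An \<open>m\<close>-dimensional vector with coordinates numbered \<open>0, \<dots>, m - 1\<close> is an element of
  \<open>real ^ 'm\<close>, where \<open>idx\<close> is a bijection from \<open>'m\<close> to \<open>{..<m}\<close>: the coordinate at
  \<open>k :: 'm\<close> is coordinate number \<open>idx k\<close>.
\<close>

definition depth_vec :: "nat \<Rightarrow> ('m::finite \<Rightarrow> nat) \<Rightarrow> 'a tree \<Rightarrow> real ^ 'm" where
  "depth_vec m idx t = (\<chi> k. real (depth_count m (idx k) t))"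


subsection \<open>Multivariate normal distributions and convergence in distribution\<close>

definition normal_or_dirac :: "real measure \<Rightarrow> bool" where
  "normal_or_dirac L \<longleftrightarrow>
     (\<exists>a. L = return borel a) \<or>
     (\<exists>a s. s > 0 \<and> L = density lborel (\<lambda>x. ennreal (normal_density a s x)))"

text \<open>
  \<open>N\<close> is the possibly degenerate normal distribution with mean \<open>\<mu>\<close> and covariance matrix \<open>S\<close>:
  all linear functionals are normally distributed, and the first two moments are as prescribed.
\<close>

definition multivariate_normal ::
  "real ^ 'm \<Rightarrow> real ^ 'm ^ 'm \<Rightarrow> (real ^ 'm) measure \<Rightarrow> bool" where
  "multivariate_normal \<mu> S N \<longleftrightarrow>
     prob_space N \<and> sets N = sets borel \<and>
     (\<forall>t. normal_or_dirac (distr N borel (\<lambda>x. t \<bullet> x))) \<and>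
     (\<forall>k. (\<integral>x. x $ k \<partial>N) = \<mu> $ k) \<and>
     (\<forall>k l. (\<integral>x. (x $ k - \<mu> $ k) * (x $ l - \<mu> $ l) \<partial>N) = S $ k $ l)"

text \<open>
  The random variables \<open>X n\<close> on \<open>M\<close> converge in distribution to the law \<open>N\<close>. The library's
  \<^const>\<open>weak_conv_m\<close> only covers laws on the real line.
\<close>

definition converges_in_distribution ::
  "'w measure \<Rightarrow> (nat \<Rightarrow> 'w \<Rightarrow> 'b::topological_space) \<Rightarrow> 'b measure \<Rightarrow> bool" where
  "converges_in_distribution M X N \<longleftrightarrow>
     (\<forall>f :: 'b \<Rightarrow> real. continuous_on UNIV f \<and> bounded (range f) \<longrightarrow>
        (\<lambda>n. \<integral>\<omega>. f (X n \<omega>) \<partial>M) \<longlonglongrightarrow> (\<integral>x. f x \<partial>N))"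


subsection \<open>The limiting covariance matrices\<close>

definition circulant :: "nat \<Rightarrow> ('m::finite \<Rightarrow> nat) \<Rightarrow> real list \<Rightarrow> real ^ 'm ^ 'm" where
  "circulant m idx xs = (\<chi> k l. xs ! ((idx l + m - idx k) mod m))"

definition Sigma_row :: "nat \<Rightarrow> real list" where
  "Sigma_row m =
     (if m = 2 then map (\<lambda>x. x / 28) [1, -1]
      else if m = 3 then map (\<lambda>x. x / 45) [2, -1, -1]
      else if m = 4 then map (\<lambda>x. x / 336) [17, -3, -11, -3]
      else if m = 5 then map (\<lambda>x. x / 275) [16, 1, -9, -9, 1]
      else if m = 6 then map (\<lambda>x. x / 1260) [89, 23, -37, -61, -37, 23]
      else if m = 7 then map (\<lambda>x. x / 637) [62, 27, -15, -43, -43, -15, 27]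
      else if m = 8 then map (\<lambda>x. x / 1344) [269, 165, -11, -171, -235, -171, -11, 165]
      else [])"

end

theory Submission
  imports Defs "HOL-Real_Asymp.Real_Asymp"
begin

text \<open>
  Let \<open>\<zeta>\<close> be an \<open>m\<close>-th root of unity and let \<open>E\<^sub>n(\<zeta>)\<close> be the sum of \<open>\<zeta>\<^sup>d\<close> over the \<open>n + 1\<close> free positions
  of \<open>T\<^sub>n\<close>, where \<open>d\<close> is the depth. A new vertex at a position of depth \<open>d\<close> changes this sum by
  \<open>(2\<zeta> - 1) \<zeta>\<^sup>d\<close>. Hence \<open>E\<^sub>n(\<zeta>) - 1\<close> is \<open>2\<zeta> - 1\<close> times the sum of \<open>\<zeta>\<^sup>d\<close> over the depths \<open>d\<close> of
  the vertices, so that by Fourier inversion the centred depth counts are linear combinations of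
  the numbers \<open>E\<^sub>n(\<zeta>) - 1\<close> with \<open>\<zeta> \<noteq> 1\<close>; and \<open>E\<^sub>n(\<zeta>)\<close>, divided by the product of the factors \<open>1 + (2\<zeta> - 1) / i\<close>, which grows like \<open>n\<close> to the power \<open>2\<zeta> - 1\<close>, is a
  martingale.

  If \<open>m \<le> 8\<close>, then \<open>Re (2\<zeta> - 1) < 1/2\<close> for all \<open>\<zeta> \<noteq> 1\<close> and \<open>E\<^sub>n(\<zeta>)\<close> has order \<open>\<surd>n\<close>. The conditional
  covariances of the increments are multiples of \<open>E\<^sub>n(\<zeta>\<zeta>') / (n + 1)\<close> and hence nearly deterministic:
  this is \<open>1\<close> if \<open>\<zeta>\<zeta>' = 1\<close> and tends to \<open>0\<close> otherwise. So characteristic functions can be compared with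
  Gaussian ones one step at a time.

  If \<open>m \<ge> 9\<close>, then \<open>Re (2\<zeta> - 1)\<close> is largest among \<open>\<zeta> \<noteq> 1\<close>, and exceeds \<open>1/2\<close>, for the two roots
  next to \<open>1\<close>. Their
  martingales converge almost surely, and the other roots contribute less; both facts follow from
  Kolmogorov's maximal inequality.
\<close>

subsection \<open>Insertion at the leaves\<close>

text \<open>It is therefore used only for the leading roots. The other roots for m \<ge> 9 are
  treated through the recursion itself, and for m \<le> 8 the growth factors are moved into the
  coefficients of a linear statistic, where nothing is divided by them. The normal limit needs only
  the law of each \<open>T n\<close>, so it is proved under \<open>growth_pmf\<close>; almost sure
  convergence needs joint laws, hence the separate treatment of histories. In the limiting variance
  a root with \<lambda> = 2\<zeta> - 1 enters with |\<lambda>|^2 / (1 - 2 Re \<lambda>). The Fourier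
  inversion divides by |\<lambda>|^2, so that 1 / (3 - 4 cos(2 pi k / m)) remains. The resulting
  trigonometric sums are never evaluated: 3 - 4 cos is the symbol of a three-term difference
  operator on the residues modulo m, and the stated matrices are verified by rational
  arithmetic.\<close>

fun leaf_depths :: "'a tree \<Rightarrow> nat list" where
  "leaf_depths Leaf = [0]"
| "leaf_depths (Node l a r) = map Suc (leaf_depths l @ leaf_depths r)"

text \<open>Free positions are numbered from left to right, in the order of
  \<open>leaf_depths\<close>. A left subtree of size s has the positions 0 to s, which explains the
  test with \<le> and the shift by s + 1.\<close>

fun grow_at :: "unit tree \<Rightarrow> nat \<Rightarrow> unit tree" where
  "grow_at Leaf i = Node Leaf () Leaf"
| "grow_at (Node l a r) i =
     (if i \<le> size l then Node (grow_at l i) a r else Node l a (grow_at r (i - Suc (size l))))"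

text \<open>The weight is an arbitrary function of the depth, so that passing to a subtree only
  shifts it; inductions over trees generalise over the weight.\<close>

definition leaf_sum :: "(nat \<Rightarrow> 'b::comm_monoid_add) \<Rightarrow> 'a tree \<Rightarrow> 'b" where
  "leaf_sum c t = (\<Sum>d\<leftarrow>leaf_depths t. c d)"

definition vertex_sum :: "(nat \<Rightarrow> 'b::comm_monoid_add) \<Rightarrow> 'a tree \<Rightarrow> 'b" where
  "vertex_sum c t = (\<Sum>d\<in>#depths t. c d)"

lemma length_leaf_depths [simp]: "length (leaf_depths t) = Suc (size t)"
  by (induction t) auto

lemma leaf_sum_Leaf [simp]: "leaf_sum c Leaf = c 0"
  by (simp add: leaf_sum_def)

lemma leaf_sum_Node [simp]:
  "leaf_sum c (Node l a r) = leaf_sum (\<lambda>d. c (Suc d)) l + leaf_sum (\<lambda>d. c (Suc d)) r"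
  by (simp add: leaf_sum_def o_def)

lemma vertex_sum_Leaf [simp]: "vertex_sum c Leaf = 0"
  by (simp add: vertex_sum_def)

lemma vertex_sum_Node [simp]:
  "vertex_sum c (Node l a r) =
     c 0 + (vertex_sum (\<lambda>d. c (Suc d)) l + vertex_sum (\<lambda>d. c (Suc d)) r)"
  by (simp add: vertex_sum_def image_mset.compositionality o_def)

lemma size_grow_at [simp]: "size (grow_at t i) = Suc (size t)"
  by (induction t i rule: grow_at.induct) auto

lemma finite_grow [simp]: "finite (grow t)"
  by (induction t rule: grow.induct) auto

lemma grow_nonempty [simp]: "grow t \<noteq> {}"
  by (induction t rule: grow.induct) auto

lemma grow_eq_image: "grow t = grow_at t ` {..size t}"
proof (induction t rule: grow.induct)
  case (2 l a r)
  have "grow_at (Node l a r) ` {..size (Node l a r)} =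
        grow_at (Node l a r) ` ({..size l} \<union> (\<lambda>i. i + Suc (size l)) ` {..size r})"
  proof (rule arg_cong2[where f = image])
    show "{..size (Node l a r)} = {..size l} \<union> (\<lambda>i. i + Suc (size l)) ` {..size r}"
    proof (intro equalityI subsetI)
      fix x assume "x \<in> {..size (Node l a r)}"
      then show "x \<in> {..size l} \<union> (\<lambda>i. i + Suc (size l)) ` {..size r}"
        by (cases "x \<le> size l") (auto intro!: image_eqI[where x = "x - Suc (size l)"])
    qed auto
  qed simp
  then show ?case
    using 2 by (simp only: image_Un image_image) (auto simp: image_iff)
qed auto

lemma grow_at_neq: "grow_at t i \<noteq> t"
  by (metis n_not_Suc_n size_grow_at)

text \<open>An insertion changes exactly one of the two subtrees, because it changes the size; equal
  results therefore come from positions on the same side.\<close>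

lemma inj_on_grow_at: "inj_on (grow_at t) {..size t}"
proof (induction t)
  case (Node l a r)
  show ?case
  proof (rule inj_onI)
    fix i j assume *: "i \<in> {..size (Node l a r)}" "j \<in> {..size (Node l a r)}"
      "grow_at (Node l a r) i = grow_at (Node l a r) j"
    have neq: "l \<noteq> grow_at l i" "grow_at r i \<noteq> r" for i l r
      using grow_at_neq by metis+
    consider "i \<le> size l" "j \<le> size l" | "i > size l" "j > size l"
      using * neq by (fastforce split: if_splits)
    then show "i = j"
    proof cases
      case 1 then show ?thesis using * Node.IH(1) by (auto dest: inj_onD)
    next
      case 2
      then have "i - Suc (size l) = j - Suc (size l)"
        using * by (intro inj_onD[OF Node.IH(2)]) auto
      with 2 show ?thesis by simp
    qed
  qed
qed auto

lemma pmf_of_set_grow: "pmf_of_set (grow t) = map_pmf (grow_at t) (pmf_of_set {..size t})"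
  by (simp add: grow_eq_image map_pmf_of_set_inj inj_on_grow_at)

text \<open>The chosen position of depth d disappears, and two positions of depth d + 1 appear below
  the new vertex.\<close>

lemma leaf_sum_grow_at:
  fixes c :: "nat \<Rightarrow> 'b::ab_group_add"
  assumes "i \<le> size t"
  shows "leaf_sum c (grow_at t i) = leaf_sum c t +
    (c (Suc (leaf_depths t ! i)) + c (Suc (leaf_depths t ! i)) - c (leaf_depths t ! i))"
  using assms
proof (induction t i arbitrary: c rule: grow_at.induct)
  case (2 l a r i)
  show ?case
  proof (cases "i \<le> size l")
    case True
    then show ?thesis using 2(1)[of "\<lambda>d. c (Suc d)"] by (simp add: nth_append)
  next
    case False
    moreover have "i - Suc (size l) \<le> size r" using 2 False by auto
    ultimately show ?thesis using 2(2)[of "\<lambda>d. c (Suc d)"] by (simp add: nth_append)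
  qed
qed simp

lemma leaf_sum_nth: "leaf_sum c t = (\<Sum>i\<le>size t. c (leaf_depths t ! i))"
  by (simp add: leaf_sum_def sum_list_sum_nth atLeast0LessThan lessThan_Suc_atMost del: atMost_Suc)

lemma leaf_sum_mult:
  fixes f :: "nat \<Rightarrow> 'b::semiring_0"
  shows "leaf_sum (\<lambda>d. a * f d) t = a * leaf_sum f t"
  by (simp add: leaf_sum_nth sum_distrib_left)

lemma leaf_sum_const: "leaf_sum (\<lambda>_. c) t = of_nat (Suc (size t)) * (c::'b::semiring_1)"
  by (simp add: leaf_sum_nth algebra_simps)

text \<open>A vertex of depth d replaces a position of weight z^d by two of weight z^(d+1), a gain
  of (2z - 1) z^d; the 1 belongs to the empty tree.\<close>

lemma leaf_sum_power:
  fixes z :: "'b::comm_ring_1"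
  shows "leaf_sum (\<lambda>d. z ^ d) t = 1 + (2 * z - 1) * vertex_sum (\<lambda>d. z ^ d) t"
proof -
  have [simp]: "vertex_sum (\<lambda>d. z * f d) u = z * vertex_sum f u" for f and u :: "'a tree"
    by (simp add: vertex_sum_def sum_mset_distrib_left)
  show ?thesis
  proof (induction t)
    case (Node l a r)
    have "leaf_sum (\<lambda>d. z ^ d) (Node l a r) =
        z * leaf_sum (\<lambda>d. z ^ d) l + z * leaf_sum (\<lambda>d. z ^ d) r"
      by (simp add: leaf_sum_mult)
    then show ?case
      unfolding Node.IH by (simp add: algebra_simps)
  qed simp
qed

lemma depth_count_eq_vertex_sum:
  "(of_nat (depth_count m j t) :: 'b::semiring_1) = vertex_sum (\<lambda>d. if d mod m = j then 1 else 0) t"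
proof -
  have "of_nat (size {#d \<in># A. d mod m = j#}) = (\<Sum>d\<in>#A. if d mod m = j then 1 else (0::'b))"
    for A by (induction A) auto
  then show ?thesis by (simp add: depth_count_def vertex_sum_def)
qed

lemma size_eq_vertex_sum: "of_nat (size t) = vertex_sum (\<lambda>_. 1) t"
  by (induction t) simp_all

subsection \<open>The growth chain\<close>

lemma bst_of_list_map:
  fixes f :: "'a::linorder \<Rightarrow> 'b::linorder"
  assumes "strict_mono f"
  shows "bst_of_list (map f xs) = map_tree f (bst_of_list xs)"
  by (induction xs rule: bst_of_list.induct)
    (simp_all add: filter_map o_def strict_mono_less[OF assms])

lemma shape_map_tree [simp]: "shape (map_tree f t) = shape t"
  by (simp add: shape_def tree.map_comp o_def)

lemma shape_simps [simp]: "shape Leaf = Leaf" "shape (Node l a r) = Node (shape l) () (shape r)"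
  by (simp_all add: shape_def)

lemma size_shape [simp]: "size (shape t) = size t"
  by (simp add: shape_def)

lemma size_bst_of_list: "distinct xs \<Longrightarrow> size (bst_of_list xs) = length xs"
proof (induction xs rule: bst_of_list.induct)
  case (2 x xs)
  have "length xs = length [y\<leftarrow>xs. y < x] + length [y\<leftarrow>xs. \<not> y < x]"
    by (simp add: sum_length_filter_compl)
  also have "[y\<leftarrow>xs. \<not> y < x] = [y\<leftarrow>xs. y > x]"
    using 2 by (intro filter_cong) (auto simp: not_less order.strict_iff_order)
  finally show ?case using 2 by simp
qed simp

text \<open>Read from left to right, the free positions are the gaps between the keys in increasing
  order, so the new key goes to the gap numbered by the count of smaller keys.\<close>

lemma shape_bst_of_list_snoc:
  assumes "distinct (xs @ [x])"
  shows "shape (bst_of_list (xs @ [x])) =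
         grow_at (shape (bst_of_list xs)) (length [y\<leftarrow>xs. y < x])"
  using assms
proof (induction xs rule: bst_of_list.induct)
  case (2 z xs)
  have sz: "size (bst_of_list [y\<leftarrow>xs. y < z]) = length [y\<leftarrow>xs. y < z]"
    using 2 by (intro size_bst_of_list) auto
  show ?case
  proof (cases "x < z")
    case True
    have "length [y\<leftarrow>z # xs. y < x] = length [y\<leftarrow>[y\<leftarrow>xs. y < z]. y < x]"
      using True by (auto intro!: arg_cong[where f = length] filter_cong)
    moreover have "length [y\<leftarrow>[y\<leftarrow>xs. y < z]. y < x] \<le> length [y\<leftarrow>xs. y < z]"
      by (rule length_filter_le)
    moreover have "\<not> z < x" using True by simp
    ultimately show ?thesis
      using True 2 sz by simp
  next
    case False
    have "length [y\<leftarrow>xs. y < x] = length [y\<leftarrow>[y\<leftarrow>xs. y < x]. y < z] + length [y\<leftarrow>[y\<leftarrow>xs. y < x]. \<not> y < z]"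
      by (simp only: sum_length_filter_compl)
    also have "[y\<leftarrow>[y\<leftarrow>xs. y < x]. y < z] = [y\<leftarrow>xs. y < z]"
      using False by (auto intro!: filter_cong)
    also have "[y\<leftarrow>[y\<leftarrow>xs. y < x]. \<not> y < z] = [y\<leftarrow>[y\<leftarrow>xs. y > z]. y < x]"
      using 2(3) by (auto intro!: filter_cong simp: not_less order.strict_iff_order)
    finally show ?thesis
      using False 2 sz by auto
  qed
qed simp

lemma pair_pmf_of_set:
  assumes "finite A" "A \<noteq> {}" "finite B" "B \<noteq> {}"
  shows "pair_pmf (pmf_of_set A) (pmf_of_set B) = pmf_of_set (A \<times> B)"
proof (rule pmf_eqI)
  fix x :: "'a \<times> 'b"
  show "pmf (pair_pmf (pmf_of_set A) (pmf_of_set B)) x = pmf (pmf_of_set (A \<times> B)) x"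
    using assms by (cases x) (simp add: pmf_pair card_cartesian_product indicator_def)
qed

text \<open>
  The permutation of \<open>{..n}\<close> with last entry \<open>r\<close> whose other entries are in the same relative
  order as those of the permutation \<open>xs\<close> of \<open>{..<n}\<close>.
\<close>

definition extend_perm :: "nat list \<times> nat \<Rightarrow> nat list" where
  "extend_perm = (\<lambda>(xs, r). map (\<lambda>x. if x < r then x else Suc x) xs @ [r])"

lemma strict_mono_skip: "strict_mono (\<lambda>x. if x < r then x else Suc (x::nat))"
  by (rule strict_monoI) auto

text \<open>This splits a uniform permutation into a uniform shorter one and an independent uniform
  rank of the last entry. Surjectivity comes from counting: both sides have (n + 1)!
  elements.\<close>

lemma bij_betw_extend_perm:
  "bij_betw extend_perm (permutations_of_set {..<n} \<times> {..n}) (permutations_of_set {..<Suc n})"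
proof -
  have inj: "inj_on extend_perm (permutations_of_set {..<n} \<times> {..n})"
  proof (rule inj_onI)
    fix p q assume eq: "extend_perm p = extend_perm q"
    obtain xs r ys s where pq: "p = (xs, r)" "q = (ys, s)" by (cases p, cases q)
    have "r = s" using eq by (simp add: extend_perm_def pq)
    moreover have "xs = ys"
    proof (rule map_injective)
      show "map (\<lambda>x. if x < s then x else Suc x) xs = map (\<lambda>x. if x < s then x else Suc x) ys"
        using eq \<open>r = s\<close> by (simp add: extend_perm_def pq)
    qed (rule strict_mono_imp_inj_on[OF strict_mono_skip])
    ultimately show "p = q" by (simp add: pq)
  qed
  have sub: "extend_perm ` (permutations_of_set {..<n} \<times> {..n}) \<subseteq> permutations_of_set {..<Suc n}"
  proof clarify
    fix xs r assume xs: "xs \<in> permutations_of_set {..<n}" and r: "r \<le> n"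
    have d: "distinct (extend_perm (xs, r))"
    proof -
      have "inj_on (\<lambda>x. if x < r then x else Suc x) (set xs)"
        using strict_mono_imp_inj_on[OF strict_mono_skip[of r]]
        by (rule inj_on_subset[OF _ subset_UNIV])
      then show ?thesis
        using permutations_of_setD(2)[OF xs] by (auto simp: extend_perm_def distinct_map split: if_splits)
    qed
    moreover have "set (extend_perm (xs, r)) = {..<Suc n}"
    proof (rule card_subset_eq)
      show "set (extend_perm (xs, r)) \<subseteq> {..<Suc n}"
      proof
        fix y assume "y \<in> set (extend_perm (xs, r))"
        then consider "y = r" | x where "x \<in> set xs" "y \<le> Suc x"
          by (auto simp: extend_perm_def split: if_splits)
        then show "y \<in> {..<Suc n}"
          using r permutations_of_setD(1)[OF xs] by cases auto
      qed
      show "card (set (extend_perm (xs, r))) = card {..<Suc n}"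
      proof -
        have "card (set (extend_perm (xs, r))) = Suc (length xs)"
          by (subst distinct_card[OF d]) (simp add: extend_perm_def)
        also have "length xs = card (set xs)"
          by (rule distinct_card[OF permutations_of_setD(2)[OF xs], symmetric])
        finally show ?thesis using permutations_of_setD(1)[OF xs] by simp
      qed
    qed simp
    ultimately show "extend_perm (xs, r) \<in> permutations_of_set {..<Suc n}" by auto
  qed
  have "extend_perm ` (permutations_of_set {..<n} \<times> {..n}) = permutations_of_set {..<Suc n}"
    by (rule card_subset_eq[OF _ sub])
      (simp_all add: card_image[OF inj] card_cartesian_product algebra_simps)
  with inj show ?thesis by (simp add: bij_betw_def)
qed

text \<open>Relabelling by a strictly increasing map keeps the shape, and exactly \<open>r\<close>
  of the relabelled entries lie below the last entry \<open>r\<close>.\<close>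

lemma shape_bst_extend_perm:
  assumes "xs \<in> permutations_of_set {..<n}" "r \<le> n"
  shows "shape (bst_of_list (extend_perm (xs, r))) = grow_at (shape (bst_of_list xs)) r"
proof -
  let ?f = "\<lambda>x. if x < r then x else Suc x"
  note xs = permutations_of_setD[OF assms(1)]
  have "distinct (extend_perm (xs, r))"
    using bij_betwE[OF bij_betw_extend_perm[of n]] assms
    by (intro permutations_of_setD(2)[of _ "{..<Suc n}"]) auto
  then have "shape (bst_of_list (extend_perm (xs, r))) =
      grow_at (shape (bst_of_list (map ?f xs))) (length [y\<leftarrow>map ?f xs. y < r])"
    by (simp only: extend_perm_def prod.case shape_bst_of_list_snoc)
  also have "[y\<leftarrow>map ?f xs. y < r] = map ?f [y\<leftarrow>xs. y < r]"
    by (auto simp: filter_map o_def intro!: filter_cong arg_cong[where f = "map ?f"])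
  also have "length (map ?f [y\<leftarrow>xs. y < r]) = card (set [y\<leftarrow>xs. y < r])"
    using distinct_card[of "[y\<leftarrow>xs. y < r]"] xs by simp
  also have "set [y\<leftarrow>xs. y < r] = {..<r}"
    using assms(2) by (auto simp add: xs(1))
  finally show ?thesis
    by (simp add: bst_of_list_map[OF strict_mono_skip])
qed

primrec growth_pmf :: "nat \<Rightarrow> unit tree pmf" where
  "growth_pmf 0 = return_pmf Leaf"
| "growth_pmf (Suc n) = growth_pmf n \<bind> (\<lambda>t. pmf_of_set (grow t))"

lemma random_bst_pmf_eq_growth_pmf: "random_bst_pmf n = growth_pmf n"
proof (induction n)
  case 0
  show ?case by (simp add: random_bst_pmf_def pmf_of_set_singleton)
next
  case (Suc n)
  let ?P = "permutations_of_set {..<n}"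
  have fin: "finite ?P" "?P \<noteq> {}" by (auto simp: permutations_of_set_empty_iff)
  have "pmf_of_set (permutations_of_set {..<Suc n}) =
      map_pmf extend_perm (pmf_of_set (?P \<times> {..n}))"
    using fin by (intro map_pmf_of_set_bij_betw[OF bij_betw_extend_perm, symmetric]) auto
  also have "pmf_of_set (?P \<times> {..n}) = pair_pmf (pmf_of_set ?P) (pmf_of_set {..n})"
    using fin by (intro pair_pmf_of_set[symmetric]) auto
  finally have "random_bst_pmf (Suc n) = pmf_of_set ?P \<bind> (\<lambda>xs. pmf_of_set {..n} \<bind>
      (\<lambda>r. return_pmf (shape (bst_of_list (extend_perm (xs, r))))))"
    by (simp add: random_bst_pmf_def pair_pmf_def map_pmf_def bind_assoc_pmf bind_return_pmf)
  also have "\<dots> = pmf_of_set ?P \<bind> (\<lambda>xs. pmf_of_set (grow (shape (bst_of_list xs))))"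
  proof (intro bind_pmf_cong refl)
    fix xs assume "xs \<in> set_pmf (pmf_of_set ?P)"
    then have xs: "xs \<in> ?P" using fin by simp
    have "length xs = n"
      using distinct_card[of xs] permutations_of_setD[OF xs] by simp
    then have "size (bst_of_list xs) = n"
      using size_bst_of_list[of xs] permutations_of_setD[OF xs] by simp
    moreover have "pmf_of_set {..n} \<bind> (\<lambda>r. return_pmf (shape (bst_of_list (extend_perm (xs, r))))) =
        pmf_of_set {..n} \<bind> (\<lambda>r. return_pmf (grow_at (shape (bst_of_list xs)) r))"
      by (intro bind_pmf_cong refl) (simp add: shape_bst_extend_perm[OF xs])
    ultimately show "pmf_of_set {..n} \<bind> (\<lambda>r. return_pmf (shape (bst_of_list (extend_perm (xs, r))))) =
        pmf_of_set (grow (shape (bst_of_list xs)))"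
      by (simp add: pmf_of_set_grow map_pmf_def)
  qed
  also have "\<dots> = random_bst_pmf n \<bind> (\<lambda>t. pmf_of_set (grow t))"
    by (simp add: random_bst_pmf_def map_pmf_def bind_assoc_pmf bind_return_pmf)
  finally show ?case by (simp add: Suc.IH)
qed

section \<open>Expectations over the growth chain\<close>

abbreviation growth_mean :: "nat \<Rightarrow> (unit tree \<Rightarrow> 'b::{banach,second_countable_topology}) \<Rightarrow> 'b" where
  "growth_mean n \<equiv> measure_pmf.expectation (growth_pmf n)"

lemma size_growth_pmf: "t \<in> set_pmf (growth_pmf n) \<Longrightarrow> size t = n"
  by (induction n arbitrary: t) (auto simp: grow_eq_image)

lemma finite_set_growth_pmf [simp]: "finite (set_pmf (growth_pmf n))"
  by (induction n) auto

lemma integrable_growth_pmf [simp]: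
  fixes H :: "unit tree \<Rightarrow> 'b::{banach,second_countable_topology}"
  shows "integrable (measure_pmf (growth_pmf n)) H"
  by (rule integrable_measure_pmf_finite) simp

lemma sum_grow:
  "(\<Sum>t'\<in>grow t. H t') = (\<Sum>i\<le>size t. H (grow_at t i))"
  by (simp add: grow_eq_image sum.reindex[OF inj_on_grow_at])

lemma card_grow [simp]: "card (grow t) = Suc (size t)"
  by (simp add: grow_eq_image card_image[OF inj_on_grow_at])

lemma expectation_grow:
  fixes H :: "unit tree \<Rightarrow> 'b::{banach,second_countable_topology}"
  shows "measure_pmf.expectation (pmf_of_set (grow t)) H =
         (\<Sum>i\<le>size t. H (grow_at t i)) /\<^sub>R real (Suc (size t))"
  by (subst integral_measure_pmf[of "grow t"])
     (simp_all add: sum_grow pmf_of_set scaleR_sum_right inverse_eq_divide)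

lemma expectation_growth_pmf_Suc:
  fixes H :: "unit tree \<Rightarrow> 'b::{banach,second_countable_topology}"
  shows "growth_mean (Suc n) H =
         growth_mean n
           (\<lambda>t. (\<Sum>i\<le>size t. H (grow_at t i)) /\<^sub>R real (Suc (size t)))"
proof -
  have "growth_mean (Suc n) H =
      (\<Sum>t\<in>set_pmf (growth_pmf n). pmf (growth_pmf n) t *\<^sub>R
         measure_pmf.expectation (pmf_of_set (grow t)) H)"
    by (simp add: pmf_expectation_bind[of "set_pmf (growth_pmf n)"])
  also have "\<dots> = growth_mean n
      (\<lambda>t. measure_pmf.expectation (pmf_of_set (grow t)) H)"
    by (rule integral_measure_pmf[symmetric]) auto
  finally show ?thesis by (simp only: expectation_grow)
qed

lemma growth_expectation_mono:
  fixes f g :: "unit tree \<Rightarrow> real"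
  assumes "\<And>t. size t = n \<Longrightarrow> f t \<le> g t"
  shows "growth_mean n f \<le> growth_mean n g"
  by (intro integral_mono_AE) (auto simp: AE_measure_pmf_iff dest!: size_growth_pmf intro: assms)

lemma growth_expectation_cong:
  fixes f g :: "unit tree \<Rightarrow> 'b::{banach,second_countable_topology}"
  assumes "\<And>t. size t = n \<Longrightarrow> f t = g t"
  shows "growth_mean n f = growth_mean n g"
  by (intro integral_cong_AE) (auto simp: AE_measure_pmf_iff dest!: size_growth_pmf intro: assms)

subsection \<open>Contracting recursions\<close>

text \<open>Once e n < c \<delta>, the constant \<delta> is a supersolution, so the excess of
  \<open>y\<close> over \<delta> obeys the homogeneous recursion. Its factors 1 - c / (n + 1)
  multiply to something of order n^(-c).\<close>

lemma recursion_tendsto_0: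
  fixes y e :: "nat \<Rightarrow> real"
  assumes c: "c > 0" and e: "e \<longlonglongrightarrow> 0" and y: "\<And>n. y n \<ge> 0"
    and rec: "\<forall>\<^sub>F n in sequentially.
      y (Suc n) \<le> (1 - c / real (Suc n)) * y n + e n / real (Suc n)"
  shows "y \<longlonglongrightarrow> 0"
proof (rule LIMSEQ_I)
  fix \<epsilon> :: real assume eps: "\<epsilon> > 0"
  define \<delta> where "\<delta> = \<epsilon> / 2"
  have "\<forall>\<^sub>F n in sequentially. e n < c * \<delta>"
    using c eps by (intro order_tendstoD(2)[OF e]) (simp add: \<delta>_def)
  moreover have "\<forall>\<^sub>F n in sequentially. c \<le> real (Suc n)"
    by real_asymp
  ultimately obtain N where N: "\<And>n. n \<ge> N \<Longrightarrow> e n < c * \<delta> \<and> c \<le> real (Suc n) \<and>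
      y (Suc n) \<le> (1 - c / real (Suc n)) * y n + e n / real (Suc n)"
    using rec by (metis (mono_tags, lifting) eventually_conj eventually_sequentially)
  define v where "v = (\<lambda>n. max 0 (y n - \<delta>))"
  have v_step: "v (Suc n) \<le> exp (- (c / real (Suc n))) * v n" if "n \<ge> N" for n
  proof -
    have 0: "1 - c / real (Suc n) \<ge> 0" using N[OF that] by (simp add: field_simps)
    have en: "e n / real (Suc n) \<le> c * \<delta> / real (Suc n)"
      using N[OF that] by (intro divide_right_mono) auto
    then have "y (Suc n) - \<delta> \<le> (1 - c / real (Suc n)) * (y n - \<delta>)"
    proof -
      have "(1 - c / real (Suc n)) * (y n - \<delta>) =
          (1 - c / real (Suc n)) * y n - \<delta> + c * \<delta> / real (Suc n)"
        by (simp only: left_diff_distrib right_diff_distrib) simp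
      then show ?thesis using N[OF that] en by linarith
    qed
    also have "\<dots> \<le> (1 - c / real (Suc n)) * v n"
      using 0 by (intro mult_left_mono) (auto simp: v_def)
    finally have "v (Suc n) \<le> (1 - c / real (Suc n)) * v n"
      using 0 by (auto simp: v_def intro!: mult_nonneg_nonneg)
    also have "\<dots> \<le> exp (- (c / real (Suc n))) * v n"
      using exp_ge_add_one_self[of "- (c / real (Suc n))"]
      by (intro mult_right_mono) (auto simp: v_def)
    finally show ?thesis .
  qed
  \<comment> \<open>The harmonic number grows by 1 / (n + 1), which exactly offsets the bound exp
    (-c / (n + 1)) for one step; hence \<open>w\<close> does not increase, and \<open>harm\<close>
    \<ge> ln turns this into polynomial decay of \<open>v\<close>.\<close>
  define w where "w = (\<lambda>n. v n * exp (c * harm n))"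
  have w: "w n \<le> w N" if "n \<ge> N" for n
    using that
  proof (induction n rule: dec_induct)
    case (step n)
    have "w (Suc n) \<le> exp (- (c / real (Suc n))) * v n * exp (c * harm (Suc n))"
      unfolding w_def using v_step[OF step(1)] by (intro mult_right_mono) auto
    also have "\<dots> = w n"
    proof -
      have "exp (- (c / real (Suc n))) * exp (c * harm (Suc n)) = exp (c * harm n)"
        by (simp only: harm_Suc flip: exp_add) (simp add: ring_distribs divide_inverse)
      then show ?thesis by (simp add: w_def)
    qed
    finally show ?case using step by simp
  qed simp
  have "v n \<le> w N * exp (- c * ln (real n + 1))" if "n \<ge> N" for n
  proof -
    have "v n = w n * exp (- c * harm n)" by (simp add: w_def exp_minus)
    also have "\<dots> \<le> w N * exp (- c * ln (real n + 1))"
      using w[OF that] ln_le_harm[of n] c by (intro mult_mono) (auto simp: w_def v_def)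
    finally show ?thesis .
  qed
  then have "\<forall>\<^sub>F n in sequentially. norm (v n) \<le> w N * exp (- c * ln (real n + 1))"
    by (intro eventually_sequentiallyI[of N]) (auto simp: v_def)
  moreover have "(\<lambda>n. w N * exp (- c * ln (real n + 1))) \<longlonglongrightarrow> 0"
    using c by real_asymp
  ultimately have "v \<longlonglongrightarrow> 0" by (rule Lim_null_comparison)
  then have "\<forall>\<^sub>F n in sequentially. v n < \<delta>"
    using eps by (intro order_tendstoD(2)) (auto simp: \<delta>_def)
  then obtain N' where "\<And>n. n \<ge> N' \<Longrightarrow> v n < \<delta>"
    by (auto simp: eventually_sequentially)
  then show "\<exists>N. \<forall>n\<ge>N. norm (y n - 0) < \<epsilon>"
    using y by (intro exI[of _ N']) (fastforce simp: v_def \<delta>_def max_def split: if_splits)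
qed

text \<open>The convenient form of the criterion: only the expansion r n = 1 - \<kappa> / n + o(1 /
  n) has to be known. Half of \<kappa> is given away to absorb the lower-order terms.\<close>

lemma contraction_tendsto_0:
  fixes r y e :: "nat \<Rightarrow> real"
  assumes r: "(\<lambda>n. real (Suc n) * (r n - 1)) \<longlonglongrightarrow> - \<kappa>" and \<kappa>: "\<kappa> > 0"
    and e: "e \<longlonglongrightarrow> 0" and y: "\<And>n. y n \<ge> 0"
    and rec: "\<forall>\<^sub>F n in sequentially. y (Suc n) \<le> \<bar>r n\<bar> * y n + e n / real (Suc n)"
  shows "y \<longlonglongrightarrow> 0"
proof (rule recursion_tendsto_0[of "\<kappa> / 2" e])
  have 1: "\<forall>\<^sub>F n in sequentially. real (Suc n) * (r n - 1) < - (\<kappa> / 2)"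
    using \<kappa> by (intro order_tendstoD(2)[OF r]) auto
  have "(\<lambda>n. real (Suc n) * (r n - 1) * (1 / real (Suc n)) + 1) \<longlonglongrightarrow> - \<kappa> * 0 + 1"
    by (intro tendsto_intros r) real_asymp
  then have "r \<longlonglongrightarrow> 1" by simp
  then have 2: "\<forall>\<^sub>F n in sequentially. r n > 0" by (intro order_tendstoD(1)) auto
  show "\<forall>\<^sub>F n in sequentially.
      y (Suc n) \<le> (1 - \<kappa> / 2 / real (Suc n)) * y n + e n / real (Suc n)"
    using 1 2 rec
  proof eventually_elim
    case (elim n)
    have "\<bar>r n\<bar> \<le> 1 - \<kappa> / 2 / real (Suc n)"
      using elim by (simp add: field_simps)
    then have "\<bar>r n\<bar> * y n \<le> (1 - \<kappa> / 2 / real (Suc n)) * y n"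
      by (intro mult_right_mono y)
    then show ?case using elim by linarith
  qed
qed (use assms in auto)

text \<open>Inserting Q n = L n gives L = a L + b to leading order. The deviation of Q n / n from
  this L contracts with rate 1 - a, and the terms of lower order form the error
  \<open>e\<close>.\<close>

lemma affine_recursion_limit:
  fixes Q :: "nat \<Rightarrow> real"
  assumes a: "a < 1"
    and rec: "\<And>n. Q (Suc n) = (1 + a / real (Suc n) + g / (real (Suc n))\<^sup>2) * Q n + b"
  shows "(\<lambda>n. Q n / real n) \<longlonglongrightarrow> b / (1 - a)"
proof -
  define L where "L = b / (1 - a)"
  define r where "r = (\<lambda>n. (1 + a / real (Suc n) + g / (real (Suc n))\<^sup>2) * (real n / real (Suc n)))"
  define e where "e = (\<lambda>n. \<bar>L\<bar> * \<bar>(g - a) / real (Suc n) - g / (real (Suc n))\<^sup>2\<bar>)"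
  have "(\<lambda>n. \<bar>Q n / real n - L\<bar>) \<longlonglongrightarrow> 0"
  proof (rule contraction_tendsto_0)
    show "(\<lambda>n. real (Suc n) * (r n - 1)) \<longlonglongrightarrow> - (1 - a)"
      unfolding r_def by real_asymp
    have "(\<lambda>n. (g - a) / real (Suc n) - g / (real (Suc n))\<^sup>2) \<longlonglongrightarrow> 0"
      by real_asymp
    then show "e \<longlonglongrightarrow> 0"
      unfolding e_def by (intro tendsto_mult_right_zero tendsto_rabs_zero)
    show "\<forall>\<^sub>F n in sequentially. \<bar>Q (Suc n) / real (Suc n) - L\<bar> \<le>
        \<bar>r n\<bar> * \<bar>Q n / real n - L\<bar> + e n / real (Suc n)"
      using eventually_gt_at_top[of 0]
    proof eventually_elim
      case (elim n)
      define N where "N = real (Suc n)"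
      have N: "N > 0" "real n = N - 1" by (auto simp: N_def)
      have L: "b = L * (1 - a)" using a by (simp add: L_def)
      have nz: "N - 1 \<noteq> 0" using elim N by auto
      define q where "q = Q n / (N - 1)"
      have Qn: "Q n = q * (N - 1)" using nz by (simp add: q_def)
      have "Q (Suc n) / N - L = r n * (q - L) + L * ((g - a) / N - g / N\<^sup>2) / N"
        unfolding rec L r_def N_def[symmetric] N(2) Qn
        using N(1) by (simp add: field_simps power2_eq_square)
      also have "\<bar>\<dots>\<bar> \<le> \<bar>r n * (q - L)\<bar> + \<bar>L * ((g - a) / N - g / N\<^sup>2) / N\<bar>"
        by (rule abs_triangle_ineq)
      also have "\<bar>L * ((g - a) / N - g / N\<^sup>2) / N\<bar> = e n / N"
        using N by (simp add: e_def N_def[symmetric] abs_mult)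
      finally show ?case by (simp add: abs_mult q_def N(2) N_def[symmetric])
    qed
  qed (use a in auto)
  then have "(\<lambda>n. Q n / real n - L) \<longlonglongrightarrow> 0" by (simp add: tendsto_rabs_zero_iff)
  then show ?thesis by (simp add: L_def LIM_zero_iff)
qed

lemma norm_one_plus_div_sq:
  fixes w :: complex
  shows "(norm (1 + w / of_nat (Suc n)))\<^sup>2 =
    1 + 2 * Re w / real (Suc n) + (norm w)\<^sup>2 / (real (Suc n))\<^sup>2"
proof -
  define S where "S = real (Suc n)"
  have S: "S \<noteq> 0" "of_nat (Suc n) = complex_of_real S" by (simp_all add: S_def)
  have "(norm (1 + w / complex_of_real S))\<^sup>2 = (1 + Re w / S)\<^sup>2 + (Im w / S)\<^sup>2"
    by (simp add: cmod_power2 Re_divide_of_real Im_divide_of_real)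
  also have "\<dots> = 1 + 2 * Re w / S + ((Re w)\<^sup>2 + (Im w)\<^sup>2) / S\<^sup>2"
    by (simp add: power2_sum power_divide add_divide_distrib)
  finally show ?thesis unfolding S(2) cmod_power2 S_def[symmetric] .
qed

subsection \<open>Roots of unity\<close>

definition zeta :: "nat \<Rightarrow> nat \<Rightarrow> complex" where
  "zeta m k = cis (2 * pi * real k / real m)"

definition lam :: "nat \<Rightarrow> nat \<Rightarrow> complex" where
  "lam m k = 2 * zeta m k - 1"

definition leaf_char :: "nat \<Rightarrow> nat \<Rightarrow> 'a tree \<Rightarrow> complex" where
  "leaf_char m k t = leaf_sum (\<lambda>d. zeta m k ^ d) t"

lemma norm_zeta [simp]: "norm (zeta m k) = 1"
  by (simp add: zeta_def)

lemma zeta_0 [simp]: "zeta m 0 = 1"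
  by (simp add: zeta_def)

lemma zeta_power: "zeta m k ^ d = zeta m (k * d)"
  by (simp add: zeta_def Complex.DeMoivre algebra_simps)

lemma zeta_add: "zeta m (j + k) = zeta m j * zeta m k"
  by (simp add: zeta_def cis_mult add_divide_distrib ring_distribs)

lemma zeta_self [simp]: "m > 0 \<Longrightarrow> zeta m m = 1"
  by (simp add: zeta_def)

lemma zeta_mult_self [simp]: "m > 0 \<Longrightarrow> zeta m (m * q) = 1"
  by (simp flip: zeta_power)

lemma zeta_mod: "m > 0 \<Longrightarrow> zeta m (k mod m) = zeta m k"
  by (metis mult_div_mod_eq zeta_add zeta_mult_self mult_1)

lemma cnj_zeta: "m > 0 \<Longrightarrow> k \<le> m \<Longrightarrow> cnj (zeta m k) = zeta m (m - k)"
proof -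
  assume *: "m > 0" "k \<le> m"
  then have "zeta m (m - k) * zeta m k = 1"
    by (simp flip: zeta_add)
  moreover have "cnj (zeta m k) * zeta m k = 1"
    using complex_norm_square[of "zeta m k"] by (simp add: mult.commute)
  moreover have "zeta m k \<noteq> 0"
    using norm_zeta[of m k] by (metis norm_zero zero_neq_one)
  ultimately show ?thesis by (metis mult_right_cancel)
qed

lemma zeta_mult_cnj:
  assumes "m > 0" "j < m" "k < m"
  shows "zeta m j * cnj (zeta m k) = zeta m ((j + m - k) mod m)"
  using assms by (simp add: cnj_zeta zeta_mod flip: zeta_add)

lemma zeta_eq_1_iff: "k < m \<Longrightarrow> zeta m k = 1 \<longleftrightarrow> k = 0"
proof
  assume k: "k < m" and *: "zeta m k = 1"
  then have "cos (2 * pi * real k / real m) = 1"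
    by (metis cis.sel(1) one_complex.sel(1) zeta_def)
  then obtain n :: int where n: "2 * pi * real k / real m = real_of_int n * 2 * pi"
    using cos_one_2pi_int by blast
  then have eq: "real k = real_of_int n * real m"
    using k by (simp add: field_simps)
  then have "int k = n * int m"
    by (metis of_int_eq_iff of_int_mult of_int_of_nat_eq)
  then have "int m dvd int k" by simp
  then show "k = 0" using k by (auto dest: dvd_imp_le)
qed simp

lemma sum_zeta_power:
  assumes "m > 0" "k < m"
  shows "(\<Sum>j<m. zeta m k ^ j) = (if k = 0 then of_nat m else 0)"
proof (cases "k = 0")
  case False
  then have "zeta m k \<noteq> 1" using zeta_eq_1_iff[of k m] assms by simp
  moreover have "zeta m k ^ m = 1" using assms by (simp add: zeta_power mult.commute[of k])
  ultimately show ?thesis using False by (simp add: geometric_sum)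
qed simp

text \<open>Since \<open>zeta m k ^ d = zeta m d ^ k\<close>, the sum over \<open>k\<close> is a
  geometric sum of powers of a single root of unity.\<close>

lemma zeta_orthogonal:
  assumes "j < m"
  shows "(\<Sum>k<m. cnj (zeta m k ^ j) * zeta m k ^ d) = (if d mod m = j then of_nat m else 0)"
proof -
  have m: "m > 0" using assms by simp
  have "(\<Sum>k<m. cnj (zeta m k ^ j) * zeta m k ^ d) = (\<Sum>k<m. zeta m ((d + m - j) mod m) ^ k)"
  proof (rule sum.cong)
    fix k
    have "cnj (zeta m k ^ j) * zeta m k ^ d = cnj (zeta m j ^ k) * zeta m d ^ k"
      by (simp add: zeta_power mult.commute flip: complex_cnj_power)
    also have "\<dots> = (zeta m (d mod m) * cnj (zeta m j)) ^ k"
      using m by (simp add: power_mult_distrib zeta_mod)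
    also have "zeta m (d mod m) * cnj (zeta m j) = zeta m ((d mod m + m - j) mod m)"
      using m assms by (intro zeta_mult_cnj) auto
    also have "(d mod m + m - j) mod m = (d + m - j) mod m"
      using assms by (metis Nat.add_diff_assoc less_imp_le_nat mod_add_left_eq)
    finally show "cnj (zeta m k ^ j) * zeta m k ^ d = zeta m ((d + m - j) mod m) ^ k" .
  qed simp
  also have "\<dots> = (if (d + m - j) mod m = 0 then of_nat m else 0)"
    using m by (intro sum_zeta_power) auto
  also have "(d + m - j) mod m = 0 \<longleftrightarrow> d mod m = j"
  proof -
    have "(d + m - j) mod m = (d mod m + (m - j)) mod m"
    proof -
      have "d + m - j = d + (m - j)" using assms by simp
      then show ?thesis by (simp only: mod_add_left_eq)
    qed
    also have "\<dots> = (if d mod m < j then d mod m + (m - j) else d mod m - j)"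
    proof (cases "d mod m < j")
      case True
      then show ?thesis using assms by simp
    next
      case False
      then have "d mod m + (m - j) = (d mod m - j) + m" using assms by simp
      moreover have "d mod m - j < m" using mod_less_divisor[OF m, of d] by linarith
      ultimately show ?thesis using False by (simp only: mod_add_self2 mod_less if_False)
    qed
    finally show ?thesis using assms by auto
  qed
  finally show ?thesis .
qed

lemma norm_lam_le: "norm (lam m k) \<le> 3"
  using norm_triangle_ineq4[of "2 * zeta m k" 1] by (simp add: lam_def norm_mult)

lemma lam_neq_0: "lam m k \<noteq> 0"
proof
  assume "lam m k = 0"
  then have "norm (2 * zeta m k) = norm (1::complex)" by (simp add: lam_def)
  then show False by (simp add: norm_mult)
qed

lemma cnj_lam: "m > 0 \<Longrightarrow> k \<le> m \<Longrightarrow> cnj (lam m k) = lam m (m - k)"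
  by (simp add: lam_def cnj_zeta)

lemma Re_lam: "Re (lam m k) = 2 * cos (2 * pi * real k / real m) - 1"
  by (simp add: lam_def zeta_def)

lemma leaf_char_0 [simp]: "leaf_char m 0 t = of_nat (Suc (size t))"
  by (simp add: leaf_char_def leaf_sum_const)

lemma leaf_char_Leaf [simp]: "leaf_char m k Leaf = 1"
  by (simp add: leaf_char_def)

lemma leaf_char_grow_at:
  "i \<le> size t \<Longrightarrow> leaf_char m k (grow_at t i) =
     leaf_char m k t + lam m k * zeta m k ^ (leaf_depths t ! i)"
  by (simp add: leaf_char_def leaf_sum_grow_at lam_def algebra_simps)

lemma leaf_char_nth: "leaf_char m k t = (\<Sum>i\<le>size t. zeta m k ^ (leaf_depths t ! i))"
  by (simp add: leaf_char_def leaf_sum_nth)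

lemma norm_leaf_char_le: "norm (leaf_char m k t) \<le> real (Suc (size t))"
  unfolding leaf_char_nth by (rule order_trans[OF norm_sum]) (simp add: norm_power)

lemma vertex_sum_lincomb:
  fixes c :: "nat \<Rightarrow> 'b::comm_ring_1"
  shows "vertex_sum (\<lambda>d. \<Sum>k\<in>A. c k * f k d) t = (\<Sum>k\<in>A. c k * vertex_sum (f k) t)"
  by (induction A rule: infinite_finite_induct)
    (simp_all add: vertex_sum_def sum_mset.distrib sum_mset_distrib_left)

text \<open>In the Fourier inversion the term k = 0 is \<open>size t / m\<close>: moved to the left
  it is the centring. The other vertex sums are expressed by leaf sums through
  \<open>leaf_sum_power\<close>.\<close>

lemma depth_count_eq_leaf_char:
  assumes "j < m"
  shows "complex_of_real (real (depth_count m j t) - real (size t) / real m) =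
    (\<Sum>k=1..<m. cnj (zeta m k ^ j) * (leaf_char m k t - 1) / lam m k) / of_nat m"
proof -
  define V where "V = (\<lambda>k. vertex_sum (\<lambda>d. zeta m k ^ d) t)"
  have m: "m > 0" using assms by simp
  have "of_nat (depth_count m j t) =
      vertex_sum (\<lambda>d. \<Sum>k<m. cnj (zeta m k ^ j) / of_nat m * zeta m k ^ d) t"
    unfolding depth_count_eq_vertex_sum
  proof (rule arg_cong2[where f = vertex_sum], rule ext)
    fix d
    have "(\<Sum>k<m. cnj (zeta m k ^ j) / of_nat m * zeta m k ^ d) =
        (\<Sum>k<m. cnj (zeta m k ^ j) * zeta m k ^ d) / of_nat m"
      by (simp add: sum_divide_distrib)
    then show "(if d mod m = j then 1 else 0) =
        (\<Sum>k<m. cnj (zeta m k ^ j) / of_nat m * zeta m k ^ d)"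
      using m by (simp only: zeta_orthogonal[OF assms]) simp
  qed simp
  also have "\<dots> = (\<Sum>k<m. cnj (zeta m k ^ j) / of_nat m * V k)"
    by (simp only: vertex_sum_lincomb V_def)
  also have "\<dots> = V 0 / of_nat m + (\<Sum>k=1..<m. cnj (zeta m k ^ j) / of_nat m * V k)"
    using m by (simp add: lessThan_atLeast0 sum.atLeast_Suc_lessThan)
  also have "V 0 = of_nat (size t)"
    unfolding V_def zeta_0 power_one size_eq_vertex_sum ..
  also have "(\<Sum>k=1..<m. cnj (zeta m k ^ j) / of_nat m * V k) =
      (\<Sum>k=1..<m. cnj (zeta m k ^ j) * (leaf_char m k t - 1) / lam m k) / of_nat m"
    unfolding sum_divide_distrib
  proof (intro sum.cong refl)
    fix k
    have "leaf_char m k t - 1 = lam m k * V k"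
      by (simp add: leaf_char_def leaf_sum_power lam_def V_def)
    then show "cnj (zeta m k ^ j) / of_nat m * V k =
        cnj (zeta m k ^ j) * (leaf_char m k t - 1) / lam m k / of_nat m"
      using lam_neq_0 by simp
  qed
  finally show ?thesis by simp
qed

subsection \<open>Second moments\<close>

lemma norm_add_sq:
  fixes a b :: complex
  shows "(norm (a + b))\<^sup>2 = (norm a)\<^sup>2 + 2 * Re (cnj a * b) + (norm b)\<^sup>2"
  unfolding cmod_power2 by (simp add: power2_eq_square algebra_simps)

text \<open>All increments have the same modulus |lam|, and their mean over the positions is lam /
  (n + 1) times the sum itself; so the square is updated exactly.\<close>

lemma second_moment_Suc:
  "growth_mean (Suc n) (\<lambda>t. (norm (leaf_char m k t))\<^sup>2) =
   (1 + 2 * Re (lam m k) / real (Suc n)) *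
     growth_mean n (\<lambda>t. (norm (leaf_char m k t))\<^sup>2) + (norm (lam m k))\<^sup>2"
proof -
  have step: "(\<Sum>i\<le>size t. (norm (leaf_char m k (grow_at t i)))\<^sup>2) /\<^sub>R real (Suc (size t)) =
      (1 + 2 * Re (lam m k) / real (Suc n)) * (norm (leaf_char m k t))\<^sup>2 + (norm (lam m k))\<^sup>2"
    if t: "size t = n" for t :: "unit tree"
  proof -
    let ?L = "leaf_char m k t"
    have "(\<Sum>i\<le>n. (norm (leaf_char m k (grow_at t i)))\<^sup>2) =
        (\<Sum>i\<le>n. (norm ?L)\<^sup>2 + 2 * Re (cnj ?L * (lam m k * zeta m k ^ (leaf_depths t ! i))) + (norm (lam m k))\<^sup>2)"
      by (intro sum.cong refl) (simp add: leaf_char_grow_at t norm_add_sq norm_mult norm_power)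
    also have "\<dots> = real (Suc n) * (norm ?L)\<^sup>2 +
        2 * Re (cnj ?L * (lam m k * (\<Sum>i\<le>n. zeta m k ^ (leaf_depths t ! i)))) +
        real (Suc n) * (norm (lam m k))\<^sup>2"
      by (simp only: sum.distrib sum_distrib_left Re_sum sum_constant card_atMost)
    also have "(\<Sum>i\<le>n. zeta m k ^ (leaf_depths t ! i)) = ?L"
      by (simp add: leaf_char_nth t)
    also have "cnj ?L * (lam m k * ?L) = lam m k * complex_of_real ((norm ?L)\<^sup>2)"
      by (simp only: complex_norm_square mult_ac)
    also have "Re \<dots> = Re (lam m k) * (norm ?L)\<^sup>2" by (simp flip: of_real_power)
    finally show ?thesis
      by (simp only: t) (simp add: field_simps)
  qed
  have "growth_mean (Suc n) (\<lambda>t. (norm (leaf_char m k t))\<^sup>2) =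
      growth_mean n
        (\<lambda>t. (1 + 2 * Re (lam m k) / real (Suc n)) * (norm (leaf_char m k t))\<^sup>2 + (norm (lam m k))\<^sup>2)"
    unfolding expectation_growth_pmf_Suc by (intro growth_expectation_cong step)
  then show ?thesis by simp
qed

lemma second_moment_bound:
  assumes "Re (lam m k) < 1 / 2"
  shows "\<exists>C\<ge>0. \<forall>n. growth_mean n (\<lambda>t. (norm (leaf_char m k t))\<^sup>2) \<le> C * real (Suc n)"
proof -
  define a where "a = max 0 (2 * Re (lam m k))"
  have a: "0 \<le> a" "a < 1" using assms by (auto simp: a_def)
  \<comment> \<open>\<open>C\<close> solves a C + 9 = C, so the linear bound reproduces itself; 9
    bounds |lam|^2. The maximum with 0 in \<open>a\<close> keeps the factor nonnegative, as needed
    to insert the induction hypothesis.\<close>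
  define C where "C = 9 / (1 - a)"
  define M where "M = (\<lambda>n. growth_mean n (\<lambda>t. (norm (leaf_char m k t))\<^sup>2))"
  have C: "C \<ge> 9" "a * C + 9 = C" using a by (simp_all add: C_def field_simps)
  have lam: "(norm (lam m k))\<^sup>2 \<le> 9"
    using power_mono[OF norm_lam_le[of m k], of 2] by simp
  have "M n \<le> C * real (Suc n)" for n
  proof (induction n)
    case 0
    then show ?case using C by (simp add: M_def)
  next
    case (Suc n)
    have M0: "M n \<ge> 0" by (simp add: M_def)
    have "M (Suc n) \<le> (1 + a / real (Suc n)) * M n + 9"
      unfolding M_def second_moment_Suc
      using lam M0 by (intro add_mono mult_right_mono) (auto simp: a_def M_def divide_right_mono)
    also have "\<dots> \<le> (1 + a / real (Suc n)) * (C * real (Suc n)) + 9"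
      using Suc a by (intro add_mono mult_left_mono) auto
    also have "\<dots> = C * real (Suc n) + (a * C + 9)"
      by (simp add: field_simps)
    also have "\<dots> = C * real (Suc (Suc n))"
      unfolding C(2) by (simp add: algebra_simps)
    finally show ?case .
  qed
  then show ?thesis using C unfolding M_def by (intro exI[of _ C]) auto
qed

text \<open>The inequality x \<le> x^2 / s + s with s = sqrt (n + 1) takes the place of
  Cauchy-Schwarz.\<close>

lemma first_moment_bound:
  assumes "Re (lam m k) < 1 / 2"
  shows "\<exists>C\<ge>0. \<forall>n. growth_mean n (\<lambda>t. norm (leaf_char m k t)) \<le> C * sqrt (real (Suc n))"
proof -
  obtain C where C: "C \<ge> 0"
    "\<And>n. growth_mean n (\<lambda>t. (norm (leaf_char m k t))\<^sup>2) \<le> C * real (Suc n)"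
    using second_moment_bound[OF assms] by auto
  have "growth_mean n (\<lambda>t. norm (leaf_char m k t)) \<le> (C + 1) * sqrt (real (Suc n))" for n
  proof -
    define s where "s = sqrt (real (Suc n))"
    have s: "s > 0" "s * s = real (Suc n)" by (simp_all add: s_def)
    have "x \<le> x\<^sup>2 / s + s" for x :: real
    proof -
      have "0 \<le> (x - s)\<^sup>2 + x\<^sup>2 + s\<^sup>2" by simp
      then have "x * s \<le> x\<^sup>2 + s * s" by (simp add: power2_eq_square algebra_simps)
      then show ?thesis using s by (simp add: field_simps power2_eq_square)
    qed
    then have "growth_mean n (\<lambda>t. norm (leaf_char m k t)) \<le>
        growth_mean n (\<lambda>t. (norm (leaf_char m k t))\<^sup>2 / s + s)"
      by (intro growth_expectation_mono)
    also have "\<dots> = growth_mean n (\<lambda>t. (norm (leaf_char m k t))\<^sup>2) / s + s"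
      by simp
    also have "\<dots> \<le> C * (s * s) / s + s"
      unfolding s(2) using C s by (intro add_mono divide_right_mono) auto
    also have "\<dots> = (C + 1) * s" using s by (simp add: field_simps)
    finally show ?thesis by (simp add: s_def)
  qed
  then show ?thesis using C by (intro exI[of _ "C + 1"]) auto
qed

subsection \<open>One step of the characteristic function\<close>

text \<open>The identity (1 - s + s^2/2) (1 + s + s^2/2) = 1 + s^4/4 turns the lower Taylor bound
  for exp s into an upper bound for exp (-s).\<close>

lemma exp_minus_quadratic:
  fixes s :: real
  assumes "s \<ge> 0"
  shows "\<bar>exp (- s) - (1 - s)\<bar> \<le> s\<^sup>2 / 2"
proof -
  have "1 - s \<le> exp (- s)" using exp_ge_add_one_self[of "-s"] by simp
  moreover have "exp (- s) \<le> 1 - s + s\<^sup>2 / 2"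
  proof -
    have q: "1 + s + s\<^sup>2 / 2 \<le> exp s" by (rule exp_lower_Taylor_quadratic[OF assms])
    have "1 - s + s\<^sup>2 / 2 = ((1 - s)\<^sup>2 + 1) / 2" by (simp add: power2_eq_square field_simps)
    also have "\<dots> > 0" by (intro divide_pos_pos add_nonneg_pos) auto
    finally have pos: "1 - s + s\<^sup>2 / 2 > 0" .
    have "1 \<le> 1 + (s\<^sup>2)\<^sup>2 / 4" by simp
    also have "\<dots> = (1 - s + s\<^sup>2 / 2) * (1 + s + s\<^sup>2 / 2)"
      by (simp add: power2_eq_square field_simps)
    also have "\<dots> \<le> (1 - s + s\<^sup>2 / 2) * exp s"
      using q pos by (intro mult_left_mono) auto
    finally show ?thesis by (simp add: exp_minus field_simps)
  qed
  ultimately show ?thesis by simp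
qed

lemma norm_cis_taylor: "norm (cis x - (1 + \<i> * of_real x - of_real (x\<^sup>2 / 2))) \<le> \<bar>x\<bar> ^ 3 / 6"
proof -
  have "(\<Sum>k\<le>2. (\<i> * complex_of_real x) ^ k / fact k) = 1 + \<i> * of_real x - of_real (x\<^sup>2 / 2)"
    by (simp add: numeral_2_eq_2 power_mult_distrib)
  then show ?thesis
    using iexp_approx1[of x 2] by (simp add: cis_conv_exp numeral_3_eq_3 fact_numeral)
qed

text \<open>Both terms are compared with their expansions 1 - V/2 and 1 - v/2; the linear term drops
  out because the mean is 0. The variance \<open>v\<close> is free, since the comparison will be
  with a deterministic one.\<close>

lemma norm_avg_cis_minus_gauss:
  fixes x :: "nat \<Rightarrow> real"
  assumes "(\<Sum>i\<le>n. x i) = 0" and B: "\<And>i. i \<le> n \<Longrightarrow> \<bar>x i\<bar> \<le> B" and v: "v \<ge> 0"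
  shows "norm ((\<Sum>i\<le>n. cis (x i)) /\<^sub>R real (Suc n) - of_real (exp (- v / 2))) \<le>
    B ^ 3 / 6 + \<bar>(\<Sum>i\<le>n. (x i)\<^sup>2) / real (Suc n) - v\<bar> / 2 + v\<^sup>2 / 8"
proof -
  define V where "V = (\<Sum>i\<le>n. (x i)\<^sup>2) / real (Suc n)"
  define T where "T = (\<lambda>x. 1 + \<i> * of_real x - of_real (x\<^sup>2 / 2) :: complex)"
  have "norm (\<Sum>i\<le>n. cis (x i) - T (x i)) \<le> (\<Sum>i\<le>n. B ^ 3 / 6)"
  proof (rule sum_norm_le)
    fix i assume "i \<in> {..n}"
    then have "\<bar>x i\<bar> ^ 3 \<le> B ^ 3" by (intro power_mono B) auto
    then show "norm (cis (x i) - T (x i)) \<le> B ^ 3 / 6"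
      unfolding T_def using norm_cis_taylor[of "x i"] by simp
  qed
  then have 1: "norm ((\<Sum>i\<le>n. cis (x i) - T (x i)) /\<^sub>R real (Suc n)) \<le> B ^ 3 / 6"
    by (simp add: field_simps)
  have "(\<Sum>i\<le>n. T (x i)) = of_nat (Suc n) + \<i> * of_real (\<Sum>i\<le>n. x i) - of_real ((\<Sum>i\<le>n. (x i)\<^sup>2) / 2)"
    by (simp add: T_def sum.distrib sum_subtractf sum_distrib_left sum_divide_distrib)
  also have "\<dots> = real (Suc n) *\<^sub>R of_real (1 - V / 2)"
  proof -
    have "(\<Sum>i\<le>n. (x i)\<^sup>2) = real (Suc n) * V" by (simp add: V_def)
    then show ?thesis
      by (simp only: assms(1) scaleR_conv_of_real of_real_diff of_real_mult of_real_divide)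
        (simp add: ring_distribs)
  qed
  finally have 2: "(\<Sum>i\<le>n. T (x i)) /\<^sub>R real (Suc n) = of_real (1 - V / 2)" by simp
  have 3: "norm (of_real (exp (- v / 2)) - of_real (1 - v / 2) :: complex) \<le> v\<^sup>2 / 8"
    using exp_minus_quadratic[of "v / 2"] v
    by (simp add: power2_eq_square flip: of_real_diff)
  have "(\<Sum>i\<le>n. cis (x i)) /\<^sub>R real (Suc n) - of_real (exp (- v / 2)) =
     (\<Sum>i\<le>n. cis (x i) - T (x i)) /\<^sub>R real (Suc n) + of_real ((v - V) / 2)
     - (of_real (exp (- v / 2)) - of_real (1 - v / 2))"
    using 2 by (simp add: sum_subtractf scaleR_diff_right field_simps)
  also have "norm \<dots> \<le> norm ((\<Sum>i\<le>n. cis (x i) - T (x i)) /\<^sub>R real (Suc n)) +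
      norm (of_real ((v - V) / 2) :: complex) + norm (of_real (exp (- v / 2)) - of_real (1 - v / 2) :: complex)"
    by (rule order_trans[OF norm_triangle_ineq4]) (intro add_mono norm_triangle_ineq order_refl)
  also have "\<dots> \<le> B ^ 3 / 6 + \<bar>V - v\<bar> / 2 + v\<^sup>2 / 8"
    using 1 3 by (intro add_mono) (simp_all only: norm_of_real, simp)
  finally show ?thesis by (simp add: V_def)
qed

text \<open>The distance from equidistribution modulo \<open>m\<close>: the moduli of all nontrivial
  Fourier coefficients of the empirical distribution of the depths of the free positions, added
  up.\<close>

definition spread :: "nat \<Rightarrow> 'a tree \<Rightarrow> real" where
  "spread m t = (\<Sum>k=1..<m. norm (leaf_char m k t)) / real (Suc (size t))"

lemma spread_nonneg: "spread m t \<ge> 0"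
  by (simp add: spread_def sum_nonneg)

lemma norm_leaf_char_le_spread:
  assumes "k \<in> {1..<m}"
  shows "norm (leaf_char m k t) / real (Suc (size t)) \<le> spread m t"
  unfolding spread_def using assms
  by (intro divide_right_mono member_le_sum) auto

text \<open>
  In the square of the sum, the diagonal terms give \<open>\<Sum> |c k|\<^sup>2\<close> and the others are leaf sums of
  powers of nontrivial roots of unity, which \<^const>\<open>spread\<close> controls.
\<close>

lemma leaf_mean_square:
  fixes c :: "nat \<Rightarrow> complex" and t :: "unit tree"
  assumes m: "m > 0" and sym: "\<And>k. k \<in> {1..<m} \<Longrightarrow> c (m - k) = cnj (c k)"
  defines "y \<equiv> \<lambda>i. Re (\<Sum>k=1..<m. c k * zeta m k ^ (leaf_depths t ! i))"
    and "C \<equiv> \<Sum>k=1..<m. norm (c k)"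
  shows "\<bar>(\<Sum>i\<le>size t. (y i)\<^sup>2) / real (Suc (size t)) - (\<Sum>k=1..<m. (norm (c k))\<^sup>2)\<bar> \<le> C\<^sup>2 * spread m t"
    and "\<bar>(\<Sum>i\<le>size t. y i) / real (Suc (size t))\<bar> \<le> C * spread m t"
    and "\<bar>y i\<bar> \<le> C"
    and "(\<Sum>k=1..<m. (norm (c k))\<^sup>2) \<le> C\<^sup>2"
proof -
  let ?K = "{1..<m}"
  define \<eta> where "\<eta> = (\<lambda>i. \<Sum>k=1..<m. c k * zeta m k ^ (leaf_depths t ! i))"
  define N where "N = real (Suc (size t))"
  have N: "N > 0" by (simp add: N_def)
  have C0: "C \<ge> 0" unfolding C_def by (intro sum_nonneg) auto
  have "norm (\<eta> i) \<le> C" for i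
    unfolding \<eta>_def C_def by (rule sum_norm_le) (simp add: norm_mult norm_power)
  then show "\<bar>y i\<bar> \<le> C"
    unfolding y_def using abs_Re_le_cmod order_trans by (fastforce simp: \<eta>_def)
  have "(\<Sum>i\<le>size t. y i) = Re (\<Sum>k=1..<m. c k * leaf_char m k t)"
    unfolding y_def leaf_char_nth sum_distrib_left by (subst sum.swap) (simp add: Re_sum)
  also have "\<bar>\<dots>\<bar> \<le> (\<Sum>k=1..<m. norm (c k) * norm (leaf_char m k t))"
    by (rule order_trans[OF abs_Re_le_cmod sum_norm_le]) (simp add: norm_mult)
  finally have "\<bar>\<Sum>i\<le>size t. y i\<bar> / N \<le> (\<Sum>k=1..<m. norm (c k) * norm (leaf_char m k t)) / N"
    using N by (intro divide_right_mono) auto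
  also have "\<dots> = (\<Sum>k=1..<m. norm (c k) * (norm (leaf_char m k t) / N))"
    by (simp add: sum_divide_distrib)
  also have "\<dots> \<le> (\<Sum>k=1..<m. norm (c k) * spread m t)"
    unfolding N_def by (intro sum_mono mult_left_mono norm_leaf_char_le_spread) auto
  also have "\<dots> = C * spread m t" by (simp add: C_def sum_distrib_right)
  finally show "\<bar>(\<Sum>i\<le>size t. y i) / real (Suc (size t))\<bar> \<le> C * spread m t"
    by (simp add: N_def)
  \<comment> \<open>The symmetry of \<open>c\<close> makes \<eta> real, so the square of its real
    part is \<eta> times its conjugate. The products of characters then have index k - j modulo m,
    which is 0 exactly on the diagonal.\<close>
  have "cnj (\<eta> i) = \<eta> i" for i
  proof -
    have "cnj (\<eta> i) = (\<Sum>k=1..<m. c (m - k) * zeta m (m - k) ^ (leaf_depths t ! i))"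
      unfolding \<eta>_def cnj_sum using m by (intro sum.cong) (auto simp: sym cnj_zeta)
    also have "\<dots> = \<eta> i" unfolding \<eta>_def
      by (rule sum.reindex_bij_witness[of _ "\<lambda>k. m - k" "\<lambda>k. m - k"]) auto
    finally show ?thesis .
  qed
  note self_conj = this
  have real: "\<eta> i = of_real (y i)" for i
  proof (rule complex_eqI)
    show "Re (\<eta> i) = Re (of_real (y i))" by (simp only: y_def \<eta>_def Re_complex_of_real)
    show "Im (\<eta> i) = Im (of_real (y i))"
      using self_conj[of i] by (simp add: complex_eq_iff)
  qed
  define P where "P = (\<lambda>k j. c k * cnj (c j) * leaf_char m ((k + m - j) mod m) t)"
  have "complex_of_real (\<Sum>i\<le>size t. (y i)\<^sup>2) = (\<Sum>i\<le>size t. \<eta> i * cnj (\<eta> i))"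
    by (simp add: real power2_eq_square)
  also have "\<dots> = (\<Sum>i\<le>size t. \<Sum>k\<in>?K. \<Sum>j\<in>?K. c k * cnj (c j) * zeta m ((k + m - j) mod m) ^ (leaf_depths t ! i))"
    unfolding \<eta>_def cnj_sum sum_product
  proof (intro sum.cong refl)
    fix i k j assume "k \<in> ?K" "j \<in> ?K"
    then have "zeta m ((k + m - j) mod m) = zeta m k * cnj (zeta m j)"
      by (intro zeta_mult_cnj[symmetric]) auto
    then show "c k * zeta m k ^ (leaf_depths t ! i) * cnj (c j * zeta m j ^ (leaf_depths t ! i)) =
        c k * cnj (c j) * zeta m ((k + m - j) mod m) ^ (leaf_depths t ! i)"
      by (simp add: power_mult_distrib)
  qed
  also have "\<dots> = (\<Sum>k\<in>?K. \<Sum>j\<in>?K. P k j)"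
    unfolding P_def leaf_char_nth sum_distrib_left
    by (rule trans[OF sum.swap]) (intro sum.cong refl sum.swap)
  also have "\<dots> = (\<Sum>k\<in>?K. P k k + (\<Sum>j\<in>?K - {k}. P k j))"
    by (intro sum.cong refl sum.remove) auto
  also have "\<dots> = of_real (N * (\<Sum>k\<in>?K. (norm (c k))\<^sup>2)) + (\<Sum>k\<in>?K. \<Sum>j\<in>?K - {k}. P k j)"
  proof -
    have "P k k = of_real (N * (norm (c k))\<^sup>2)" for k
      by (simp add: P_def N_def complex_norm_square mult_ac del: of_nat_Suc flip: of_real_power)
    then show ?thesis by (simp add: sum.distrib sum_distrib_left)
  qed
  finally have "complex_of_real ((\<Sum>i\<le>size t. (y i)\<^sup>2) - N * (\<Sum>k\<in>?K. (norm (c k))\<^sup>2)) =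
      (\<Sum>k\<in>?K. \<Sum>j\<in>?K - {k}. P k j)"
    by simp
  then have "\<bar>(\<Sum>i\<le>size t. (y i)\<^sup>2) - N * (\<Sum>k\<in>?K. (norm (c k))\<^sup>2)\<bar> =
      norm (\<Sum>k\<in>?K. \<Sum>j\<in>?K - {k}. P k j)"
    unfolding norm_of_real[symmetric, where 'a = complex] by (simp only:)
  also have "\<dots> \<le> (\<Sum>k\<in>?K. \<Sum>j\<in>?K - {k}. norm (c k) * norm (c j) * (N * spread m t))"
  proof (intro sum_norm_le)
    fix k j assume kj: "k \<in> ?K" "j \<in> ?K - {k}"
    have "(k + m - j) mod m \<in> ?K"
    proof (cases "k < j")
      case True
      then have "(k + m - j) mod m = k + m - j" using kj by (intro mod_less) auto
      then show ?thesis using kj True by auto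
    next
      case False
      then have "k + m - j = (k - j) + m" using kj by auto
      moreover have "k - j < m" using kj by auto
      ultimately have "(k + m - j) mod m = k - j" by (simp only: mod_add_self2 mod_less)
      then show ?thesis using kj False by auto
    qed
    then have "norm (leaf_char m ((k + m - j) mod m) t) \<le> N * spread m t"
      using norm_leaf_char_le_spread[of "(k + m - j) mod m" m t] N by (simp add: N_def field_simps)
    then show "norm (P k j) \<le> norm (c k) * norm (c j) * (N * spread m t)"
      by (simp add: P_def norm_mult mult_left_mono)
  qed
  also have "\<dots> \<le> (\<Sum>k\<in>?K. \<Sum>j\<in>?K. norm (c k) * norm (c j) * (N * spread m t))"
    using N spread_nonneg[of m t] by (intro sum_mono sum_mono2) auto
  also have "\<dots> = N * (C\<^sup>2 * spread m t)"
    by (simp add: C_def power2_eq_square sum_product sum_distrib_right sum_distrib_left mult_ac)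
  finally have "\<bar>(\<Sum>i\<le>size t. (y i)\<^sup>2) - N * (\<Sum>k\<in>?K. (norm (c k))\<^sup>2)\<bar> / N \<le> N * (C\<^sup>2 * spread m t) / N"
    using N by (intro divide_right_mono) auto
  moreover have "\<bar>S - N * v\<bar> / N = \<bar>S / N - v\<bar>" for S v
  proof -
    have "S / N - v = (S - N * v) / N" using N by (simp add: diff_divide_distrib)
    then show ?thesis using N by simp
  qed
  ultimately show "\<bar>(\<Sum>i\<le>size t. (y i)\<^sup>2) / real (Suc (size t)) - (\<Sum>k=1..<m. (norm (c k))\<^sup>2)\<bar> \<le> C\<^sup>2 * spread m t"
    using N by (simp add: N_def)
  have "(\<Sum>k\<in>?K. (norm (c k))\<^sup>2) \<le> (\<Sum>k\<in>?K. norm (c k) * C)"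
    unfolding power2_eq_square C_def by (intro sum_mono mult_left_mono member_le_sum) auto
  then show "(\<Sum>k=1..<m. (norm (c k))\<^sup>2) \<le> C\<^sup>2"
    by (simp add: C_def power2_eq_square sum_distrib_right)
qed

text \<open>The mean increment \<open>a\<close> moves into the phase, where it is exactly the effect
  of the factors 1 + lam / (n + 1). After division by the unimodular \<open>cis (F + a)\<close> only
  centred increments remain, with a variance that differs from \<open>v\<close> by a multiple of
  \<open>spread\<close>.\<close>

lemma one_step_estimate:
  fixes b :: "nat \<Rightarrow> complex" and t :: "unit tree"
  assumes m: "m > 0" and sym: "\<And>k. k \<in> {1..<m} \<Longrightarrow> b (m - k) = cnj (b k)"
    and t: "size t = n"
  defines "B \<equiv> 3 * (\<Sum>k=1..<m. norm (b k))"
    and "v \<equiv> \<Sum>k=1..<m. (norm (b k) * norm (lam m k))\<^sup>2"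
  shows "norm ((\<Sum>i\<le>n. cis (Re (\<Sum>k=1..<m. b k * leaf_char m k (grow_at t i)))) /\<^sub>R real (Suc n) -
      cis (Re (\<Sum>k=1..<m. b k * (1 + lam m k / of_nat (Suc n)) * leaf_char m k t)) * of_real (exp (- v / 2)))
    \<le> 2 * B ^ 3 + B ^ 4 + B\<^sup>2 * spread m t"
proof -
  define c where "c = (\<lambda>k. b k * lam m k)"
  define C where "C = (\<Sum>k=1..<m. norm (c k))"
  define y where "y = (\<lambda>i. Re (\<Sum>k=1..<m. c k * zeta m k ^ (leaf_depths t ! i)))"
  define a where "a = (\<Sum>i\<le>n. y i) / real (Suc n)"
  define F where "F = Re (\<Sum>k=1..<m. b k * leaf_char m k t)"
  define S where "S = spread m t"
  have S: "S \<ge> 0" by (simp add: S_def spread_nonneg)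
  have csym: "c (m - k) = cnj (c k)" if "k \<in> {1..<m}" for k
    using that m by (simp add: c_def sym cnj_lam)
  have v_eq: "v = (\<Sum>k=1..<m. (norm (c k))\<^sup>2)"
    by (simp add: v_def c_def norm_mult)
  have v0: "v \<ge> 0" by (simp add: v_def sum_nonneg)
  have y_le_C: "\<bar>y i\<bar> \<le> C" for i
    unfolding y_def C_def by (rule leaf_mean_square(3)[where c = c]) (use m csym in auto)
  have ms1: "\<bar>(\<Sum>i\<le>n. (y i)\<^sup>2) / real (Suc n) - v\<bar> \<le> C\<^sup>2 * S"
    using leaf_mean_square(1)[of m c t, OF m csym] by (simp only: y_def C_def S_def v_eq t)
  have ms2: "\<bar>(\<Sum>i\<le>n. y i) / real (Suc n)\<bar> \<le> C * S"
    using leaf_mean_square(2)[of m c t, OF m csym] by (simp only: y_def C_def S_def t)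
  have ms4: "v \<le> C\<^sup>2"
    using leaf_mean_square(4)[of m c, OF m csym] by (simp only: C_def v_eq)
  have C0: "C \<ge> 0" by (simp add: C_def sum_nonneg)
  have CB: "C \<le> B"
    unfolding C_def B_def sum_distrib_left c_def norm_mult
    using mult_left_mono[OF norm_lam_le norm_ge_zero]
    by (intro sum_mono) (simp add: mult.commute[of 3])
  have grow: "Re (\<Sum>k=1..<m. b k * leaf_char m k (grow_at t i)) = F + y i" if "i \<le> n" for i
    using that by (simp add: leaf_char_grow_at t F_def y_def c_def ring_distribs sum.distrib mult_ac)
  have mean: "Re (\<Sum>k=1..<m. b k * (1 + lam m k / of_nat (Suc n)) * leaf_char m k t) = F + a"
  proof -
    have "(\<Sum>i\<le>n. y i) = Re (\<Sum>k=1..<m. c k * leaf_char m k t)"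
      unfolding y_def leaf_char_nth sum_distrib_left t by (subst sum.swap) (simp add: Re_sum)
    then have "a = Re (\<Sum>k=1..<m. c k * leaf_char m k t) / real (Suc n)" by (simp add: a_def)
    also have "\<dots> = Re ((\<Sum>k=1..<m. c k * leaf_char m k t) / of_real (real (Suc n)))"
      by (simp only: Re_divide_of_real)
    finally show ?thesis
      by (simp add: F_def c_def ring_distribs sum.distrib sum_divide_distrib mult_ac)
  qed
  have a_abs: "\<bar>a\<bar> \<le> C * S" "\<bar>a\<bar> \<le> C"
  proof -
    show "\<bar>a\<bar> \<le> C * S" using ms2 by (simp add: a_def)
    have "\<bar>\<Sum>i\<le>n. y i\<bar> \<le> (\<Sum>i\<le>n. C)"
      by (rule order_trans[OF sum_abs sum_mono]) (rule y_le_C)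
    then show "\<bar>a\<bar> \<le> C" by (simp add: a_def field_simps)
  qed
  have sum0: "(\<Sum>i\<le>n. y i - a) = 0"
    by (simp only: sum_subtractf sum_constant card_atMost) (simp add: a_def)
  have bound: "\<bar>y i - a\<bar> \<le> 2 * B" for i
    using y_le_C[of i] a_abs(2) CB by linarith
  have sq: "(\<Sum>i\<le>n. (y i - a)\<^sup>2) / real (Suc n) = (\<Sum>i\<le>n. (y i)\<^sup>2) / real (Suc n) - a\<^sup>2"
  proof -
    have "(\<Sum>i\<le>n. (y i - a)\<^sup>2) = (\<Sum>i\<le>n. (y i)\<^sup>2) - 2 * a * (\<Sum>i\<le>n. y i) + real (Suc n) * a\<^sup>2"
      by (simp add: power2_diff sum.distrib sum_subtractf sum_distrib_left mult_ac)
    also have "(\<Sum>i\<le>n. y i) = real (Suc n) * a" by (simp add: a_def)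
    finally show ?thesis by (simp add: field_simps power2_eq_square)
  qed
  have var: "\<bar>(\<Sum>i\<le>n. (y i - a)\<^sup>2) / real (Suc n) - v\<bar> \<le> 2 * (B\<^sup>2 * S)"
  proof -
    \<comment> \<open>Two bounds for |a| are multiplied, the trivial one and the one by the spread,
      so that the centring correction of the variance is linear in the spread too.\<close>
    have "a\<^sup>2 \<le> C\<^sup>2 * S"
      using mult_mono[OF a_abs(2,1)] C0 by (simp add: power2_eq_square mult.assoc)
    moreover have "C\<^sup>2 * S \<le> B\<^sup>2 * S" using C0 CB S by (intro mult_right_mono power_mono)
    moreover have "0 \<le> a\<^sup>2" by simp
    ultimately show ?thesis using ms1 unfolding sq by linarith
  qed
  have v4: "v\<^sup>2 \<le> B ^ 4"
  proof -
    have "v \<le> B\<^sup>2" using ms4 power_mono[OF CB C0, of 2] by linarith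
    then have "v\<^sup>2 \<le> (B\<^sup>2)\<^sup>2" using v0 by (intro power_mono)
    then show ?thesis by (simp flip: power_mult)
  qed
  have "norm ((\<Sum>i\<le>n. cis (y i - a)) /\<^sub>R real (Suc n) - of_real (exp (- v / 2))) \<le>
      (2 * B) ^ 3 / 6 + \<bar>(\<Sum>i\<le>n. (y i - a)\<^sup>2) / real (Suc n) - v\<bar> / 2 + v\<^sup>2 / 8"
    by (rule norm_avg_cis_minus_gauss) (use sum0 bound v0 in auto)
  also have "\<dots> \<le> 2 * B ^ 3 + B ^ 4 + B\<^sup>2 * S"
  proof -
    have "0 \<le> B ^ 3" "0 \<le> B ^ 4" using C0 CB by auto
    moreover have "(2 * B) ^ 3 = 8 * B ^ 3" by (simp add: power_mult_distrib)
    moreover have "X / 6 + U / 2 + w / 8 \<le> 2 * x + z + y'"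
      if "0 \<le> x" "0 \<le> z" "X = 8 * x" "U \<le> 2 * y'" "w \<le> z" for X U w x y' z :: real
      using that by linarith
    ultimately show ?thesis using var v4 by blast
  qed
  also have "(\<Sum>i\<le>n. cis (y i - a)) /\<^sub>R real (Suc n) - of_real (exp (- v / 2)) =
    cis (- (F + a)) * ((\<Sum>i\<le>n. cis (F + y i)) /\<^sub>R real (Suc n) - cis (F + a) * of_real (exp (- v / 2)))"
  proof -
    have "cis (- (F + a)) * cis (F + y i) = cis (y i - a)" for i by (simp add: cis_mult)
    moreover have "cis (- (F + a)) * cis (F + a) = 1" by (simp add: cis_mult)
    ultimately show ?thesis
      by (simp add: right_diff_distrib sum_distrib_left flip: mult.assoc)
  qed
  also have "norm \<dots> = norm ((\<Sum>i\<le>n. cis (F + y i)) /\<^sub>R real (Suc n) - cis (F + a) * of_real (exp (- v / 2)))"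
    by (simp add: norm_mult)
  also have "(\<Sum>i\<le>n. cis (F + y i)) =
      (\<Sum>i\<le>n. cis (Re (\<Sum>k=1..<m. b k * leaf_char m k (grow_at t i))))"
    by (intro sum.cong refl arg_cong[where f = cis] grow[symmetric]) simp
  finally show ?thesis by (simp only: mean S_def)
qed

subsection \<open>Convergence of the characteristic functions\<close>

text \<open>The factor by which the conditional mean of \<open>leaf_char\<close> is multiplied while
  the tree grows from size \<open>l\<close> to size \<open>n\<close>.\<close>

definition growth_prod :: "nat \<Rightarrow> nat \<Rightarrow> nat \<Rightarrow> nat \<Rightarrow> complex" where
  "growth_prod m k l n = (\<Prod>i\<in>{l..<n}. 1 + lam m k / of_nat (Suc i))"

lemma growth_prod_self [simp]: "growth_prod m k n n = 1"
  by (simp add: growth_prod_def)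

lemma growth_prod_left:
  "l < n \<Longrightarrow> growth_prod m k l n = (1 + lam m k / of_nat (Suc l)) * growth_prod m k (Suc l) n"
  by (simp add: growth_prod_def prod.atLeast_Suc_lessThan)

lemma growth_prod_right:
  "l \<le> n \<Longrightarrow> growth_prod m k l (Suc n) = growth_prod m k l n * (1 + lam m k / of_nat (Suc n))"
  by (simp add: growth_prod_def prod.atLeastLessThan_Suc)

lemma cnj_growth_prod:
  "m > 0 \<Longrightarrow> k \<le> m \<Longrightarrow> cnj (growth_prod m k l n) = growth_prod m (m - k) l n"
  by (simp add: growth_prod_def cnj_lam)

text \<open>
  An upper bound for \<open>|1 + w / (i + 1)|\<close> if \<open>|w| \<le> 3\<close> and \<open>Re w \<le> 9 / 20\<close>; the number \<open>9 / 20\<close>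
  lies between \<open>2 cos (\<pi> / 4) - 1\<close>, the extreme case \<open>m = 8\<close>, and the critical value \<open>1 / 2\<close>.
\<close>

definition rate :: "nat \<Rightarrow> real" where
  "rate i = sqrt (1 + 9 / 10 / real (Suc i) + 9 / (real (Suc i))\<^sup>2)"

definition rate_prod :: "nat \<Rightarrow> nat \<Rightarrow> real" where
  "rate_prod l n = (\<Prod>i\<in>{l..<n}. rate i)"

lemma rate_nonneg: "rate i \<ge> 0"
  by (simp add: rate_def add_nonneg_nonneg)

lemma rate_prod_nonneg: "rate_prod l n \<ge> 0"
  by (simp add: rate_prod_def prod_nonneg rate_nonneg)

lemma rate_prod_right: "l \<le> n \<Longrightarrow> rate_prod l (Suc n) = rate_prod l n * rate n"
  by (simp add: rate_prod_def prod.atLeastLessThan_Suc)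

lemma rate_prod_self [simp]: "rate_prod n n = 1"
  by (simp add: rate_prod_def)

lemma norm_growth_prod_le:
  assumes "Re (lam m k) \<le> 9 / 20"
  shows "norm (growth_prod m k l n) \<le> rate_prod l n"
  unfolding growth_prod_def rate_prod_def prod_norm[symmetric]
proof (rule prod_mono, intro conjI norm_ge_zero)
  fix i
  have lam: "(norm (lam m k))\<^sup>2 \<le> 9"
    using power_mono[OF norm_lam_le[of m k], of 2] by simp
  have "(norm (1 + lam m k / of_nat (Suc i)))\<^sup>2 \<le> 1 + 9 / 10 / real (Suc i) + 9 / (real (Suc i))\<^sup>2"
    unfolding norm_one_plus_div_sq using assms lam
    by (intro add_mono divide_right_mono) auto
  then show "norm (1 + lam m k / of_nat (Suc i)) \<le> rate i"
    unfolding rate_def by (rule real_le_rsqrt)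
qed

text \<open>\<open>q n\<close> is the step factor of
  \<open>(rate_prod l n / sqrt (real n))\<^sup>2\<close>. The limit is 9/10 - 1, negative because
  9/20 lies below the critical value 1/2.\<close>

lemma rate_limits:
  defines "q \<equiv> \<lambda>n. (rate n)\<^sup>2 * (real n / real (Suc n))"
  shows "(\<lambda>n. real (Suc n) * (q n - 1)) \<longlonglongrightarrow> - (1 / 10)"
    and "\<forall>\<^sub>F n in sequentially. q n \<le> 1"
    and "q n \<ge> 0"
proof -
  have q: "q n = (1 + 9 / 10 / real (Suc n) + 9 / (real (Suc n))\<^sup>2) * (real n / real (Suc n))" for n
    by (simp add: q_def rate_def add_nonneg_nonneg)
  show lim: "(\<lambda>n. real (Suc n) * (q n - 1)) \<longlonglongrightarrow> - (1 / 10)"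
    unfolding q by real_asymp
  have "\<forall>\<^sub>F n in sequentially. real (Suc n) * (q n - 1) < 0"
    by (rule order_tendstoD(2)[OF lim]) simp
  then show "\<forall>\<^sub>F n in sequentially. q n \<le> 1"
    by eventually_elim (simp add: mult_less_0_iff)
  show "q n \<ge> 0" by (simp add: q_def)
qed

text \<open>The errors of the replacement argument add up to sums of this form. From n to n + 1 all
  old terms acquire the factor \<open>sqrt (q n) ^ p\<close>, at most \<open>q n\<close> since p
  \<ge> 2 and eventually q n \<le> 1; the new term with l = n is the error of the
  contraction.\<close>

lemma weighted_rate_sum_tendsto_0:
  assumes p: "p \<ge> 2" and e: "\<And>n. e n \<ge> 0"
    and lim: "(\<lambda>n. real (Suc n) * e n / sqrt (real (Suc n)) ^ p) \<longlonglongrightarrow> 0"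
  shows "(\<lambda>n. \<Sum>l<n. e l * (rate_prod (Suc l) n / sqrt (real n)) ^ p) \<longlonglongrightarrow> 0"
proof (rule contraction_tendsto_0[OF rate_limits(1) _ lim])
  define y where "y = (\<lambda>n. \<Sum>l<n. e l * (rate_prod (Suc l) n / sqrt (real n)) ^ p)"
  define q where "q = (\<lambda>n. (rate n)\<^sup>2 * (real n / real (Suc n)))"
  show y0: "y n \<ge> 0" for n
    unfolding y_def by (intro sum_nonneg mult_nonneg_nonneg e zero_le_power divide_nonneg_nonneg rate_prod_nonneg) auto
  show "\<forall>\<^sub>F n in sequentially. y (Suc n) \<le> \<bar>q n\<bar> * y n +
      real (Suc n) * e n / sqrt (real (Suc n)) ^ p / real (Suc n)"
    using rate_limits(2) eventually_gt_at_top[of 0]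
  proof eventually_elim
    case (elim n)
    have q: "0 \<le> q n" "q n \<le> 1" using elim rate_limits(3) by (auto simp: q_def)
    have sq: "rate n * (sqrt (real n) / sqrt (real (Suc n))) = sqrt (q n)"
      using rate_nonneg by (simp add: q_def real_sqrt_mult real_sqrt_divide)
    have "e l * (rate_prod (Suc l) (Suc n) / sqrt (real (Suc n))) ^ p =
        sqrt (q n) ^ p * (e l * (rate_prod (Suc l) n / sqrt (real n)) ^ p)" if "l < n" for l
    proof -
      have "rate_prod (Suc l) (Suc n) / sqrt (real (Suc n)) = sqrt (q n) * (rate_prod (Suc l) n / sqrt (real n))"
        using that elim(2) by (simp add: rate_prod_right flip: sq)
      then show ?thesis by (simp only: power_mult_distrib mult_ac)
    qed
    then have "(\<Sum>l<n. e l * (rate_prod (Suc l) (Suc n) / sqrt (real (Suc n))) ^ p) = sqrt (q n) ^ p * y n"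
      unfolding y_def sum_distrib_left by (intro sum.cong refl) auto
    then have "y (Suc n) = sqrt (q n) ^ p * y n + e n * (1 / sqrt (real (Suc n))) ^ p"
      by (simp add: y_def del: of_nat_Suc)
    moreover have "sqrt (q n) ^ p \<le> sqrt (q n) ^ 2"
      using q p by (intro power_decreasing) auto
    then have "sqrt (q n) ^ p * y n \<le> \<bar>q n\<bar> * y n"
      using q by (intro mult_right_mono y0) auto
    ultimately show ?case by (simp add: power_divide)
  qed
qed simp

text \<open>Below the critical value, the influence of the initial tree is lost on the scale sqrt
  n.\<close>

lemma rate_prod_0_tendsto_0: "(\<lambda>n. rate_prod 0 n / sqrt (real n)) \<longlonglongrightarrow> 0"
proof -
  define y where "y = (\<lambda>n. (rate_prod 0 n / sqrt (real n))\<^sup>2)"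
  have "y \<longlonglongrightarrow> 0"
  proof (rule contraction_tendsto_0[OF rate_limits(1)])
    show "\<forall>\<^sub>F n in sequentially. y (Suc n) \<le>
        \<bar>(rate n)\<^sup>2 * (real n / real (Suc n))\<bar> * y n + 0 / real (Suc n)"
      using eventually_gt_at_top[of 0]
      by eventually_elim (simp add: y_def rate_prod_right power_divide power_mult_distrib abs_mult mult.commute)
  qed (auto simp: y_def)
  then have "(\<lambda>n. sqrt (y n)) \<longlonglongrightarrow> sqrt 0" by (intro tendsto_real_sqrt)
  then show ?thesis by (simp add: y_def rate_prod_nonneg)
qed

text \<open>In the step to n + 1 all old terms are multiplied by the same |1 + lam / (n + 1)|^2, and
  the new term is an empty product; this is the affine recursion with a = 2 Re lam and b =
  1.\<close>

lemma growth_prod_square_sum_limit: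
  assumes "Re (lam m k) < 1 / 2"
  shows "(\<lambda>n. (\<Sum>l<n. (norm (growth_prod m k (Suc l) n))\<^sup>2) / real n) \<longlonglongrightarrow> 1 / (1 - 2 * Re (lam m k))"
proof (rule affine_recursion_limit)
  fix n
  have "(\<Sum>l<n. (norm (growth_prod m k (Suc l) (Suc n)))\<^sup>2) =
      (\<Sum>l<n. (norm (1 + lam m k / of_nat (Suc n)))\<^sup>2 * (norm (growth_prod m k (Suc l) n))\<^sup>2)"
    by (intro sum.cong refl) (simp add: growth_prod_right norm_mult power_mult_distrib)
  then show "(\<Sum>l<Suc n. (norm (growth_prod m k (Suc l) (Suc n)))\<^sup>2) =
      (1 + 2 * Re (lam m k) / real (Suc n) + (norm (lam m k))\<^sup>2 / (real (Suc n))\<^sup>2) *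
      (\<Sum>l<n. (norm (growth_prod m k (Suc l) n))\<^sup>2) + 1"
    unfolding norm_one_plus_div_sq by (simp add: sum_distrib_left)
qed (use assms in simp)

text \<open>A replacement argument of Lindeberg type. The phase of \<open>h n l\<close> predicts the
  final statistic from the tree of size \<open>l\<close>, and its damping factor carries the
  variance of the steps still to come. Moving \<open>l\<close> by one trades a random increment for
  a Gaussian factor.\<close>

lemma char_fun_limit:
  fixes a :: "nat \<Rightarrow> complex"
  assumes m: "m > 0" and lam: "\<And>k. k \<in> {1..<m} \<Longrightarrow> Re (lam m k) \<le> 9 / 20"
    and sym: "\<And>k. k \<in> {1..<m} \<Longrightarrow> a (m - k) = cnj (a k)"
  shows "(\<lambda>n. growth_mean n
      (\<lambda>t. cis (Re (\<Sum>k=1..<m. a k * leaf_char m k t) / sqrt (real n)))) \<longlonglongrightarrow>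
    of_real (exp (- (\<Sum>k=1..<m. (norm (a k) * norm (lam m k))\<^sup>2 / (1 - 2 * Re (lam m k))) / 2))"
proof -
  let ?K = "{1..<m}"
  let ?V = "\<Sum>k\<in>?K. (norm (a k) * norm (lam m k))\<^sup>2 / (1 - 2 * Re (lam m k))"
  define A where "A = 3 * (\<Sum>k\<in>?K. norm (a k))"
  have A0: "A \<ge> 0" by (simp add: A_def sum_nonneg)
  \<comment> \<open>The growth from \<open>l\<close> to \<open>n\<close> is already contained in the
    coefficients, so \<open>b n l\<close> is \<open>b n (Suc l)\<close> times 1 + lam / (l + 1),
    which is the phase that \<open>one_step_estimate\<close> produces.\<close>
  define b where "b = (\<lambda>n l k. a k * growth_prod m k l n / of_real (sqrt (real n)))"
  define \<sigma> where "\<sigma> = (\<lambda>n l. \<Sum>k\<in>?K. (norm (b n (Suc l) k) * norm (lam m k))\<^sup>2)"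
  define s where "s = (\<lambda>n l. \<Sum>i\<in>{l..<n}. \<sigma> n i)"
  \<comment> \<open>The mean of \<open>h n l\<close> over trees of size \<open>l\<close> is the characteristic function for \<open>l = n\<close>, is
    explicit for \<open>l = 0\<close>, and changes little from \<open>l\<close> to \<open>l + 1\<close>.\<close>
  define h where "h = (\<lambda>n l (t :: unit tree). cis (Re (\<Sum>k\<in>?K. b n l k * leaf_char m k t)) *
    complex_of_real (exp (- s n l / 2)))"
  define T where "T = (\<lambda>n l. growth_mean l (h n l))"
  define \<beta> where "\<beta> = (\<lambda>n l. A * (rate_prod (Suc l) n / sqrt (real n)))"
  have s0: "s n l \<ge> 0" for n l by (simp add: s_def \<sigma>_def sum_nonneg)
  have \<beta>0: "\<beta> n l \<ge> 0" for n l using A0 by (simp add: \<beta>_def rate_prod_nonneg)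

  have "\<exists>D\<ge>0. \<forall>k\<in>?K. \<forall>n. growth_mean n (\<lambda>t. norm (leaf_char m k t)) \<le> D * sqrt (real (Suc n))"
  proof -
    have "\<forall>k\<in>?K. \<exists>C\<ge>0. \<forall>n. growth_mean n (\<lambda>t. norm (leaf_char m k t)) \<le> C * sqrt (real (Suc n))"
      using lam by (intro ballI first_moment_bound) (fastforce intro: le_less_trans)
    then obtain C where C: "\<And>k. k \<in> ?K \<Longrightarrow> C k \<ge> 0"
      "\<And>k n. k \<in> ?K \<Longrightarrow> growth_mean n (\<lambda>t. norm (leaf_char m k t)) \<le> C k * sqrt (real (Suc n))"
      by metis
    show ?thesis
    proof (intro exI[of _ "sum C ?K"] conjI ballI allI)
      show "sum C ?K \<ge> 0" by (intro sum_nonneg C)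
      fix k n assume k: "k \<in> ?K"
      have "C k \<le> sum C ?K" using k C by (intro member_le_sum) auto
      then show "growth_mean n (\<lambda>t. norm (leaf_char m k t)) \<le> sum C ?K * sqrt (real (Suc n))"
        by (intro order_trans[OF C(2)[OF k]] mult_right_mono) auto
    qed
  qed
  then obtain D where D: "D \<ge> 0"
    "\<And>k n. k \<in> ?K \<Longrightarrow> growth_mean n (\<lambda>t. norm (leaf_char m k t)) \<le> D * sqrt (real (Suc n))"
    by auto
  define D' where "D' = real (card ?K) * D"
  have spread: "growth_mean n (spread m) \<le> D' / sqrt (real (Suc n))" for n
  proof -
    have "growth_mean n (spread m) =
        growth_mean n (\<lambda>t. (\<Sum>k\<in>?K. norm (leaf_char m k t)) / real (Suc n))"
      by (intro growth_expectation_cong) (simp add: spread_def)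
    also have "\<dots> = (\<Sum>k\<in>?K. growth_mean n (\<lambda>t. norm (leaf_char m k t))) / real (Suc n)"
      by simp
    also have "\<dots> \<le> (\<Sum>k\<in>?K. D * sqrt (real (Suc n))) / real (Suc n)"
      by (intro divide_right_mono sum_mono D) auto
    also have "\<dots> = D' * (sqrt (real (Suc n)) / real (Suc n))" by (simp add: D'_def)
    also have "sqrt (real (Suc n)) / real (Suc n) = 1 / sqrt (real (Suc n))"
      by (simp add: sqrt_divide_self_eq inverse_eq_divide)
    finally show ?thesis by simp
  qed

  have step: "norm (T n (Suc l) - T n l) \<le>
      2 * \<beta> n l ^ 3 + \<beta> n l ^ 4 + (\<beta> n l)\<^sup>2 * (D' / sqrt (real (Suc l)))" if "l < n" for n l
  proof -
    define B where "B = 3 * (\<Sum>k\<in>?K. norm (b n (Suc l) k))"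
    have B0: "B \<ge> 0" by (simp add: B_def sum_nonneg)
    have B: "B \<le> \<beta> n l"
    proof -
      have "norm (b n (Suc l) k) \<le> norm (a k) * (rate_prod (Suc l) n / sqrt (real n))" if "k \<in> ?K" for k
        using norm_growth_prod_le[OF lam[OF that], of "Suc l" n]
        by (simp add: b_def norm_mult norm_divide mult_left_mono divide_right_mono)
      then have "B \<le> 3 * (\<Sum>k\<in>?K. norm (a k) * (rate_prod (Suc l) n / sqrt (real n)))"
        unfolding B_def by (intro mult_left_mono sum_mono) auto
      then show ?thesis by (simp only: \<beta>_def A_def sum_distrib_right mult.assoc)
    qed
    have bsym: "b n (Suc l) (m - k) = cnj (b n (Suc l) k)" if "k \<in> ?K" for k
      using that m by (simp add: b_def sym cnj_growth_prod)
    have bl: "b n l k = b n (Suc l) k * (1 + lam m k / of_nat (Suc l))" for k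
      using growth_prod_left[OF that, of m k] by (simp add: b_def)
    have sl: "s n l = s n (Suc l) + \<sigma> n l"
      using that by (simp add: s_def sum.atLeast_Suc_lessThan)
    have pt: "norm ((\<Sum>i\<le>size t. h n (Suc l) (grow_at t i)) /\<^sub>R real (Suc (size t)) - h n l t) \<le>
        2 * B ^ 3 + B ^ 4 + B\<^sup>2 * spread m t" if t: "size t = l" for t :: "unit tree"
    proof -
      define e1 where "e1 = complex_of_real (exp (- s n (Suc l) / 2))"
      define X where "X = (\<Sum>i\<le>l. cis (Re (\<Sum>k\<in>?K. b n (Suc l) k * leaf_char m k (grow_at t i)))) /\<^sub>R real (Suc l) -
        cis (Re (\<Sum>k\<in>?K. b n (Suc l) k * (1 + lam m k / of_nat (Suc l)) * leaf_char m k t)) *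
          complex_of_real (exp (- \<sigma> n l / 2))"
      have "exp (- s n l / 2) = exp (- \<sigma> n l / 2) * exp (- s n (Suc l) / 2)"
        by (simp add: sl flip: exp_add)
      then have "norm ((\<Sum>i\<le>size t. h n (Suc l) (grow_at t i)) /\<^sub>R real (Suc (size t)) - h n l t) = norm (X * e1)"
        by (simp add: h_def t X_def e1_def bl left_diff_distrib sum_distrib_right mult.assoc del: Re_sum)
      moreover have "norm X \<le> 2 * B ^ 3 + B ^ 4 + B\<^sup>2 * spread m t"
        unfolding X_def B_def \<sigma>_def by (rule one_step_estimate) (use m bsym t in auto)
      moreover have "norm (X * e1) \<le> norm X"
        unfolding norm_mult by (rule mult_left_le) (use s0 in \<open>simp_all add: e1_def\<close>)
      ultimately show ?thesis by linarith
    qed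
    have "T n (Suc l) - T n l = growth_mean l
        (\<lambda>t. (\<Sum>i\<le>size t. h n (Suc l) (grow_at t i)) /\<^sub>R real (Suc (size t)) - h n l t)"
      unfolding T_def expectation_growth_pmf_Suc by (rule Bochner_Integration.integral_diff[symmetric]) simp_all
    also have "norm \<dots> \<le> growth_mean l
        (\<lambda>t. norm ((\<Sum>i\<le>size t. h n (Suc l) (grow_at t i)) /\<^sub>R real (Suc (size t)) - h n l t))"
      by (rule integral_norm_bound)
    also have "\<dots> \<le> growth_mean l (\<lambda>t. 2 * B ^ 3 + B ^ 4 + B\<^sup>2 * spread m t)"
      by (intro growth_expectation_mono pt)
    also have "\<dots> = 2 * B ^ 3 + B ^ 4 + B\<^sup>2 * growth_mean l (spread m)"
      by simp
    also have "\<dots> \<le> 2 * \<beta> n l ^ 3 + \<beta> n l ^ 4 + (\<beta> n l)\<^sup>2 * (D' / sqrt (real (Suc l)))"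
      using B B0 spread by (intro add_mono mult_mono power_mono integral_nonneg) (auto simp: spread_nonneg)
    finally show ?thesis .
  qed

  have diff: "(\<lambda>n. T n n - T n 0) \<longlonglongrightarrow> 0"
  proof (rule Lim_null_comparison)
    define W where "W = (\<lambda>p e n. \<Sum>l<n. e l * (rate_prod (Suc l) n / sqrt (real n)) ^ p)"
    \<comment> \<open>The cubic and quartic errors are summed with weight 1; the quadratic one
      carries the mean spread, of order 1 / sqrt l, without which its sum would not vanish.\<close>
    let ?W = "\<lambda>n. 2 * A ^ 3 * W 3 (\<lambda>_. 1) n + A ^ 4 * W 4 (\<lambda>_. 1) n + A ^ 2 * D' * W 2 (\<lambda>l. 1 / sqrt (real (Suc l))) n"
    show "\<forall>\<^sub>F n in sequentially. norm (T n n - T n 0) \<le>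
        ?W n"
    proof (intro always_eventually allI)
      fix n
      have "T n n - T n 0 = (\<Sum>l<n. T n (Suc l) - T n l)"
        by (simp add: sum_lessThan_telescope)
      also have "norm \<dots> \<le> (\<Sum>l<n. 2 * \<beta> n l ^ 3 + \<beta> n l ^ 4 + (\<beta> n l)\<^sup>2 * (D' / sqrt (real (Suc l))))"
        by (intro sum_norm_le step) auto
      also have "\<dots> = ?W n"
        unfolding W_def sum_distrib_left sum.distrib[symmetric] \<beta>_def power_mult_distrib
        by (intro sum.cong refl) simp
      finally show "norm (T n n - T n 0) \<le>
        ?W n" .
    qed
    have "W 3 (\<lambda>_. 1) \<longlonglongrightarrow> 0" "W 4 (\<lambda>_. 1) \<longlonglongrightarrow> 0"
      unfolding W_def by (rule weighted_rate_sum_tendsto_0; simp; real_asymp)+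
    moreover have "W 2 (\<lambda>l. 1 / sqrt (real (Suc l))) \<longlonglongrightarrow> 0"
      unfolding W_def
    proof (rule weighted_rate_sum_tendsto_0)
      show "(\<lambda>n. real (Suc n) * (1 / sqrt (real (Suc n))) / sqrt (real (Suc n)) ^ 2) \<longlonglongrightarrow> 0"
        by real_asymp
    qed auto
    ultimately show "?W \<longlonglongrightarrow> 0"
      by (intro tendsto_add_zero tendsto_mult_right_zero)
  qed

  \<comment> \<open>The empty tree has all characters equal to 1, so \<open>T n 0\<close> is
    explicit: its phase tends to 0, and \<open>s n 0\<close> is the whole variance.\<close>
  have T0: "(\<lambda>n. T n 0) \<longlonglongrightarrow> cis 0 * of_real (exp (- ?V / 2))"
  proof -
    have "(\<lambda>n. \<Sum>k\<in>?K. b n 0 k) \<longlonglongrightarrow> (\<Sum>k\<in>?K. 0)"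
    proof (rule tendsto_sum)
      fix k assume k: "k \<in> ?K"
      have "norm (b n 0 k) \<le> norm (a k) * (rate_prod 0 n / sqrt (real n))" for n
        using norm_growth_prod_le[OF lam[OF k], of 0 n]
        by (simp add: b_def norm_mult norm_divide mult_left_mono divide_right_mono)
      then show "(\<lambda>n. b n 0 k) \<longlonglongrightarrow> 0"
        by (intro Lim_null_comparison[OF always_eventually
              tendsto_mult_right_zero[OF rate_prod_0_tendsto_0, of "norm (a k)"]] allI)
    qed
    then have 1: "(\<lambda>n. Re (\<Sum>k\<in>?K. b n 0 k)) \<longlonglongrightarrow> 0"
      using tendsto_Re by fastforce
    have "(\<lambda>n. \<Sum>k\<in>?K. (norm (a k) * norm (lam m k))\<^sup>2 *
        ((\<Sum>l<n. (norm (growth_prod m k (Suc l) n))\<^sup>2) / real n)) \<longlonglongrightarrow>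
      (\<Sum>k\<in>?K. (norm (a k) * norm (lam m k))\<^sup>2 * (1 / (1 - 2 * Re (lam m k))))"
      using lam by (intro tendsto_sum tendsto_mult_left growth_prod_square_sum_limit) (fastforce intro: le_less_trans)
    also have "(\<lambda>n. \<Sum>k\<in>?K. (norm (a k) * norm (lam m k))\<^sup>2 *
        ((\<Sum>l<n. (norm (growth_prod m k (Suc l) n))\<^sup>2) / real n)) = (\<lambda>n. s n 0)"
    proof
      fix n
      have "s n 0 = (\<Sum>k\<in>?K. \<Sum>l<n. (norm (b n (Suc l) k) * norm (lam m k))\<^sup>2)"
        unfolding s_def \<sigma>_def by (subst sum.swap) (simp add: atLeast0LessThan)
      also have "\<dots> = (\<Sum>k\<in>?K. \<Sum>l<n. (norm (a k) * norm (lam m k))\<^sup>2 * ((norm (growth_prod m k (Suc l) n))\<^sup>2 / real n))"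
        by (intro sum.cong refl) (simp add: b_def norm_mult norm_divide power_mult_distrib power_divide)
      finally show "(\<Sum>k\<in>?K. (norm (a k) * norm (lam m k))\<^sup>2 *
        ((\<Sum>l<n. (norm (growth_prod m k (Suc l) n))\<^sup>2) / real n)) = s n 0"
        by (simp add: sum_distrib_left sum_divide_distrib)
    qed
    finally have 2: "(\<lambda>n. s n 0) \<longlonglongrightarrow> ?V"
      by simp
    have T: "T n 0 = cis (Re (\<Sum>k\<in>?K. b n 0 k)) * of_real (exp (- s n 0 / 2))" for n
      by (simp add: T_def h_def)
    have c: "(\<lambda>n. cis (Re (\<Sum>k\<in>?K. b n 0 k))) \<longlonglongrightarrow> cis 0"
      unfolding cis_conv_exp by (intro tendsto_intros 1)
    have "(\<lambda>n. complex_of_real (exp (- s n 0 / 2))) \<longlonglongrightarrow>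
        of_real (exp (- ?V / 2))"
      by (intro tendsto_intros 2) simp
    from tendsto_mult[OF c this] show ?thesis by (simp only: T)
  qed
  have "T n n = growth_mean n
      (\<lambda>t. cis (Re (\<Sum>k\<in>?K. a k * leaf_char m k t) / sqrt (real n)))" for n
  proof -
    have "Re (\<Sum>k\<in>?K. b n n k * leaf_char m k t) = Re (\<Sum>k\<in>?K. a k * leaf_char m k t) / sqrt (real n)" for t :: "unit tree"
      unfolding Re_divide_of_real[symmetric] sum_divide_distrib by (simp add: b_def)
    then show ?thesis by (simp add: T_def h_def s_def)
  qed
  moreover have "(\<lambda>n. T n n) \<longlonglongrightarrow> cis 0 * of_real (exp (- ?V / 2))"
    using tendsto_add[OF diff T0] by simp
  ultimately show ?thesis by simp
qed

subsection \<open>Convergence in distribution from characteristic functions\<close>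

text \<open>Complex coefficients under a real part let one generator cover sines, cosines and
  constants, and make products computable from Re a * Re b = Re (a b + a cnj b) / 2.\<close>

inductive_set trig_poly :: "(real ^ 'm \<Rightarrow> real) set" where
  char: "(\<lambda>x. Re (c * cis (u \<bullet> x))) \<in> trig_poly"
| add: "f \<in> trig_poly \<Longrightarrow> g \<in> trig_poly \<Longrightarrow> (\<lambda>x. f x + g x) \<in> trig_poly"

lemma trig_poly_mult:
  assumes "f \<in> trig_poly" "g \<in> trig_poly"
  shows "(\<lambda>x. f x * g x) \<in> trig_poly"
  using assms(1)
proof induction
  case (char c u)
  show ?case using assms(2)
  proof induction
    case (char d v)
    have "(\<lambda>x. Re (c * cis (u \<bullet> x)) * Re (d * cis (v \<bullet> x))) =
        (\<lambda>x. Re ((c * d / 2) * cis ((u + v) \<bullet> x)) + Re ((c * cnj d / 2) * cis ((u - v) \<bullet> x)))"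
    proof
      fix x
      have p: "Re a * Re b = Re (a * b / 2) + Re (a * cnj b / 2)" for a b :: complex
        by (simp add: field_simps)
      have "c * cis (u \<bullet> x) * (d * cis (v \<bullet> x)) / 2 = (c * d / 2) * cis ((u + v) \<bullet> x)"
        "c * cis (u \<bullet> x) * cnj (d * cis (v \<bullet> x)) / 2 = (c * cnj d / 2) * cis ((u - v) \<bullet> x)"
      proof -
        have "cis ((u + v) \<bullet> x) = cis (u \<bullet> x) * cis (v \<bullet> x)"
          by (simp add: inner_add_left cis_mult)
        moreover have "cis ((u - v) \<bullet> x) = cis (u \<bullet> x) * cnj (cis (v \<bullet> x))"
          by (simp add: inner_diff_left cis_cnj cis_mult)
        ultimately show "c * cis (u \<bullet> x) * (d * cis (v \<bullet> x)) / 2 = (c * d / 2) * cis ((u + v) \<bullet> x)"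
          "c * cis (u \<bullet> x) * cnj (d * cis (v \<bullet> x)) / 2 = (c * cnj d / 2) * cis ((u - v) \<bullet> x)"
          by simp_all
      qed
      then show "Re (c * cis (u \<bullet> x)) * Re (d * cis (v \<bullet> x)) =
          Re ((c * d / 2) * cis ((u + v) \<bullet> x)) + Re ((c * cnj d / 2) * cis ((u - v) \<bullet> x))"
        by (simp only: p)
    qed
    then show ?case by (simp only: trig_poly.intros)
  next
    case (add g h)
    then show ?case using trig_poly.add[OF add.IH] by (simp add: ring_distribs)
  qed
next
  case (add f h)
  then show ?case using trig_poly.add[OF add.IH] by (simp add: ring_distribs)
qed

lemma trig_poly_sum:
  assumes "finite A" "\<And>k. k \<in> A \<Longrightarrow> f k \<in> trig_poly"
  shows "(\<lambda>x. \<Sum>k\<in>A. f k x) \<in> trig_poly"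
  using assms
proof (induction A rule: finite_induct)
  case empty
  show ?case using trig_poly.char[of 0 0] by simp
next
  case (insert k A)
  then show ?case using trig_poly.add[of "f k" "\<lambda>x. \<Sum>k\<in>A. f k x"] by simp
qed

definition torus_map :: "real \<Rightarrow> real ^ 'm \<Rightarrow> complex ^ 'm" where
  "torus_map s x = (\<chi> k. cis (s * x $ k))"

lemma polynomial_torus_map_trig_poly:
  assumes "real_polynomial_function p"
  shows "(\<lambda>x. p (torus_map s x)) \<in> trig_poly"
  using assms
proof induction
  case (linear f)
  interpret bounded_linear f by fact
  \<comment> \<open>A functional that is linear over the reals sends cos + \<i> sin in coordinate
    \<open>k\<close> to f(e) cos + f(\<i> e) sin, the real part of (f(e) - \<i> f(\<i> e)) times
    \<open>cis\<close>.\<close>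
  have "f (torus_map s x) = (\<Sum>k\<in>UNIV. Re (Complex (f (axis k 1)) (- f (axis k \<i>)) * cis (axis k s \<bullet> x)))" for x
  proof -
    have "torus_map s x = (\<Sum>k\<in>UNIV. cos (s * x $ k) *\<^sub>R axis k 1 + sin (s * x $ k) *\<^sub>R axis k \<i>)"
    proof (rule vec_eq_iff[THEN iffD2], rule allI)
      fix j
      have "(\<Sum>k\<in>UNIV. cos (s * x $ k) *\<^sub>R axis k 1 + sin (s * x $ k) *\<^sub>R axis k \<i>) $ j =
          (\<Sum>k\<in>UNIV. if k = j then cis (s * x $ j) else 0)"
        unfolding sum_component by (intro sum.cong refl) (auto simp: axis_def complex_eq_iff)
      then show "torus_map s x $ j = (\<Sum>k\<in>UNIV. cos (s * x $ k) *\<^sub>R axis k 1 + sin (s * x $ k) *\<^sub>R axis k \<i>) $ j"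
        by (simp add: torus_map_def)
    qed
    then show ?thesis
      by (simp add: sum add scaleR inner_axis' mult.commute)
  qed
  then show ?case
    by (simp only:) (intro trig_poly_sum trig_poly.char finite)
next
  case (const c)
  show ?case using trig_poly.char[of "of_real c" 0] by simp
qed (auto intro: trig_poly.add trig_poly_mult)

lemma trig_poly_continuous: "f \<in> trig_poly \<Longrightarrow> continuous_on UNIV f"
  by (induction rule: trig_poly.induct) (auto simp: cis_conv_exp intro!: continuous_intros)

lemma trig_poly_bounded: "f \<in> trig_poly \<Longrightarrow> \<exists>B. \<forall>x. \<bar>f x\<bar> \<le> B"
proof (induction rule: trig_poly.induct)
  case (char c u)
  have "\<bar>Re (c * cis (u \<bullet> x))\<bar> \<le> norm c" for x
    using abs_Re_le_cmod[of "c * cis (u \<bullet> x)"] by (simp add: norm_mult)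
  then show ?case by blast
next
  case (add f g)
  then obtain A B where "\<And>x. \<bar>f x\<bar> \<le> A" "\<And>x. \<bar>g x\<bar> \<le> B" by blast
  then have "\<bar>f x + g x\<bar> \<le> A + B" for x
    by (intro order_trans[OF abs_triangle_ineq add_mono])
  then show ?case by blast
qed

lemma integrable_continuous_bounded:
  fixes f :: "'b::topological_space \<Rightarrow> real"
  assumes "prob_space M" "X \<in> borel_measurable M" "continuous_on UNIV f" "\<And>x. \<bar>f x\<bar> \<le> B"
  shows "integrable M (\<lambda>\<omega>. f (X \<omega>))"
proof -
  interpret prob_space M by fact
  have [measurable]: "f \<in> borel_measurable borel"
    by (intro borel_measurable_continuous_onI assms)
  show ?thesis
    using assms(2,4) by (intro integrable_const_bound[where B = B]) auto
qed

text \<open>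
  The ball of radius \<open>R\<close> embeds into a torus, where a continuous function is uniformly close to a
  polynomial. This gives a bound for the approximating function on the whole space as well.
\<close>

lemma trig_poly_approximation:
  fixes f :: "real ^ 'm \<Rightarrow> real"
  assumes f: "continuous_on UNIV f" "\<And>x. \<bar>f x\<bar> \<le> B" and R: "R > 0" and e: "e > 0"
  obtains p where "p \<in> trig_poly" "\<And>x. norm x \<le> R \<Longrightarrow> \<bar>f x - p x\<bar> \<le> e" "\<And>x. \<bar>p x\<bar> \<le> B + e"
proof -
  \<comment> \<open>With this scale the coordinates of the ball become angles in [-pi/2, pi/2],
    where the sine is injective.\<close>
  define s where "s = pi / (2 * R)"
  let ?\<Phi> = "torus_map s :: real ^ 'm \<Rightarrow> complex ^ 'm"
  have cont: "continuous_on A ?\<Phi>" for A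
    unfolding torus_map_def cis_conv_exp by (intro continuous_intros)
  have inj: "inj_on ?\<Phi> (cball 0 R)"
  proof (rule inj_onI)
    fix x y :: "real ^ 'm" assume xy: "x \<in> cball 0 R" "y \<in> cball 0 R" "?\<Phi> x = ?\<Phi> y"
    show "x = y"
    proof (rule vec_eq_iff[THEN iffD2], rule allI)
      fix k
      have "\<bar>x $ k\<bar> \<le> R" "\<bar>y $ k\<bar> \<le> R"
        using xy component_le_norm_cart[of x k] component_le_norm_cart[of y k] by auto
      moreover have s: "s > 0" "s * R = pi / 2" using R by (simp_all add: s_def)
      ultimately have "\<bar>s * x $ k\<bar> \<le> s * R" "\<bar>s * y $ k\<bar> \<le> s * R"
        by (simp_all add: abs_mult)
      then have b: "- (pi / 2) \<le> s * x $ k" "s * x $ k \<le> pi / 2" "- (pi / 2) \<le> s * y $ k" "s * y $ k \<le> pi / 2"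
        unfolding s(2) by (simp_all only: abs_le_iff, linarith+)
      have "cis (s * x $ k) = cis (s * y $ k)"
        using xy(3) by (simp add: torus_map_def vec_eq_iff)
      then have "sin (s * x $ k) = sin (s * y $ k)" by (simp add: complex_eq_iff)
      from sin_inj_pi[OF b this] show "x $ k = y $ k" using s(1) by simp
    qed
  qed
  let ?S = "?\<Phi> ` cball 0 R"
  define h where "h = inv_into (cball 0 R) ?\<Phi>"
  have h: "h (?\<Phi> x) = x" if "norm x \<le> R" for x
    unfolding h_def using that by (intro inv_into_f_f inj) auto
  have "continuous_on ?S h"
    by (rule continuous_on_inv[OF cont compact_cball]) (auto simp: h)
  then have fh: "continuous_on ?S (\<lambda>z. f (h z))"
    by (rule continuous_on_compose2[OF f(1)]) auto
  have "compact ?S" by (intro compact_continuous_image cont compact_cball)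
  then have "closedin (top_of_set UNIV) ?S" by (simp add: compact_imp_closed)
  then obtain g where g: "continuous_on UNIV g" "\<And>z. z \<in> ?S \<Longrightarrow> g z = f (h z)" "\<And>z. norm (g z) \<le> B"
    using Tietze[OF fh, of UNIV B] f(2)[of 0] f(2) by (metis UNIV_I abs_ge_zero order_trans real_norm_def)
  \<comment> \<open>The approximation is made on a ball containing the whole torus, not just the
    image of the small ball; since the Tietze extension \<open>g\<close> keeps the bound
    \<open>B\<close>, the composite is bounded by B + e everywhere.\<close>
  obtain q where q: "real_polynomial_function q"
    "\<And>z. z \<in> cball 0 (real CARD('m)) \<Longrightarrow> \<bar>g z - q z\<bar> < e"
    using Stone_Weierstrass_real_polynomial_function[OF compact_cball continuous_on_subset[OF g(1) subset_UNIV] e]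
    by blast
  have range: "?\<Phi> x \<in> cball 0 (real CARD('m))" for x
  proof -
    have "norm (?\<Phi> x) \<le> (\<Sum>k\<in>(UNIV::'m set). norm (?\<Phi> x $ k))"
      unfolding norm_vec_def by (rule L2_set_le_sum) auto
    then show ?thesis by (simp add: torus_map_def)
  qed
  show ?thesis
  proof
    show "(\<lambda>x. q (?\<Phi> x)) \<in> trig_poly" by (rule polynomial_torus_map_trig_poly[OF q(1)])
    show "\<bar>f x - q (?\<Phi> x)\<bar> \<le> e" if "norm x \<le> R" for x
    proof -
      have "g (?\<Phi> x) = f x" using that by (subst g(2)) (auto simp: h)
      then show ?thesis using q(2)[OF range[of x]] by simp
    qed
    show "\<bar>q (?\<Phi> x)\<bar> \<le> B + e" for x
      using q(2)[OF range[of x]] g(3)[of "?\<Phi> x"] by auto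
  qed
qed

text \<open>Bounded second moments play the role of tightness. A trigonometric polynomial is close
  to \<open>f\<close> on a large ball, and outside it the difference is dominated by a small
  multiple of the squared norm.\<close>

lemma converges_in_distribution_char_fun:
  fixes X :: "nat \<Rightarrow> 'w \<Rightarrow> real ^ 'm" and N :: "(real ^ 'm) measure"
  assumes M: "prob_space M" and X: "\<And>n. X n \<in> borel_measurable M"
    and N: "prob_space N" "sets N = sets borel"
    and chf: "\<And>u. (\<lambda>n. \<integral>\<omega>. cis (u \<bullet> X n \<omega>) \<partial>M) \<longlonglongrightarrow> (\<integral>x. cis (u \<bullet> x) \<partial>N)"
    and momX: "\<forall>\<^sub>F n in sequentially. integrable M (\<lambda>\<omega>. (norm (X n \<omega>))\<^sup>2) \<and> (\<integral>\<omega>. (norm (X n \<omega>))\<^sup>2 \<partial>M) \<le> C"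
    and momN: "integrable N (\<lambda>x. (norm x)\<^sup>2)" "(\<integral>x. (norm x)\<^sup>2 \<partial>N) \<le> C"
  shows "converges_in_distribution M X N"
  unfolding converges_in_distribution_def
proof (intro allI impI, elim conjE)
  fix f :: "real ^ 'm \<Rightarrow> real"
  assume f: "continuous_on UNIV f" and "bounded (range f)"
  then obtain B where B: "\<And>x. \<bar>f x\<bar> \<le> B" by (auto simp: bounded_iff)
  have B0: "B \<ge> 0" using B[of 0] by linarith
  have C0: "C \<ge> 0" by (rule order_trans[OF _ momN(2)]) simp
  have idN: "(\<lambda>x. x) \<in> borel_measurable N"
    using N(2) by (simp add: measurable_def sets_eq_imp_space_eq)
  note intX = integrable_continuous_bounded[OF M X]
  note intN = integrable_continuous_bounded[OF N(1) idN]
  interpret M: prob_space M by fact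
  interpret N: prob_space N by fact
  have trig: "(\<lambda>n. \<integral>\<omega>. p (X n \<omega>) \<partial>M) \<longlonglongrightarrow> (\<integral>x. p x \<partial>N)" if "p \<in> trig_poly" for p
    using that
  proof induction
    case (char c u)
    have [measurable]: "(\<lambda>x::real ^ 'm. cis (u \<bullet> x)) \<in> borel_measurable borel"
      unfolding cis_conv_exp by (intro borel_measurable_continuous_onI continuous_intros)
    have i1: "integrable M (\<lambda>\<omega>. cis (u \<bullet> X n \<omega>))" for n
      using X by (intro M.integrable_const_bound[where B = 1]) auto
    have i2: "integrable N (\<lambda>x. cis (u \<bullet> x))"
    proof (rule N.integrable_const_bound[where B = 1])
      show "(\<lambda>x. cis (u \<bullet> x)) \<in> borel_measurable N"
        by (rule measurable_compose[OF idN]) measurable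
    qed simp
    have "(\<lambda>n. Re (c * (\<integral>\<omega>. cis (u \<bullet> X n \<omega>) \<partial>M))) \<longlonglongrightarrow> Re (c * (\<integral>x. cis (u \<bullet> x) \<partial>N))"
      by (intro tendsto_intros chf)
    moreover have "(\<integral>\<omega>. Re (c * cis (u \<bullet> X n \<omega>)) \<partial>M) = Re (c * (\<integral>\<omega>. cis (u \<bullet> X n \<omega>) \<partial>M))" for n
      using i1 by (subst integral_Re) auto
    moreover have "(\<integral>x. Re (c * cis (u \<bullet> x)) \<partial>N) = Re (c * (\<integral>x. cis (u \<bullet> x) \<partial>N))"
      using i2 by (subst integral_Re) auto
    ultimately show ?case by simp
  next
    case (add p q)
    obtain P Q where PQ: "\<And>x. \<bar>p x\<bar> \<le> P" "\<And>x. \<bar>q x\<bar> \<le> Q"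
      using trig_poly_bounded add.hyps by blast
    note cont = add.hyps[THEN trig_poly_continuous]
    show ?case
      using tendsto_add[OF add.IH] intX[OF cont(1) PQ(1)] intX[OF cont(2) PQ(2)]
        intN[OF cont(1) PQ(1)] intN[OF cont(2) PQ(2)] by simp
  qed
  show "(\<lambda>n. \<integral>\<omega>. f (X n \<omega>) \<partial>M) \<longlonglongrightarrow> (\<integral>x. f x \<partial>N)"
  proof (rule LIMSEQ_I)
    fix \<epsilon> :: real assume eps: "\<epsilon> > 0"
    define e where "e = \<epsilon> / 5"
    have e: "e > 0" using eps by (simp add: e_def)
    \<comment> \<open>Chosen so that e / (C + 1) * R^2 = 2 B + e, the trivial bound for |f - p|; the
      1 in C + 1 protects against C = 0. The budget of five \<open>e\<close> is 2 + 2 for the two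
      approximations and 1 for the limit.\<close>
    define R where "R = sqrt ((2 * B + e) * (C + 1) / e)"
    have R2: "R\<^sup>2 = (2 * B + e) * (C + 1) / e" and R: "R > 0"
      using e B0 C0 by (simp_all add: R_def)
    obtain p where p: "p \<in> trig_poly" "\<And>x. norm x \<le> R \<Longrightarrow> \<bar>f x - p x\<bar> \<le> e" "\<And>x. \<bar>p x\<bar> \<le> B + e"
      using trig_poly_approximation[OF f B R e] by blast
    have pt: "\<bar>f x - p x\<bar> \<le> e + e / (C + 1) * (norm x)\<^sup>2" for x
    proof (cases "norm x \<le> R")
      case True
      then show ?thesis using p(2)[OF True] e C0 by (intro order_trans[OF p(2)[OF True]]) auto
    next
      case False
      then have "R\<^sup>2 \<le> (norm x)\<^sup>2" using R by (intro power_mono) auto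
      then have "e / (C + 1) * R\<^sup>2 \<le> e / (C + 1) * (norm x)\<^sup>2"
        using e C0 by (intro mult_left_mono) auto
      moreover have "e / (C + 1) * R\<^sup>2 = 2 * B + e"
        unfolding R2 using e C0 by simp
      moreover have "\<bar>f x - p x\<bar> \<le> 2 * B + e" using B[of x] p(3)[of x] by linarith
      ultimately show ?thesis using e by linarith
    qed
    have approx: "\<bar>(\<integral>\<omega>. f (Y \<omega>) \<partial>L) - (\<integral>\<omega>. p (Y \<omega>) \<partial>L)\<bar> \<le> 2 * e"
      if L: "prob_space L" and Y: "Y \<in> borel_measurable L"
        and mom: "integrable L (\<lambda>\<omega>. (norm (Y \<omega>))\<^sup>2)" "(\<integral>\<omega>. (norm (Y \<omega>))\<^sup>2 \<partial>L) \<le> C"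
      for L :: "'z measure" and Y
    proof -
      interpret L: prob_space L by fact
      note i = integrable_continuous_bounded[OF L Y f B]
        integrable_continuous_bounded[OF L Y trig_poly_continuous[OF p(1)] p(3)]
      have "\<bar>(\<integral>\<omega>. f (Y \<omega>) \<partial>L) - (\<integral>\<omega>. p (Y \<omega>) \<partial>L)\<bar> = \<bar>\<integral>\<omega>. f (Y \<omega>) - p (Y \<omega>) \<partial>L\<bar>"
        using i by simp
      also have "\<dots> \<le> (\<integral>\<omega>. \<bar>f (Y \<omega>) - p (Y \<omega>)\<bar> \<partial>L)"
        by (rule integral_abs_bound)
      also have "\<dots> \<le> (\<integral>\<omega>. e + e / (C + 1) * (norm (Y \<omega>))\<^sup>2 \<partial>L)"
        using i mom pt by (intro integral_mono) auto
      also have "\<dots> = e + e / (C + 1) * (\<integral>\<omega>. (norm (Y \<omega>))\<^sup>2 \<partial>L)"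
        using mom by (simp add: L.prob_space)
      also have "\<dots> \<le> e + e / (C + 1) * (C + 1)"
        using mom e C0 by (intro add_left_mono mult_left_mono) auto
      also have "\<dots> = 2 * e" using C0 by simp
      finally show ?thesis .
    qed
    have "\<forall>\<^sub>F n in sequentially. \<bar>(\<integral>\<omega>. p (X n \<omega>) \<partial>M) - (\<integral>x. p x \<partial>N)\<bar> < e"
      using tendstoD[OF trig[OF p(1)] e] by (simp add: dist_real_def)
    with momX have "\<forall>\<^sub>F n in sequentially. \<bar>(\<integral>\<omega>. f (X n \<omega>) \<partial>M) - (\<integral>x. f x \<partial>N)\<bar> < \<epsilon>"
    proof eventually_elim
      case (elim n)
      have "\<bar>(\<integral>\<omega>. f (X n \<omega>) \<partial>M) - (\<integral>\<omega>. p (X n \<omega>) \<partial>M)\<bar> \<le> 2 * e"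
        using elim by (intro approx M X) auto
      moreover have "\<bar>(\<integral>x. f x \<partial>N) - (\<integral>x. p x \<partial>N)\<bar> \<le> 2 * e"
        by (intro approx N(1) idN momN)
      ultimately show ?case using elim(2) unfolding e_def by linarith
    qed
    then show "\<exists>n0. \<forall>n\<ge>n0. norm ((\<integral>\<omega>. f (X n \<omega>) \<partial>M) - (\<integral>x. f x \<partial>N)) < \<epsilon>"
      by (simp add: eventually_sequentially)
  qed
qed

subsection \<open>Gaussian vectors\<close>

lemma char_distr_mult_std_normal:
  "char (distr std_normal_distribution borel (\<lambda>x. \<sigma> * x)) t = of_real (exp (- ((\<sigma> * t)\<^sup>2) / 2))"
proof -
  interpret S: real_distribution std_normal_distribution by (rule real_dist_normal_dist)
  have "char (distr std_normal_distribution borel (\<lambda>x. \<sigma> * x)) t = char std_normal_distribution (\<sigma> * t)"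
    unfolding char_def by (subst integral_distr) (simp_all add: mult_ac)
  then show ?thesis by (simp add: char_std_normal_distribution)
qed

lemma real_distribution_scaled_std_normal:
  "real_distribution (distr std_normal_distribution borel (\<lambda>x. \<sigma> * x))"
proof -
  interpret S: real_distribution std_normal_distribution by (rule real_dist_normal_dist)
  show ?thesis by (intro S.real_distribution_distr) simp
qed

lemma normal_or_dirac_scaled_std_normal:
  assumes "\<sigma> \<ge> 0"
  shows "normal_or_dirac (distr std_normal_distribution borel (\<lambda>x. \<sigma> * x))"
proof (cases "\<sigma> = 0")
  case True
  interpret S: real_distribution std_normal_distribution by (rule real_dist_normal_dist)
  have "distr std_normal_distribution borel (\<lambda>x. \<sigma> * x) = return borel 0"
    unfolding True mult_zero_left by (rule S.distr_const) simp
  then show ?thesis unfolding normal_or_dirac_def by blast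
next
  case False
  then have pos: "\<sigma> > 0" using assms by simp
  interpret S: real_distribution std_normal_distribution by (rule real_dist_normal_dist)
  have "distributed std_normal_distribution lborel (\<lambda>x. x) std_normal_density"
    unfolding distributed_def by (auto intro!: distr_id2)
  then have "distributed std_normal_distribution lborel (\<lambda>x. \<sigma> * x) (normal_density 0 \<sigma>)"
    using pos by (subst S.normal_standard_normal_convert) simp_all
  then have "distr std_normal_distribution lborel (\<lambda>x. \<sigma> * x) = density lborel (normal_density 0 \<sigma>)"
    by (rule distributed_distr_eq_density)
  moreover have "distr std_normal_distribution borel (\<lambda>x. \<sigma> * x) = distr std_normal_distribution lborel (\<lambda>x. \<sigma> * x)"
    by (rule distr_cong) auto
  ultimately show ?thesis using pos unfolding normal_or_dirac_def by metis
qed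

lemma borel_measurable_vec_lambda:
  fixes f :: "'m::finite \<Rightarrow> 'a \<Rightarrow> 'b::euclidean_space"
  assumes "\<And>k. f k \<in> borel_measurable M"
  shows "(\<lambda>\<omega>. \<chi> k. f k \<omega>) \<in> borel_measurable M"
proof (rule borel_measurable_euclidean_space[THEN iffD2], rule ballI)
  fix b :: "'b ^ 'm" assume "b \<in> Basis"
  then obtain k u where b: "b = axis k u" unfolding Basis_vec_def by blast
  have "(\<lambda>\<omega>. (\<chi> k. f k \<omega>) \<bullet> b) = (\<lambda>\<omega>. f k \<omega> \<bullet> u)"
    unfolding b by (simp add: inner_axis)
  then show "(\<lambda>\<omega>. (\<chi> k. f k \<omega>) \<bullet> b) \<in> borel_measurable M"
    by (simp only:) (intro borel_measurable_inner assms measurable_const, simp)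
qed

lemma norm_vec_sq: "(norm x)\<^sup>2 = (\<Sum>k\<in>UNIV. (x $ k)\<^sup>2)" for x :: "real ^ 'm"
  unfolding power2_norm_eq_inner inner_vec_def by (simp add: power2_eq_square)

text \<open>The vector is the linear image under \<open>A\<close> of independent standard normals.
  Each functional of it has, by its characteristic function, the law of a multiple of one standard
  normal, from which its moments are read off.\<close>

lemma gaussian_vector_exists:
  fixes A :: "'i \<Rightarrow> 'm::finite \<Rightarrow> real"
  assumes I: "finite I"
  obtains N :: "(real ^ 'm) measure" where
    "multivariate_normal 0 (\<chi> k l. \<Sum>i\<in>I. A i k * A i l) N"
    "\<And>u. (\<integral>x. cis (u \<bullet> x) \<partial>N) = of_real (exp (- (\<Sum>i\<in>I. (\<Sum>k\<in>UNIV. u $ k * A i k)\<^sup>2) / 2))"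
    "integrable N (\<lambda>x. (norm x)\<^sup>2)"
proof -
  let ?S = "std_normal_distribution"
  interpret S: real_distribution ?S by (rule real_dist_normal_dist)
  interpret P: product_prob_space "\<lambda>_. ?S" I by unfold_locales
  let ?P = "Pi\<^sub>M I (\<lambda>_. ?S)"
  define X where "X = (\<lambda>\<omega>. (\<chi> k. \<Sum>i\<in>I. A i k * \<omega> i) :: real ^ 'm)"
  define N where "N = distr ?P borel X"
  have X [measurable]: "X \<in> borel_measurable ?P"
    unfolding X_def by (rule borel_measurable_vec_lambda) measurable
  have N: "prob_space N" unfolding N_def by (intro P.P.prob_space_distr X)
  have setsN: "sets N = sets borel" by (simp add: N_def)
  then have idN: "(\<lambda>x. x) \<in> borel_measurable N"
    by (simp add: measurable_def sets_eq_imp_space_eq)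
  define c where "c = (\<lambda>u i. \<Sum>k\<in>UNIV. u $ k * A i k)"
  define \<sigma> where "\<sigma> = (\<lambda>u. sqrt (\<Sum>i\<in>I. (c u i)\<^sup>2))"
  have \<sigma>2: "(\<sigma> u)\<^sup>2 = (\<Sum>i\<in>I. (c u i)\<^sup>2)" for u by (simp add: \<sigma>_def sum_nonneg)
  have inner_meas: "(\<lambda>x. u \<bullet> x) \<in> borel_measurable N" for u
    by (rule measurable_compose[OF idN]) simp
  have law: "distr N borel (\<lambda>x. u \<bullet> x) = distr ?S borel (\<lambda>x. \<sigma> u * x)" for u
  proof (rule Levy_uniqueness)
    have inner: "u \<bullet> X \<omega> = (\<Sum>i\<in>I. c u i * \<omega> i)" for \<omega>
      unfolding X_def c_def inner_vec_def
      by (simp add: sum_distrib_left sum_distrib_right mult.assoc sum.swap[of _ I])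
    have eq: "distr N borel (\<lambda>x. u \<bullet> x) = distr ?P borel (\<lambda>\<omega>. \<Sum>i\<in>I. c u i * \<omega> i)"
      unfolding N_def by (subst distr_distr) (simp_all add: o_def inner)
    have meas: "(\<lambda>\<omega>. \<Sum>i\<in>I. c u i * \<omega> i) \<in> borel_measurable ?P" by measurable
    show "real_distribution (distr N borel (\<lambda>x. u \<bullet> x))"
      unfolding eq using meas by (intro P.P.real_distribution_distr)
    show "real_distribution (distr ?S borel (\<lambda>x. \<sigma> u * x))"
      by (rule real_distribution_scaled_std_normal)
    show "char (distr N borel (\<lambda>x. u \<bullet> x)) = char (distr ?S borel (\<lambda>x. \<sigma> u * x))"
    proof
      fix t
      have "char (distr N borel (\<lambda>x. u \<bullet> x)) t = (CLINT \<omega>|?P. (\<Prod>i\<in>I. iexp (t * c u i * \<omega> i)))"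
        unfolding eq char_def
        by (subst integral_distr[OF meas])
          (simp_all add: exp_sum[OF I] sum_distrib_left mult.assoc)
      also have "\<dots> = (\<Prod>i\<in>I. CLINT x|?S. iexp (t * c u i * x))"
        by (rule P.product_integral_prod[OF I]) (intro S.integrable_const_bound[where B = 1]; simp)
      also have "\<dots> = (\<Prod>i\<in>I. of_real (exp (- ((t * c u i)\<^sup>2) / 2)))"
      proof (intro prod.cong refl)
        fix i
        show "(CLINT x|?S. iexp (t * c u i * x)) = of_real (exp (- ((t * c u i)\<^sup>2) / 2))"
          using fun_cong[OF char_std_normal_distribution, of "t * c u i"] by (simp only: char_def)
      qed
      also have "\<dots> = of_real (exp (\<Sum>i\<in>I. - ((t * c u i)\<^sup>2) / 2))"
        unfolding exp_sum[OF I] of_real_prod ..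
      also have "(\<Sum>i\<in>I. - ((t * c u i)\<^sup>2) / 2) = - ((\<sigma> u * t)\<^sup>2) / 2"
        by (simp add: power_mult_distrib \<sigma>2 sum_negf sum_distrib_left mult.commute flip: sum_divide_distrib)
      finally show "char (distr N borel (\<lambda>x. u \<bullet> x)) t = char (distr ?S borel (\<lambda>x. \<sigma> u * x)) t"
        by (simp only: char_distr_mult_std_normal)
    qed
  qed
  have transfer: "(\<integral>x. g (u \<bullet> x) \<partial>N) = (\<integral>x. g (\<sigma> u * x) \<partial>?S)"
    if "g \<in> borel_measurable borel" for u and g :: "real \<Rightarrow> 'z::{banach,second_countable_topology}"
  proof -
    have "(\<integral>x. g (u \<bullet> x) \<partial>N) = (\<integral>y. g y \<partial>distr N borel (\<lambda>x. u \<bullet> x))"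
      by (rule integral_distr[symmetric]) (use that inner_meas in auto)
    also have "\<dots> = (\<integral>x. g (\<sigma> u * x) \<partial>?S)"
      unfolding law by (rule integral_distr) (use that in auto)
    finally show ?thesis .
  qed
  have integrable_transfer: "integrable N (\<lambda>x. (u \<bullet> x) ^ n)" for u n
  proof -
    have "integrable (distr ?S borel (\<lambda>x. \<sigma> u * x)) (\<lambda>y. y ^ n)"
      by (subst integrable_distr_eq) (simp_all add: power_mult_distrib integrable_std_normal_distribution_moment)
    then show ?thesis
      unfolding law[symmetric] by (subst (asm) integrable_distr_eq) (use inner_meas in simp_all)
  qed
  have mean: "(\<integral>x. u \<bullet> x \<partial>N) = 0" for u
    using transfer[of "\<lambda>y. y" u] integral_std_normal_distribution_moment_odd[of 1] by simp
  have second: "(\<integral>x. (u \<bullet> x)\<^sup>2 \<partial>N) = (\<sigma> u)\<^sup>2" for u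
    using transfer[of "\<lambda>y. y\<^sup>2" u] std_normal_distribution_even_moments(1)[of 1]
    by (simp add: power_mult_distrib)
  have c_axis: "c (axis k 1) i = A i k" for k i
    by (simp add: c_def axis_def if_distrib[of "\<lambda>z. z * _"] cong: if_cong)
  have c_add: "c (u + v) i = c u i + c v i" for u v i
    by (simp add: c_def ring_distribs sum.distrib)
  have comp: "x $ k = axis k 1 \<bullet> x" for x :: "real ^ 'm" and k by (simp add: inner_axis')
  have cov: "(\<integral>x. x $ k * x $ l \<partial>N) = (\<Sum>i\<in>I. A i k * A i l)" for k l
  proof -
    let ?u = "axis k 1 :: real ^ 'm" and ?v = "axis l 1 :: real ^ 'm"
    \<comment> \<open>Polarisation: only second moments of linear functionals are known so
      far.\<close>
    have "(\<integral>x. x $ k * x $ l \<partial>N) = (\<integral>x. (((?u + ?v) \<bullet> x)\<^sup>2 - (?u \<bullet> x)\<^sup>2 - (?v \<bullet> x)\<^sup>2) / 2 \<partial>N)"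
      by (intro Bochner_Integration.integral_cong refl)
        (simp add: comp[symmetric] inner_add_left power2_sum)
    also have "\<dots> = ((\<sigma> (?u + ?v))\<^sup>2 - (\<sigma> ?u)\<^sup>2 - (\<sigma> ?v)\<^sup>2) / 2"
      using integrable_transfer[of _ 2] by (simp add: second)
    also have "\<dots> = (\<Sum>i\<in>I. A i k * A i l)"
      by (simp add: \<sigma>2 c_add c_axis power2_sum sum.distrib mult.assoc flip: sum_distrib_left)
    finally show ?thesis .
  qed
  show ?thesis
  proof
    show "multivariate_normal 0 (\<chi> k l. \<Sum>i\<in>I. A i k * A i l) N"
      unfolding multivariate_normal_def
    proof (intro conjI allI N setsN)
      show "normal_or_dirac (distr N borel (\<lambda>x. u \<bullet> x))" for u
        unfolding law by (rule normal_or_dirac_scaled_std_normal) (simp add: \<sigma>_def sum_nonneg)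
      show "(\<integral>x. x $ k \<partial>N) = (0 :: real ^ 'm) $ k" for k
        using mean[of "axis k 1"] by (simp add: comp[symmetric])
      show "(\<integral>x. (x $ k - (0 :: real ^ 'm) $ k) * (x $ l - (0 :: real ^ 'm) $ l) \<partial>N) =
          (\<chi> k l. \<Sum>i\<in>I. A i k * A i l) $ k $ l" for k l
        by (simp add: cov)
    qed
    show "(\<integral>x. cis (u \<bullet> x) \<partial>N) = of_real (exp (- (\<Sum>i\<in>I. (\<Sum>k\<in>UNIV. u $ k * A i k)\<^sup>2) / 2))" for u
    proof -
      have cis_meas: "(\<lambda>x. cis x) \<in> borel_measurable borel"
        by (intro borel_measurable_continuous_onI continuous_on_cis continuous_on_id)
      have "(\<integral>x. cis (u \<bullet> x) \<partial>N) = char ?S (\<sigma> u)"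
        using transfer[OF cis_meas, of u] by (simp add: char_def cis_conv_exp mult.commute)
      then show ?thesis by (simp add: char_std_normal_distribution \<sigma>2 c_def)
    qed
    show "integrable N (\<lambda>x. (norm x)\<^sup>2)"
      using integrable_transfer[of _ 2] unfolding norm_vec_sq comp
      by (intro Bochner_Integration.integrable_sum) auto
  qed
qed

subsection \<open>The limiting covariance matrix\<close>

text \<open>All angles lie between pi/4 and 2 pi - pi/4, the extreme being m = 8, and sqrt 2 \<le>
  29/20 gives 2 * 29/40 - 1 = 9/20.\<close>

lemma cos_root_le:
  assumes "k \<in> {1..<m}" "m \<le> 8"
  shows "2 * cos (2 * pi * real k / real m) - 1 \<le> 9 / 20"
proof -
  let ?x = "2 * pi * real k / real m"
  have m: "real m > 0" "real k \<ge> 1" "real k \<le> real m - 1" using assms by auto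
  have lo: "pi / 4 \<le> ?x"
  proof -
    have "pi * real m \<le> pi * (8 * real k)" using assms by (intro mult_left_mono) auto
    then show ?thesis using m by (simp add: field_simps)
  qed
  have hi: "?x \<le> 2 * pi - pi / 4"
  proof -
    have "real m \<le> 8" using assms by simp
    also have "8 \<le> 8 * (real m - real k)" using m by simp
    finally have "real m \<le> 8 * (real m - real k)" .
    then have "pi * real m \<le> pi * (8 * (real m - real k))" by (intro mult_left_mono) auto
    then show ?thesis using m by (simp add: field_simps)
  qed
  have "cos ?x \<le> cos (pi / 4)"
  proof (cases "?x \<le> pi")
    case True
    then show ?thesis using lo by (intro cos_monotone_0_pi_le) auto
  next
    case False
    have "cos (2 * pi - ?x) \<le> cos (pi / 4)"
      using False hi by (intro cos_monotone_0_pi_le) auto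
    then show ?thesis by (simp add: cos_diff)
  qed
  also have "\<dots> = sqrt 2 / 2" by (rule cos_45)
  also have "\<dots> \<le> 29 / 40"
    using real_le_lsqrt[of "29 / 20" 2] by (simp add: power2_eq_square)
  finally show ?thesis by simp
qed

lemma zeta_power_mod: "m > 0 \<Longrightarrow> zeta m k ^ (d mod m) = zeta m k ^ d"
  by (metis zeta_power zeta_mod mod_mult_right_eq)

lemma Suc_mod_pred_mod:
  fixes d m :: nat
  assumes "d < m"
  shows "((d + 1) mod m + m - 1) mod m = d" "((d + m - 1) mod m + 1) mod m = d"
proof -
  show "((d + 1) mod m + m - 1) mod m = d"
  proof (cases "d + 1 < m")
    case True
    then have "((d + 1) mod m + m - 1) mod m = (d + m) mod m" by simp
    then show ?thesis using assms by simp
  next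
    case False
    then have "d + 1 = m" using assms by simp
    then show ?thesis by (metis Suc_eq_plus1 add_diff_cancel_right' add_0 assms mod_less mod_self)
  qed
  have "((d + m - 1) mod m + 1) mod m = (d + m - 1 + 1) mod m" by (rule mod_add_left_eq)
  then show "((d + m - 1) mod m + 1) mod m = d" using assms by simp
qed

text \<open>
  The operator on the left-hand side of the recurrence multiplies the Fourier coefficient
  number \<open>k\<close> by \<open>3 - 4 cos (2 \<pi> k / m)\<close>.
\<close>

lemma circulant_Fourier:
  fixes r :: "nat \<Rightarrow> real"
  assumes m: "m \<ge> 2" "m \<le> 8" and d: "d < m"
    and rec: "\<And>d. d < m \<Longrightarrow> 3 * r d - 2 * r ((d + 1) mod m) - 2 * r ((d + m - 1) mod m) =
      ((if d = 0 then 1 else 0) - 1 / real m) / real m"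
  shows "r d = (\<Sum>k=1..<m. Re (zeta m k ^ d) / (3 - 4 * cos (2 * pi * real k / real m))) / (real m)\<^sup>2"
proof -
  have m0: "m > 0" using m by simp
  define q where "q = (\<lambda>k. 3 - 4 * cos (2 * pi * real k / real m))"
  have q: "q k \<noteq> 0" if "k < m" for k
  proof (cases "k = 0")
    case False
    then show ?thesis using cos_root_le[of k m] that m by (auto simp: q_def)
  qed (simp add: q_def)
  define R where "R = (\<lambda>k. \<Sum>d<m. of_real (r d) * cnj (zeta m k ^ d))"
  have cz: "zeta m k * cnj (zeta m k) = 1" for k
    using complex_norm_square[of "zeta m k"] by simp
  have shift: "(\<Sum>d<m. of_real (f ((d + 1) mod m)) * cnj (zeta m k ^ d)) = zeta m k * (\<Sum>d<m. of_real (f d) * cnj (zeta m k ^ d))" for f k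
    unfolding sum_distrib_left
  proof (rule sum.reindex_bij_witness[of _ "\<lambda>d. (d + m - 1) mod m" "\<lambda>d. (d + 1) mod m"])
    fix d assume "d \<in> {..<m}"
    then show "((d + 1) mod m + m - 1) mod m = d" "((d + m - 1) mod m + 1) mod m = d"
      using Suc_mod_pred_mod[of d m] by auto
    have "zeta m k ^ ((d + 1) mod m) = zeta m k ^ d * zeta m k"
      by (simp only: zeta_power_mod[OF m0] power_add power_one_right)
    then have "zeta m k * cnj (zeta m k ^ ((d + 1) mod m)) = (zeta m k * cnj (zeta m k)) * cnj (zeta m k ^ d)"
      by (simp only: complex_cnj_mult mult_ac)
    then show "zeta m k * (of_real (f ((d + 1) mod m)) * cnj (zeta m k ^ ((d + 1) mod m))) =
        of_real (f ((d + 1) mod m)) * cnj (zeta m k ^ d)"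
      unfolding cz mult_1_left by (simp only: mult.left_commute[of "zeta m k"])
  qed (use m0 in auto)
  have shift1: "(\<Sum>d<m. of_real (r ((d + 1) mod m)) * cnj (zeta m k ^ d)) = zeta m k * R k" for k
    unfolding R_def by (rule shift)
  have shift2: "(\<Sum>d<m. of_real (r ((d + m - 1) mod m)) * cnj (zeta m k ^ d)) = cnj (zeta m k) * R k" (is "?S = _") for k
  proof -
    have "zeta m k * ?S = (\<Sum>d<m. of_real (r (((d + 1) mod m + m - 1) mod m)) * cnj (zeta m k ^ d))"
      by (rule shift[symmetric])
    also have "\<dots> = R k"
      unfolding R_def by (intro sum.cong refl) (simp only: Suc_mod_pred_mod lessThan_iff)
    finally have "R k = zeta m k * ?S" ..
    then have "cnj (zeta m k) * R k = (zeta m k * cnj (zeta m k)) * ?S"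
      by (simp only: mult_ac)
    then show ?thesis by (simp only: cz mult_1_left)
  qed
  \<comment> \<open>\<open>R\<close> is the discrete Fourier transform of the row. The right-hand
    side of the recurrence has transform 1/m, except 0 at k = 0; there q is -1, so the row sums to
    0.\<close>
  have R: "of_real (q k) * R k = (if k = 0 then 0 else 1 / of_nat m)" if k: "k < m" for k
  proof -
    have "zeta m k + cnj (zeta m k) = of_real (2 * cos (2 * pi * real k / real m))"
      by (simp add: zeta_def complex_eq_iff)
    then have "of_real (q k) * R k = (3 - 2 * (zeta m k + cnj (zeta m k))) * R k"
      by (simp add: q_def)
    also have "\<dots> = 3 * R k - 2 * (zeta m k * R k) - 2 * (cnj (zeta m k) * R k)"
      by (simp add: algebra_simps)
    also have "\<dots> = (\<Sum>d<m. of_real (3 * r d - 2 * r ((d + 1) mod m) - 2 * r ((d + m - 1) mod m)) * cnj (zeta m k ^ d))"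
      unfolding shift1[symmetric] shift2[symmetric]
      unfolding R_def sum_distrib_left sum_subtractf[symmetric]
      by (intro sum.cong refl) (simp add: algebra_simps)
    also have "\<dots> = (\<Sum>d<m. (if d = 0 then 1 / of_nat m else 0) - cnj (zeta m k ^ d) / of_nat m / of_nat m)"
    proof (intro sum.cong refl)
      fix d assume "d \<in> {..<m}"
      then have d: "d < m" by simp
      show "of_real (3 * r d - 2 * r ((d + 1) mod m) - 2 * r ((d + m - 1) mod m)) * cnj (zeta m k ^ d) =
          (if d = 0 then 1 / of_nat m else 0) - cnj (zeta m k ^ d) / of_nat m / of_nat m"
        unfolding rec[OF d] by (simp add: diff_divide_distrib left_diff_distrib)
    qed
    also have "\<dots> = 1 / of_nat m - cnj (\<Sum>d<m. zeta m k ^ d) / of_nat m / of_nat m"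
      using m0 by (simp add: sum_subtractf sum_divide_distrib)
    also have "\<dots> = (if k = 0 then 0 else 1 / of_nat m)"
      using m0 k by (simp add: sum_zeta_power)
    finally show ?thesis .
  qed
  have "of_nat m * complex_of_real (r d) = (\<Sum>e<m. of_real (r e) * (if d mod m = e then of_nat m else 0))"
    using d by (simp add: if_distrib[of "\<lambda>z. _ * z"] cong: if_cong)
  also have "\<dots> = (\<Sum>e<m. of_real (r e) * (\<Sum>k<m. cnj (zeta m k ^ e) * zeta m k ^ d))"
    by (intro sum.cong refl) (simp only: zeta_orthogonal lessThan_iff)
  also have "\<dots> = (\<Sum>k<m. R k * zeta m k ^ d)"
    unfolding R_def sum_distrib_left sum_distrib_right by (subst sum.swap) (simp only: mult.assoc)
  also have "\<dots> = (\<Sum>k<m. if k = 0 then 0 else zeta m k ^ d / of_real (q k) / of_nat m)"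
  proof (intro sum.cong refl)
    fix k assume "k \<in> {..<m}"
    then show "R k * zeta m k ^ d = (if k = 0 then 0 else zeta m k ^ d / of_real (q k) / of_nat m)"
      using R[of k] q[of k] m0 by (auto simp: field_simps split: if_splits)
  qed
  also have "\<dots> = (\<Sum>k=1..<m. zeta m k ^ d / of_real (q k)) / of_nat m"
    using m0 by (simp add: lessThan_atLeast0 sum.atLeast_Suc_lessThan sum_divide_distrib)
  finally have "Re (of_nat m * complex_of_real (r d)) = Re ((\<Sum>k=1..<m. zeta m k ^ d / of_real (q k)) / of_real (real m))"
    by (simp only: of_real_of_nat_eq)
  then have "real m * r d = (\<Sum>k=1..<m. Re (zeta m k ^ d) / q k) / real m"
    by (simp only: Re_divide_of_real Re_sum) simp
  then show ?thesis using m0 by (simp add: q_def power2_eq_square field_simps)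
qed

text \<open>Since 3 - 4 cos does not vanish at any of the angles, this recurrence determines the
  row. Checking it takes only rational numbers, whereas evaluating the Fourier sums would need the
  cosines of 2 pi k / 5 or 2 pi k / 7.\<close>

lemma Sigma_row_recurrence:
  assumes "m \<ge> 2" "m \<le> 8" "d < m"
  shows "3 * Sigma_row m ! d - 2 * Sigma_row m ! ((d + 1) mod m) - 2 * Sigma_row m ! ((d + m - 1) mod m) =
    ((if d = 0 then 1 else 0) - 1 / real m) / real m"
proof -
  consider "m = 2" | "m = 3" | "m = 4" | "m = 5" | "m = 6" | "m = 7" | "m = 8"
    using assms by linarith
  then show ?thesis
  proof cases
    case 1
    then consider "d = 0" | "d = 1" using assms by linarith
    then show ?thesis by cases (simp_all add: 1 Sigma_row_def)
  next
    case 2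
    then consider "d = 0" | "d = 1" | "d = 2" using assms by linarith
    then show ?thesis by cases (simp_all add: 2 Sigma_row_def)
  next
    case 3
    then consider "d = 0" | "d = 1" | "d = 2" | "d = 3" using assms by linarith
    then show ?thesis by cases (simp_all add: 3 Sigma_row_def)
  next
    case 4
    then consider "d = 0" | "d = 1" | "d = 2" | "d = 3" | "d = 4" using assms by linarith
    then show ?thesis by cases (simp_all add: 4 Sigma_row_def)
  next
    case 5
    then consider "d = 0" | "d = 1" | "d = 2" | "d = 3" | "d = 4" | "d = 5" using assms by linarith
    then show ?thesis by cases (simp_all add: 5 Sigma_row_def)
  next
    case 6
    then consider "d = 0" | "d = 1" | "d = 2" | "d = 3" | "d = 4" | "d = 5" | "d = 6"
      using assms by linarith
    then show ?thesis by cases (simp_all add: 6 Sigma_row_def)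
  next
    case 7
    then consider "d = 0" | "d = 1" | "d = 2" | "d = 3" | "d = 4" | "d = 5" | "d = 6" | "d = 7"
      using assms by linarith
    then show ?thesis by cases (simp_all add: 7 Sigma_row_def)
  qed
qed

lemma circulant_entry:
  assumes m: "m \<ge> 2" "m \<le> 8" and idx: "bij_betw idx (UNIV :: 'm::finite set) {..<m}"
  shows "circulant m idx (Sigma_row m) $ j $ l =
    (\<Sum>k=1..<m. Re (zeta m k ^ idx l * cnj (zeta m k ^ idx j)) /
       ((real m)\<^sup>2 * (3 - 4 * cos (2 * pi * real k / real m))))"
proof -
  have m0: "m > 0" using m by simp
  have lt: "idx j < m" "idx l < m" using bij_betwE[OF idx] by auto
  have eq: "zeta m k ^ ((idx l + m - idx j) mod m) = zeta m k ^ idx l * cnj (zeta m k ^ idx j)" for k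
  proof -
    have "zeta m k ^ ((idx l + m - idx j) mod m) = zeta m ((idx l + m - idx j) mod m) ^ k"
      by (simp only: zeta_power mult.commute)
    also have "\<dots> = (zeta m (idx l) * cnj (zeta m (idx j))) ^ k"
      using lt m0 by (simp only: zeta_mult_cnj)
    also have "\<dots> = zeta m (idx l) ^ k * cnj (zeta m (idx j) ^ k)"
      by (simp only: power_mult_distrib complex_cnj_power)
    finally show ?thesis by (simp only: zeta_power mult.commute[of k])
  qed
  have "circulant m idx (Sigma_row m) $ j $ l = Sigma_row m ! ((idx l + m - idx j) mod m)"
    by (simp add: circulant_def)
  also have "\<dots> = (\<Sum>k=1..<m. Re (zeta m k ^ ((idx l + m - idx j) mod m)) /
      (3 - 4 * cos (2 * pi * real k / real m))) / (real m)\<^sup>2"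
    using m m0 by (intro circulant_Fourier Sigma_row_recurrence) auto
  finally show ?thesis by (simp only: eq sum_divide_distrib divide_divide_eq_left mult.commute[of "(real m)\<^sup>2"])
qed

subsection \<open>The normal limit\<close>

lemma random_bst_integral:
  fixes g :: "unit tree \<Rightarrow> 'b::{banach,second_countable_topology}"
  assumes "random_bst M n T"
  shows "(\<integral>\<omega>. g (T \<omega>) \<partial>M) = growth_mean n g"
    and "integrable M (\<lambda>\<omega>. g (T \<omega>))"
proof -
  have T: "T \<in> measurable M (count_space UNIV)"
    and law: "distr M (count_space UNIV) T = measure_pmf (growth_pmf n)"
    using assms by (simp_all add: random_bst_def random_bst_pmf_eq_growth_pmf)
  have g: "g \<in> borel_measurable (count_space UNIV)" by simp
  have "(\<integral>\<omega>. g (T \<omega>) \<partial>M) = integral\<^sup>L (distr M (count_space UNIV) T) g"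
    by (rule integral_distr[OF T g, symmetric])
  then show "(\<integral>\<omega>. g (T \<omega>) \<partial>M) = growth_mean n g"
    by (simp only: law)
  have "integrable (distr M (count_space UNIV) T) g"
    unfolding law by simp
  then show "integrable M (\<lambda>\<omega>. g (T \<omega>))"
    by (rule integrable_distr[OF T])
qed

lemma norm_lam_ge: "norm (lam m k) \<ge> 1"
  using norm_triangle_ineq2[of "2 * zeta m k" 1] by (simp add: lam_def norm_mult)

text \<open>Fourier inversion with |lam| \<ge> 1, then Cauchy-Schwarz and (x + 1)^2 \<le> 2 x^2 + 2.
  The constants are crude because only boundedness of second moments is wanted.\<close>

lemma depth_deviation_sq_le:
  assumes "j < m"
  shows "(real (depth_count m j t) - real (size t) / real m)\<^sup>2 \<le>
    (\<Sum>k=1..<m. 2 * (norm (leaf_char m k t))\<^sup>2 + 2)"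
proof -
  let ?x = "real (depth_count m j t) - real (size t) / real m"
  have m: "real m > 0" using assms by simp
  have "\<bar>?x\<bar> = norm (complex_of_real ?x)" by (simp only: norm_of_real)
  also have "\<dots> = norm (\<Sum>k=1..<m. cnj (zeta m k ^ j) * (leaf_char m k t - 1) / lam m k) / real m"
    unfolding depth_count_eq_leaf_char[OF assms] by (simp add: norm_divide)
  also have "\<dots> \<le> (\<Sum>k=1..<m. norm (leaf_char m k t - 1)) / real m"
  proof (intro divide_right_mono sum_norm_le)
    fix k
    have "norm (leaf_char m k t - 1) / norm (lam m k) \<le> norm (leaf_char m k t - 1) / 1"
      using norm_lam_ge lam_neq_0 by (intro divide_left_mono) auto
    then show "norm (cnj (zeta m k ^ j) * (leaf_char m k t - 1) / lam m k) \<le> norm (leaf_char m k t - 1)"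
      by (simp add: norm_mult norm_divide norm_power)
  qed simp
  finally have "\<bar>?x\<bar>\<^sup>2 \<le> ((\<Sum>k=1..<m. norm (leaf_char m k t - 1)) / real m)\<^sup>2"
    by (intro power_mono) auto
  also have "\<dots> \<le> (\<Sum>k=1..<m. (norm (leaf_char m k t - 1))\<^sup>2) * real (card {1..<m}) / (real m)\<^sup>2"
    unfolding power_divide by (intro divide_right_mono sum_squared_le_sum_of_squares) auto
  also have "\<dots> \<le> (\<Sum>k=1..<m. (norm (leaf_char m k t - 1))\<^sup>2) * (real m)\<^sup>2 / (real m)\<^sup>2"
  proof (intro divide_right_mono mult_left_mono sum_nonneg)
    have "card {1..<m} \<le> m * m" by (cases m) auto
    then have "real (card {1..<m}) \<le> real (m * m)" by (rule of_nat_mono)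
    then show "real (card {1..<m}) \<le> (real m)\<^sup>2" by (simp add: power2_eq_square)
  qed auto
  also have "\<dots> = (\<Sum>k=1..<m. (norm (leaf_char m k t - 1))\<^sup>2)" using m by simp
  also have "\<dots> \<le> (\<Sum>k=1..<m. 2 * (norm (leaf_char m k t))\<^sup>2 + 2)"
  proof (intro sum_mono)
    fix k
    have "(norm (leaf_char m k t - 1))\<^sup>2 \<le> (norm (leaf_char m k t) + 1)\<^sup>2"
      using norm_triangle_ineq4[of "leaf_char m k t" 1] by (intro power_mono) auto
    also have "\<dots> \<le> 2 * (norm (leaf_char m k t))\<^sup>2 + 2"
      using sum_squares_ge_zero[of "norm (leaf_char m k t) - 1" 0] by (simp add: power2_eq_square algebra_simps)
    finally show "(norm (leaf_char m k t - 1))\<^sup>2 \<le> 2 * (norm (leaf_char m k t))\<^sup>2 + 2" .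
  qed
  finally show ?thesis by simp
qed

lemma powr_minus_half: "x \<ge> 0 \<Longrightarrow> x powr (- 1 / 2) = 1 / sqrt x"
  using powr_minus_divide[of x "1 / 2"] by (simp add: powr_half_sqrt)

lemma depth_vec_normal_limit:
  fixes idx :: "'m::finite \<Rightarrow> nat" and M :: "'w measure"
  assumes m: "m \<ge> 2" "m \<le> 8" and idx: "bij_betw idx UNIV {..<m}"
    and M: "prob_space M" and T: "\<And>n. random_bst M n (T n)"
  shows "\<exists>N. multivariate_normal 0 (circulant m idx (Sigma_row m)) N \<and>
    converges_in_distribution M (\<lambda>n \<omega>. real n powr (-1/2) *\<^sub>R
      (depth_vec m idx (T n \<omega>) - (real n / real m) *\<^sub>R 1)) N"
proof -
  let ?K = "{1..<m}"
  have m0: "m > 0" using m by simp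
  have lt: "idx \<kappa> < m" for \<kappa> using bij_betwE[OF idx] by auto
  have lam: "Re (lam m k) \<le> 9 / 20" if "k \<in> ?K" for k
    using cos_root_le[OF that m(2)] by (simp add: Re_lam)
  define w where "w = (\<lambda>k. (real m)\<^sup>2 * (3 - 4 * cos (2 * pi * real k / real m)))"
  have w: "w k > 0" if "k \<in> ?K" for k
    using cos_root_le[OF that m(2)] m0 by (simp add: w_def)
  \<comment> \<open>Two independent normals for each root, one for the real and one for the
    imaginary part: Re (z cnj w) = Re z Re w + Im z Im w makes the circulant matrix a Gram
    matrix.\<close>
  define A where "A = (\<lambda>(k, b) \<kappa>. (if b then Re (zeta m k ^ idx \<kappa>) else Im (zeta m k ^ idx \<kappa>)) / sqrt (w k))"
  have sumA: "(\<Sum>i\<in>?K \<times> UNIV. f i) = (\<Sum>k\<in>?K. f (k, True) + f (k, False))" for f :: "nat \<times> bool \<Rightarrow> real"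
    by (simp add: UNIV_bool add.commute sum.cartesian_product[of "\<lambda>k b. f (k, b)", simplified, symmetric])
  have cov: "(\<chi> \<kappa> \<mu>. \<Sum>i\<in>?K \<times> UNIV. A i \<kappa> * A i \<mu>) = circulant m idx (Sigma_row m)"
  proof (rule vec_eq_iff[THEN iffD2], rule allI, rule vec_eq_iff[THEN iffD2], rule allI)
    fix \<kappa> \<mu>
    have "(\<Sum>i\<in>?K \<times> UNIV. A i \<kappa> * A i \<mu>) = (\<Sum>k\<in>?K. Re (zeta m k ^ idx \<mu> * cnj (zeta m k ^ idx \<kappa>)) / w k)"
      unfolding sumA using w
      by (intro sum.cong refl) (auto simp: A_def less_imp_le real_sqrt_mult_self add_divide_distrib mult.commute simp del: complex_cnj_power)
    then show "(\<chi> \<kappa> \<mu>. \<Sum>i\<in>?K \<times> UNIV. A i \<kappa> * A i \<mu>) $ \<kappa> $ \<mu> = circulant m idx (Sigma_row m) $ \<kappa> $ \<mu>"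
      by (simp only: circulant_entry[OF m idx] w_def vec_lambda_beta)
  qed
  define U where "U = (\<lambda>(u :: real ^ 'm) k. \<Sum>\<kappa>\<in>UNIV. of_real (u $ \<kappa>) * cnj (zeta m k ^ idx \<kappa>))"
  have finI: "finite (?K \<times> (UNIV :: bool set))" by simp
  obtain N :: "(real ^ 'm) measure" where N: "multivariate_normal 0 (circulant m idx (Sigma_row m)) N"
    "\<And>u. (\<integral>x. cis (u \<bullet> x) \<partial>N) = of_real (exp (- (\<Sum>i\<in>?K \<times> UNIV. (\<Sum>\<kappa>\<in>UNIV. u $ \<kappa> * A i \<kappa>)\<^sup>2) / 2))"
    "integrable N (\<lambda>x. (norm x)\<^sup>2)"
    using gaussian_vector_exists[OF finI, of A] unfolding cov by blast
  have chfN: "(\<integral>x. cis (u \<bullet> x) \<partial>N) = of_real (exp (- (\<Sum>k\<in>?K. (norm (U u k))\<^sup>2 / w k) / 2))" for u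
  proof -
    have "(\<Sum>i\<in>?K \<times> UNIV. (\<Sum>\<kappa>\<in>UNIV. u $ \<kappa> * A i \<kappa>)\<^sup>2) = (\<Sum>k\<in>?K. (norm (U u k))\<^sup>2 / w k)"
      unfolding sumA
    proof (intro sum.cong refl)
      fix k assume k: "k \<in> ?K"
      have "(\<Sum>\<kappa>\<in>UNIV. u $ \<kappa> * A (k, True) \<kappa>) = Re (U u k) / sqrt (w k)"
        "(\<Sum>\<kappa>\<in>UNIV. u $ \<kappa> * A (k, False) \<kappa>) = - Im (U u k) / sqrt (w k)"
        by (simp_all add: A_def U_def Re_sum Im_sum sum_divide_distrib sum_negf complex_cnj_power[symmetric] del: complex_cnj_power)
      then show "(\<Sum>\<kappa>\<in>UNIV. u $ \<kappa> * A (k, True) \<kappa>)\<^sup>2 + (\<Sum>\<kappa>\<in>UNIV. u $ \<kappa> * A (k, False) \<kappa>)\<^sup>2 = (norm (U u k))\<^sup>2 / w k"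
        using w[OF k] by (simp add: power_divide cmod_power2 add_divide_distrib)
    qed
    then show ?thesis by (simp only: N(2))
  qed
  define X where "X = (\<lambda>n \<omega>. real n powr (-1/2) *\<^sub>R (depth_vec m idx (T n \<omega>) - (real n / real m) *\<^sub>R (1 :: real ^ 'm)))"
  define Y where "Y = (\<lambda>n (t :: unit tree). real n powr (-1/2) *\<^sub>R (depth_vec m idx t - (real n / real m) *\<^sub>R (1 :: real ^ 'm)))"
  have XY: "X n \<omega> = Y n (T n \<omega>)" for n \<omega> by (simp add: X_def Y_def)
  have X_meas: "X n \<in> borel_measurable M" for n
  proof -
    have "T n \<in> measurable M (count_space UNIV)" using T[of n] by (simp add: random_bst_def)
    then have "(\<lambda>\<omega>. Y n (T n \<omega>)) \<in> borel_measurable M" by (rule measurable_compose) simp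
    then show ?thesis by (simp add: XY[abs_def])
  qed
  have Ycomp: "Y n t $ \<kappa> = (real (depth_count m (idx \<kappa>) t) - real n / real m) / sqrt (real n)" for n \<kappa> and t :: "unit tree"
    unfolding Y_def powr_minus_half[OF of_nat_0_le_iff] by (simp add: depth_vec_def)
  have chfX: "(\<lambda>n. \<integral>\<omega>. cis (u \<bullet> X n \<omega>) \<partial>M) \<longlonglongrightarrow> (\<integral>x. cis (u \<bullet> x) \<partial>N)" for u
  proof -
    \<comment> \<open>The coefficients of u in the Fourier inversion. The constant \<open>c\<close>
      comes from the 1 in leaf_char - 1; its phase c / sqrt n disappears in the limit.\<close>
    define a where "a = (\<lambda>k. U u k / of_nat m / lam m k)"
    define c where "c = Re (\<Sum>k\<in>?K. a k)"
    have sym: "a (m - k) = cnj (a k)" if "k \<in> ?K" for k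
    proof -
      have "U u (m - k) = cnj (U u k)"
        using that m0 by (simp add: U_def cnj_zeta[of m k, symmetric])
      then show ?thesis using that m0 by (simp add: a_def cnj_lam)
    qed
    have inner: "u \<bullet> Y n t = (Re (\<Sum>k\<in>?K. a k * leaf_char m k t)) / sqrt (real n) - c / sqrt (real n)" if "size t = n" for n t
    proof -
      have "complex_of_real (\<Sum>\<kappa>\<in>UNIV. u $ \<kappa> * (real (depth_count m (idx \<kappa>) t) - real n / real m)) =
          (\<Sum>\<kappa>\<in>UNIV. of_real (u $ \<kappa>) * ((\<Sum>k\<in>?K. cnj (zeta m k ^ idx \<kappa>) * (leaf_char m k t - 1) / lam m k) / of_nat m))"
        unfolding that[symmetric] by (simp only: of_real_sum of_real_mult depth_count_eq_leaf_char[OF lt])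
      also have "\<dots> = (\<Sum>k\<in>?K. a k * (leaf_char m k t - 1))"
        unfolding a_def U_def sum_distrib_left sum_distrib_right sum_divide_distrib
        by (subst sum.swap) (simp add: mult_ac)
      also have "\<dots> = (\<Sum>k\<in>?K. a k * leaf_char m k t) - (\<Sum>k\<in>?K. a k)"
        by (simp add: right_diff_distrib sum_subtractf)
      finally have eq: "complex_of_real (\<Sum>\<kappa>\<in>UNIV. u $ \<kappa> * (real (depth_count m (idx \<kappa>) t) - real n / real m)) =
          (\<Sum>k\<in>?K. a k * leaf_char m k t) - (\<Sum>k\<in>?K. a k)" .
      have "(\<Sum>\<kappa>\<in>UNIV. u $ \<kappa> * (real (depth_count m (idx \<kappa>) t) - real n / real m)) =
          Re (\<Sum>k\<in>?K. a k * leaf_char m k t) - c"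
        using arg_cong[OF eq, of Re] by (simp only: c_def Re_complex_of_real minus_complex.sel)
      moreover have "u \<bullet> Y n t = (\<Sum>\<kappa>\<in>UNIV. u $ \<kappa> * (real (depth_count m (idx \<kappa>) t) - real n / real m)) / sqrt (real n)"
        by (simp add: inner_vec_def Ycomp sum_divide_distrib)
      ultimately show ?thesis by (simp only: diff_divide_distrib)
    qed
    have "(\<integral>\<omega>. cis (u \<bullet> X n \<omega>) \<partial>M) = cis (- (c / sqrt (real n))) * growth_mean n
        (\<lambda>t. cis (Re (\<Sum>k\<in>?K. a k * leaf_char m k t) / sqrt (real n)))" for n
    proof -
      have "(\<integral>\<omega>. cis (u \<bullet> X n \<omega>) \<partial>M) = growth_mean n (\<lambda>t. cis (u \<bullet> Y n t))"
        unfolding XY by (rule random_bst_integral(1)[OF T])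
      also have "\<dots> = growth_mean n
          (\<lambda>t. cis (- (c / sqrt (real n))) * cis (Re (\<Sum>k\<in>?K. a k * leaf_char m k t) / sqrt (real n)))"
        by (intro growth_expectation_cong) (simp only: inner cis_mult, simp only: diff_conv_add_uminus add.commute)
      finally show ?thesis by simp
    qed
    moreover have cl: "(\<lambda>n. cis (- (c / sqrt (real n)))) \<longlonglongrightarrow> cis 0"
    proof -
      have "(\<lambda>n. - (c / sqrt (real n))) \<longlonglongrightarrow> 0" by real_asymp
      then show ?thesis unfolding cis_conv_exp by (intro tendsto_intros)
    qed
    \<comment> \<open>The division by lam in \<open>a\<close> cancels the size of the increments,
      and 1 - 2 Re lam = 3 - 4 cos (2 pi k / m).\<close>
    moreover have "(\<Sum>k\<in>?K. (norm (a k) * norm (lam m k))\<^sup>2 / (1 - 2 * Re (lam m k))) = (\<Sum>k\<in>?K. (norm (U u k))\<^sup>2 / w k)"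
    proof (intro sum.cong refl)
      fix k assume "k \<in> ?K"
      have "norm (a k) * norm (lam m k) = norm (U u k) / real m"
        using lam_neq_0[of m k] by (simp add: a_def norm_divide norm_mult)
      then show "(norm (a k) * norm (lam m k))\<^sup>2 / (1 - 2 * Re (lam m k)) = (norm (U u k))\<^sup>2 / w k"
        by (simp add: Re_lam w_def power_divide)
    qed
    ultimately show ?thesis
      using tendsto_mult[OF cl char_fun_limit[where a = a, OF m0 lam sym]] chfN[of u] by (simp del: Re_sum)
  qed
  have "\<exists>C. \<forall>n\<ge>1. (\<integral>\<omega>. (norm (X n \<omega>))\<^sup>2 \<partial>M) \<le> C"
  proof -
    have "\<forall>k\<in>?K. \<exists>C\<ge>0. \<forall>n. growth_mean n (\<lambda>t. (norm (leaf_char m k t))\<^sup>2) \<le> C * real (Suc n)"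
      using lam by (intro ballI second_moment_bound) (fastforce intro: le_less_trans)
    then obtain C where C: "\<And>k. k \<in> ?K \<Longrightarrow> C k \<ge> 0"
      "\<And>k n. k \<in> ?K \<Longrightarrow> growth_mean n (\<lambda>t. (norm (leaf_char m k t))\<^sup>2) \<le> C k * real (Suc n)"
      by metis
    define D where "D = (\<Sum>k\<in>?K. 4 * C k + 2)"
    have "(\<integral>\<omega>. (norm (X n \<omega>))\<^sup>2 \<partial>M) \<le> real CARD('m) * D" if n: "n \<ge> 1" for n
    proof -
      have n0: "real n > 0" using n by simp
      have "(\<integral>\<omega>. (norm (X n \<omega>))\<^sup>2 \<partial>M) = growth_mean n (\<lambda>t. (norm (Y n t))\<^sup>2)"
        unfolding XY by (rule random_bst_integral(1)[OF T])
      also have "\<dots> \<le> growth_mean n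
          (\<lambda>t. real CARD('m) * ((\<Sum>k\<in>?K. 2 * (norm (leaf_char m k t))\<^sup>2 + 2) / real n))"
      proof (rule growth_expectation_mono)
        fix t :: "unit tree" assume t: "size t = n"
        have "(norm (Y n t))\<^sup>2 = (\<Sum>\<kappa>\<in>(UNIV::'m set). (real (depth_count m (idx \<kappa>) t) - real n / real m)\<^sup>2 / real n)"
          unfolding norm_vec_sq Ycomp by (simp add: power_divide)
        also have "\<dots> \<le> (\<Sum>\<kappa>\<in>(UNIV::'m set). (\<Sum>k\<in>?K. 2 * (norm (leaf_char m k t))\<^sup>2 + 2) / real n)"
          using depth_deviation_sq_le[OF lt, where t = t] by (intro sum_mono divide_right_mono) (auto simp: t)
        finally show "(norm (Y n t))\<^sup>2 \<le> real CARD('m) * ((\<Sum>k\<in>?K. 2 * (norm (leaf_char m k t))\<^sup>2 + 2) / real n)"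
          by simp
      qed
      also have "\<dots> = real CARD('m) * ((\<Sum>k\<in>?K. 2 * growth_mean n (\<lambda>t. (norm (leaf_char m k t))\<^sup>2) + 2) / real n)"
        by simp
      also have "\<dots> \<le> real CARD('m) * ((\<Sum>k\<in>?K. (4 * C k + 2) * real n) / real n)"
      proof (intro mult_left_mono divide_right_mono sum_mono)
        fix k assume k: "k \<in> ?K"
        have "C k * real (Suc n) \<le> C k * (2 * real n)" using C(1)[OF k] n by (intro mult_left_mono) auto
        then show "2 * growth_mean n (\<lambda>t. (norm (leaf_char m k t))\<^sup>2) + 2 \<le> (4 * C k + 2) * real n"
          using C(2)[OF k, of n] n by (simp add: ring_distribs)
      qed auto
      also have "\<dots> = real CARD('m) * D"
        using n0 by (simp add: D_def flip: sum_distrib_right)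
      finally show ?thesis .
    qed
    then show ?thesis by blast
  qed
  then obtain C where C: "\<And>n. n \<ge> 1 \<Longrightarrow> (\<integral>\<omega>. (norm (X n \<omega>))\<^sup>2 \<partial>M) \<le> C" by blast
  have "converges_in_distribution M X N"
  proof (rule converges_in_distribution_char_fun[OF M X_meas _ _ chfX _ N(3)])
    show "prob_space N" "sets N = sets borel" using N(1) by (auto simp: multivariate_normal_def)
    show "\<forall>\<^sub>F n in sequentially. integrable M (\<lambda>\<omega>. (norm (X n \<omega>))\<^sup>2) \<and>
        (\<integral>\<omega>. (norm (X n \<omega>))\<^sup>2 \<partial>M) \<le> max C (\<integral>x. (norm x)\<^sup>2 \<partial>N)"
      using eventually_ge_at_top[of 1]
    proof eventually_elim
      case (elim n)
      have "integrable M (\<lambda>\<omega>. (norm (X n \<omega>))\<^sup>2)"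
        unfolding XY by (rule random_bst_integral(2)[OF T])
      then show ?case using C[OF elim] by auto
    qed
  qed simp
  then show ?thesis using N(1) unfolding X_def by blast
qed

text \<open>Countability lets the law of a list of trees be determined by its point masses, and
  makes histories measurable.\<close>

instance tree :: (countable) countable
  by countable_datatype

subsection \<open>Histories of the growth process\<close>

text \<open>A maximal inequality concerns a whole path, so the joint law of the trees of sizes 0 to
  \<open>n\<close> is needed. It is a finitely supported law on lists, the current tree being the
  last entry.\<close>

primrec history_pmf :: "nat \<Rightarrow> unit tree list pmf" where
  "history_pmf 0 = return_pmf [Leaf]"
| "history_pmf (Suc n) = history_pmf n \<bind> (\<lambda>h. map_pmf (\<lambda>t. h @ [t]) (pmf_of_set (grow (last h))))"

definition history :: "(nat \<Rightarrow> 'w \<Rightarrow> unit tree) \<Rightarrow> nat \<Rightarrow> 'w \<Rightarrow> unit tree list" where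
  "history T n \<omega> = map (\<lambda>i. T i \<omega>) [0..<Suc n]"

abbreviation history_mean :: "nat \<Rightarrow> (unit tree list \<Rightarrow> 'b::{banach,second_countable_topology}) \<Rightarrow> 'b" where
  "history_mean n \<equiv> measure_pmf.expectation (history_pmf n)"

lemma finite_history_pmf [simp]: "finite (set_pmf (history_pmf n))"
  by (induction n) auto

lemma length_history_pmf: "h \<in> set_pmf (history_pmf n) \<Longrightarrow> length h = Suc n"
  by (induction n arbitrary: h) auto

lemma size_last_history_pmf: "h \<in> set_pmf (history_pmf n) \<Longrightarrow> size (last h) = n"
  by (induction n arbitrary: h) (auto simp: grow_eq_image)

lemma integrable_history_pmf [simp]:
  fixes f :: "unit tree list \<Rightarrow> 'b::{banach,second_countable_topology}"
  shows "integrable (measure_pmf (history_pmf n)) f"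
  by (rule integrable_measure_pmf_finite) simp

lemma expectation_history_Suc:
  fixes f :: "unit tree list \<Rightarrow> 'b::{banach,second_countable_topology}"
  shows "history_mean (Suc n) f = history_mean n
    (\<lambda>h. (\<Sum>i\<le>size (last h). f (h @ [grow_at (last h) i])) /\<^sub>R real (Suc (size (last h))))"
proof -
  have "history_mean (Suc n) f =
      (\<Sum>h\<in>set_pmf (history_pmf n). pmf (history_pmf n) h *\<^sub>R
         measure_pmf.expectation (map_pmf (\<lambda>t. h @ [t]) (pmf_of_set (grow (last h)))) f)"
    by (simp add: pmf_expectation_bind[of "set_pmf (history_pmf n)"])
  also have "\<dots> = history_mean n
      (\<lambda>h. measure_pmf.expectation (map_pmf (\<lambda>t. h @ [t]) (pmf_of_set (grow (last h)))) f)"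
    by (rule integral_measure_pmf[symmetric]) auto
  finally show ?thesis by (simp only: integral_map_pmf expectation_grow)
qed

lemma history_expectation_mono:
  fixes f g :: "unit tree list \<Rightarrow> real"
  assumes "\<And>h. h \<in> set_pmf (history_pmf n) \<Longrightarrow> f h \<le> g h"
  shows "history_mean n f \<le> history_mean n g"
  by (intro integral_mono_AE) (auto simp: AE_measure_pmf_iff intro: assms)

lemma pmf_history_snoc:
  "pmf (history_pmf (Suc n)) (xs @ [t]) = pmf (history_pmf n) xs * pmf (pmf_of_set (grow (last xs))) t"
proof -
  have "pmf (map_pmf (\<lambda>t. h @ [t]) (pmf_of_set (grow (last h)))) (xs @ [t]) =
      (if h = xs then pmf (pmf_of_set (grow (last xs))) t else 0)" for h :: "unit tree list"
  proof (cases "h = xs")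
    case True
    have "inj (\<lambda>t. xs @ [t])" by (rule injI) simp
    from pmf_map_inj'[OF this] show ?thesis unfolding True by simp
  next
    case False
    then have "xs @ [t] \<notin> set_pmf (map_pmf (\<lambda>t. h @ [t]) (pmf_of_set (grow (last h))))"
      by auto
    then show ?thesis using False by (simp only: set_pmf_iff) simp
  qed
  then have "pmf (history_pmf (Suc n)) (xs @ [t]) =
      history_mean n (\<lambda>h. if h = xs then pmf (pmf_of_set (grow (last xs))) t else 0)"
    by (simp add: pmf_bind)
  also have "\<dots> = history_mean n (\<lambda>h. indicator {xs} h *\<^sub>R pmf (pmf_of_set (grow (last xs))) t)"
    by (intro Bochner_Integration.integral_cong refl) simp
  also have "\<dots> = pmf (history_pmf n) xs * pmf (pmf_of_set (grow (last xs))) t"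
    by (simp add: measure_pmf_single)
  finally show ?thesis .
qed

lemma prob_history:
  assumes "bst_growth_process M T"
  shows "measure M {\<omega> \<in> space M. \<forall>i\<le>n. T i \<omega> = h i} = pmf (history_pmf n) (map h [0..<Suc n])"
proof (induction n)
  case 0
  interpret prob_space M using assms by (simp add: bst_growth_process_def)
  have T0: "AE \<omega> in M. T 0 \<omega> = Leaf" and meas: "T 0 \<in> measurable M (count_space UNIV)"
    using assms by (simp_all add: bst_growth_process_def)
  show ?case
  proof (cases "h 0 = Leaf")
    case True
    have "measure M {\<omega> \<in> space M. T 0 \<omega> = h 0} = measure M (space M)"
      using T0 meas by (intro measure_eq_AE) (auto simp: True)
    then show ?thesis using True by (simp add: prob_space)
  next
    case False
    have "measure M {\<omega> \<in> space M. T 0 \<omega> = h 0} = measure M {}"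
      using T0 meas False by (intro measure_eq_AE) auto
    then show ?thesis using False by (simp add: indicator_def)
  qed
next
  case (Suc n)
  have "measure M {\<omega> \<in> space M. \<forall>i\<le>Suc n. T i \<omega> = h i} =
      pmf (history_pmf n) (map h [0..<Suc n]) * pmf (pmf_of_set (grow (h n))) (h (Suc n))"
    using assms unfolding bst_growth_process_def Suc.IH[symmetric] by blast
  also have "\<dots> = pmf (history_pmf (Suc n)) (map h [0..<Suc n] @ [h (Suc n)])"
    by (subst pmf_history_snoc) simp
  finally show ?case by simp
qed

lemma measurable_history:
  assumes "bst_growth_process M T"
  shows "history T n \<in> measurable M (count_space UNIV)"
proof (induction n)
  case 0
  have "T 0 \<in> measurable M (count_space UNIV)"
    using assms by (simp add: bst_growth_process_def)
  then have "(\<lambda>\<omega>. [T 0 \<omega>]) \<in> measurable M (count_space UNIV)"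
    by (rule measurable_compose) simp
  then show ?case by (simp add: history_def[abs_def])
next
  case (Suc n)
  have "T (Suc n) \<in> measurable M (count_space UNIV)"
    using assms by (simp add: bst_growth_process_def)
  then have "(\<lambda>\<omega>. h @ [T (Suc n) \<omega>]) \<in> measurable M (count_space UNIV)" for h
    by (rule measurable_compose) simp
  from measurable_compose_countable[where f = "\<lambda>h \<omega>. h @ [T (Suc n) \<omega>]", OF this Suc] show ?case
    by (simp add: history_def[abs_def])
qed

lemma distr_history:
  assumes "bst_growth_process M T"
  shows "distr M (count_space UNIV) (history T n) = measure_pmf (history_pmf n)"
proof (rule measure_eqI_countable[of _ UNIV])
  interpret prob_space M using assms by (simp add: bst_growth_process_def)
  note meas = measurable_history[OF assms, of n]
  fix xs :: "unit tree list"
  have "emeasure (distr M (count_space UNIV) (history T n)) {xs} = measure M {\<omega> \<in> space M. history T n \<omega> = xs}"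
    using meas by (subst emeasure_distr) (auto simp: emeasure_eq_measure vimage_def Int_def conj_commute)
  also have "measure M {\<omega> \<in> space M. history T n \<omega> = xs} = pmf (history_pmf n) xs"
  proof (cases "length xs = Suc n")
    case True
    then have xs: "map (\<lambda>i. xs ! i) [0..<Suc n] = xs" by (metis map_nth)
    have "{\<omega> \<in> space M. history T n \<omega> = xs} = {\<omega> \<in> space M. \<forall>i\<le>n. T i \<omega> = xs ! i}"
      using True by (auto simp: history_def list_eq_iff_nth_eq less_Suc_eq_le simp del: upt_Suc)
    then show ?thesis by (simp only: prob_history[OF assms] xs)
  next
    case False
    then have "{\<omega> \<in> space M. history T n \<omega> = xs} = {}" by (auto simp: history_def simp del: upt_Suc)
    moreover have "xs \<notin> set_pmf (history_pmf n)" using False length_history_pmf by blast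
    ultimately show ?thesis by (simp only: measure_empty set_pmf_iff not_not)
  qed
  finally show "emeasure (distr M (count_space UNIV) (history T n)) {xs} = emeasure (measure_pmf (history_pmf n)) {xs}"
    by (simp add: emeasure_pmf_single)
qed auto

subsection \<open>A maximal inequality\<close>

text \<open>The part of a step that the current tree does not predict. The path is a function, so
  that both a process and a list, through its indexing function, can be inserted.\<close>

definition martingale_diff :: "nat \<Rightarrow> nat \<Rightarrow> (nat \<Rightarrow> unit tree) \<Rightarrow> nat \<Rightarrow> complex" where
  "martingale_diff m k f i =
     leaf_char m k (f (Suc i)) - (1 + lam m k / of_nat (Suc i)) * leaf_char m k (f i)"

lemma martingale_diff_cong:
  "f i = g i \<Longrightarrow> f (Suc i) = g (Suc i) \<Longrightarrow> martingale_diff m k f i = martingale_diff m k g i"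
  by (simp add: martingale_diff_def)

text \<open>
  Kolmogorov's argument: the partial sums are stopped when they first exceed \<open>\<epsilon>\<close>, the
  condition in the summand of the stopped sum being that this has not happened yet.
\<close>

lemma kolmogorov_history:
  fixes wt :: "nat \<Rightarrow> complex" and m k :: nat
  assumes eps: "\<epsilon> > 0" and an: "a \<le> n"
  defines "S \<equiv> \<lambda>h j. \<Sum>i\<in>{a..<j}. wt i * martingale_diff m k ((!) h) i"
  shows "measure_pmf.prob (history_pmf n) {h. \<exists>j\<in>{a..n}. norm (S h j) \<ge> \<epsilon>} \<le>
    36 * (\<Sum>i\<in>{a..<n}. (norm (wt i))\<^sup>2) / \<epsilon>\<^sup>2"
proof -
  let ?hit = "{h. \<exists>j\<in>{a..n}. norm (S h j) \<ge> \<epsilon>}"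
  define alive where "alive = (\<lambda>h i. \<forall>j\<in>{a..i}. norm (S h j) < \<epsilon>)"
  define Q where "Q = (\<lambda>h j. \<Sum>i\<in>{a..<j}. if alive h i then wt i * martingale_diff m k ((!) h) i else 0)"
  have Q2: "history_mean n (\<lambda>h. (norm (Q h n))\<^sup>2) \<le> 36 * (\<Sum>i\<in>{a..<n}. (norm (wt i))\<^sup>2)"
    using an
  proof (induction n rule: dec_induct)
    case base
    show ?case by (simp add: Q_def)
  next
    case (step n)
    have "(\<Sum>i\<le>size (last h). (norm (Q (h @ [grow_at (last h) i]) (Suc n)))\<^sup>2) /\<^sub>R real (Suc (size (last h))) \<le>
        (norm (Q h n))\<^sup>2 + 36 * (norm (wt n))\<^sup>2" if h: "h \<in> set_pmf (history_pmf n)" for h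
    proof -
      define t where "t = last h"
      have len: "length h = Suc n" and t: "size t = n" and ne: "h \<noteq> []"
        using length_history_pmf[OF h] size_last_history_pmf[OF h] by (auto simp: t_def)
      have tn: "h ! n = t" using len ne by (simp add: t_def last_conv_nth)
      define g where "g = (\<lambda>i. h @ [grow_at t i])"
      define d where "d = (\<lambda>i. lam m k * zeta m k ^ (leaf_depths t ! i) - lam m k / of_nat (Suc n) * leaf_char m k t)"
      define w where "w = (if alive h n then wt n else 0)"
      have past: "martingale_diff m k ((!) (g i)) l = martingale_diff m k ((!) h) l" if "l < n" for i l
        using that len by (intro martingale_diff_cong) (simp_all add: g_def nth_append)
      have Spast: "S (g i) j = S h j" if "j \<le> n" for i j
        unfolding S_def using that by (intro sum.cong refl) (simp add: past)
      then have alive: "alive (g i) l = alive h l" if "l \<le> n" for i l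
        using that by (simp add: alive_def)
      have Qpast: "Q (g i) n = Q h n" for i
        unfolding Q_def by (intro sum.cong refl) (simp add: past alive)
      have new: "martingale_diff m k ((!) (g i)) n = d i" if "i \<le> n" for i
        using that len t tn
        by (simp add: martingale_diff_def g_def nth_append leaf_char_grow_at d_def ring_distribs)
      have QSuc: "Q (g i) (Suc n) = Q h n + w * d i" if "i \<le> n" for i
        using step(1) that Qpast[of i] by (simp add: Q_def sum.atLeastLessThan_Suc alive new w_def)
      have d0: "(\<Sum>i\<le>n. d i) = 0"
        by (simp add: d_def sum_subtractf leaf_char_nth t del: of_nat_Suc flip: sum_distrib_left)
      \<comment> \<open>3 for the increment and 3 for its mean; the square of 6 is the constant in
        the inequality.\<close>
      have d6: "norm (d i) \<le> 6" for i
      proof -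
        have "norm (leaf_char m k t) / real (Suc n) \<le> 1"
          using norm_leaf_char_le[of m k t] t by (simp add: field_simps)
        then have "norm (lam m k) * (norm (leaf_char m k t) / real (Suc n)) \<le> 3 * 1"
          using norm_lam_le by (intro mult_mono) auto
        then have "norm (lam m k / of_nat (Suc n) * leaf_char m k t) \<le> 3"
          by (simp add: norm_mult norm_divide del: of_nat_Suc)
        moreover have "norm (lam m k * zeta m k ^ (leaf_depths t ! i)) \<le> 3"
          using norm_lam_le by (simp add: norm_mult norm_power)
        ultimately show ?thesis unfolding d_def by (intro order_trans[OF norm_triangle_ineq4]) simp
      qed
      have "(\<Sum>i\<le>n. (norm (Q (g i) (Suc n)))\<^sup>2) = (\<Sum>i\<le>n. (norm (Q h n))\<^sup>2 + 2 * Re (cnj (Q h n) * (w * d i)) + (norm (w * d i))\<^sup>2)"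
        by (intro sum.cong refl) (simp add: QSuc norm_add_sq)
      also have "\<dots> = real (Suc n) * (norm (Q h n))\<^sup>2 + 2 * Re (cnj (Q h n) * (w * (\<Sum>i\<le>n. d i))) + (\<Sum>i\<le>n. (norm (w * d i))\<^sup>2)"
        by (simp only: sum.distrib sum_distrib_left Re_sum sum_constant card_atMost)
      also have "(\<Sum>i\<le>n. (norm (w * d i))\<^sup>2) \<le> (\<Sum>i\<le>n. 36 * (norm (wt n))\<^sup>2)"
      proof (intro sum_mono)
        fix i
        have "norm (w * d i) \<le> norm (wt n) * 6"
          unfolding norm_mult using d6 by (intro mult_mono) (auto simp: w_def)
        then have "(norm (w * d i))\<^sup>2 \<le> (norm (wt n) * 6)\<^sup>2" by (intro power_mono) auto
        then show "(norm (w * d i))\<^sup>2 \<le> 36 * (norm (wt n))\<^sup>2" by (simp add: power_mult_distrib)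
      qed
      finally have "(\<Sum>i\<le>n. (norm (Q (g i) (Suc n)))\<^sup>2) \<le> real (Suc n) * ((norm (Q h n))\<^sup>2 + 36 * (norm (wt n))\<^sup>2)"
        by (simp add: d0 ring_distribs)
      then have "(\<Sum>i\<le>n. (norm (Q (g i) (Suc n)))\<^sup>2) /\<^sub>R real (Suc n) \<le> (norm (Q h n))\<^sup>2 + 36 * (norm (wt n))\<^sup>2"
        by (simp add: field_simps)
      then show ?thesis by (simp only: g_def t_def[symmetric] t)
    qed
    then have "history_mean (Suc n) (\<lambda>h. (norm (Q h (Suc n)))\<^sup>2) \<le>
        history_mean n (\<lambda>h. (norm (Q h n))\<^sup>2 + 36 * (norm (wt n))\<^sup>2)"
      unfolding expectation_history_Suc by (intro history_expectation_mono)
    also have "\<dots> = history_mean n (\<lambda>h. (norm (Q h n))\<^sup>2) + 36 * (norm (wt n))\<^sup>2"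
      by simp
    finally show ?case using step by (simp add: sum.atLeastLessThan_Suc)
  qed
  have hit: "norm (Q h n) \<ge> \<epsilon>" if "\<exists>j\<in>{a..n}. norm (S h j) \<ge> \<epsilon>" for h
  proof -
    define j where "j = (LEAST j. j \<in> {a..n} \<and> norm (S h j) \<ge> \<epsilon>)"
    have j: "j \<in> {a..n}" "norm (S h j) \<ge> \<epsilon>"
      using that LeastI_ex[of "\<lambda>j. j \<in> {a..n} \<and> norm (S h j) \<ge> \<epsilon>"] unfolding j_def by blast+
    have least: "norm (S h i) < \<epsilon>" if "i \<in> {a..<j}" for i
      using that j(1) not_less_Least[of i "\<lambda>j. j \<in> {a..n} \<and> norm (S h j) \<ge> \<epsilon>"] unfolding j_def[symmetric] by auto
    have "Q h n = (\<Sum>i\<in>{a..<n}. if i < j then wt i * martingale_diff m k ((!) h) i else 0)"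
      unfolding Q_def
    proof (intro sum.cong refl if_cong)
      fix i assume i: "i \<in> {a..<n}"
      show "alive h i = (i < j)"
      proof
        assume "alive h i"
        then show "i < j" using j i unfolding alive_def by (meson atLeastAtMost_iff leI not_le)
      next
        assume "i < j"
        then show "alive h i" using least unfolding alive_def by simp
      qed
    qed
    also have "\<dots> = S h j"
      unfolding S_def using j(1) by (intro sum.mono_neutral_cong_right) auto
    finally show ?thesis using j(2) by simp
  qed
  have "measure_pmf.prob (history_pmf n) ?hit =
      history_mean n (indicator ?hit)"
    by simp
  also have "\<dots> \<le> history_mean n (\<lambda>h. (norm (Q h n))\<^sup>2 / \<epsilon>\<^sup>2)"
  proof (rule history_expectation_mono)
    fix h
    show "indicator ?hit h \<le> (norm (Q h n))\<^sup>2 / \<epsilon>\<^sup>2"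
    proof (cases "\<exists>j\<in>{a..n}. norm (S h j) \<ge> \<epsilon>")
      case True
      have "\<epsilon>\<^sup>2 \<le> (norm (Q h n))\<^sup>2" using hit[OF True] eps by (intro power_mono) auto
      then show ?thesis using True eps by (simp add: field_simps)
    qed simp
  qed
  also have "\<dots> = history_mean n (\<lambda>h. (norm (Q h n))\<^sup>2) / \<epsilon>\<^sup>2" by simp
  also have "\<dots> \<le> 36 * (\<Sum>i\<in>{a..<n}. (norm (wt i))\<^sup>2) / \<epsilon>\<^sup>2"
    using Q2 by (intro divide_right_mono) auto
  finally show ?thesis .
qed

lemma kolmogorov_process:
  fixes wt :: "nat \<Rightarrow> complex" and a m k :: nat
  assumes T: "bst_growth_process M T" and eps: "\<epsilon> > 0"
  defines "S \<equiv> \<lambda>\<omega> j. \<Sum>i\<in>{a..<j}. wt i * martingale_diff m k (\<lambda>i. T i \<omega>) i"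
  shows "measure M {\<omega> \<in> space M. \<exists>j\<in>{a..n}. norm (S \<omega> j) \<ge> \<epsilon>} \<le>
    36 * (\<Sum>i\<in>{a..<n}. (norm (wt i))\<^sup>2) / \<epsilon>\<^sup>2"
proof (cases "a \<le> n")
  case True
  let ?A = "{h. \<exists>j\<in>{a..n}. norm (\<Sum>i\<in>{a..<j}. wt i * martingale_diff m k ((!) h) i) \<ge> \<epsilon>}"
  have "S \<omega> j = (\<Sum>i\<in>{a..<j}. wt i * martingale_diff m k ((!) (history T n \<omega>)) i)" if "j \<le> n" for \<omega> j
    unfolding S_def using that
    by (intro sum.cong refl arg_cong2[where f = "(*)"] martingale_diff_cong)
      (auto simp: history_def simp del: upt_Suc)
  then have "{\<omega> \<in> space M. \<exists>j\<in>{a..n}. norm (S \<omega> j) \<ge> \<epsilon>} = history T n -` ?A \<inter> space M"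
    by auto
  then have "measure M {\<omega> \<in> space M. \<exists>j\<in>{a..n}. norm (S \<omega> j) \<ge> \<epsilon>} =
      measure (distr M (count_space UNIV) (history T n)) ?A"
    using measurable_history[OF T, of n] by (subst measure_distr) auto
  then show ?thesis
    unfolding distr_history[OF T] using kolmogorov_history[OF eps True, of wt m k] by simp
qed simp

subsection \<open>Almost sure convergence\<close>

lemma size_growth_process:
  assumes "bst_growth_process M T"
  shows "AE \<omega> in M. size (T n \<omega>) = n"
proof -
  have "AE h in measure_pmf (history_pmf n). size (last h) = n"
    by (simp add: AE_measure_pmf_iff size_last_history_pmf)
  then have "AE h in distr M (count_space UNIV) (history T n). size (last h) = n"
    by (simp only: distr_history[OF assms])
  then have "AE \<omega> in M. size (last (history T n \<omega>)) = n"
    by (subst (asm) AE_distr_iff[OF measurable_history[OF assms]]) auto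
  then show ?thesis by (simp add: history_def)
qed

lemma borel_measurable_leaf_char:
  assumes "T \<in> measurable M (count_space UNIV)"
  shows "(\<lambda>\<omega>. leaf_char m k (T \<omega>)) \<in> borel_measurable M"
  using assms by (rule measurable_compose) simp

lemma borel_measurable_martingale_diff:
  assumes "bst_growth_process M T"
  shows "(\<lambda>\<omega>. martingale_diff m k (\<lambda>i. T i \<omega>) i) \<in> borel_measurable M"
proof -
  have [measurable]: "(\<lambda>\<omega>. leaf_char m k (T i \<omega>)) \<in> borel_measurable M" for i
    using assms by (intro borel_measurable_leaf_char) (simp add: bst_growth_process_def)
  show ?thesis unfolding martingale_diff_def by measurable
qed

text \<open>The maximal inequality bounds the probability that the partial sums oscillate by more
  than 1 / (p + 1) after time \<open>a\<close>, uniformly in the end point, by a tail of the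
  summable series. So almost surely the sums are Cauchy.\<close>

lemma martingale_series_converges:
  fixes wt :: "nat \<Rightarrow> complex"
  assumes T: "bst_growth_process M T" and sm: "summable (\<lambda>i. (norm (wt i))\<^sup>2)"
  shows "AE \<omega> in M. convergent (\<lambda>n. \<Sum>i<n. wt i * martingale_diff m k (\<lambda>i. T i \<omega>) i)"
proof -
  interpret prob_space M using T by (simp add: bst_growth_process_def)
  define S where "S = (\<lambda>\<omega> a j. \<Sum>i\<in>{a..<j}. wt i * martingale_diff m k (\<lambda>i. T i \<omega>) i)"
  define B where "B = (\<lambda>p a n. {\<omega> \<in> space M. \<exists>j\<in>{a..n}. norm (S \<omega> a j) \<ge> 1 / real (Suc p)})"
  have [measurable]: "(\<lambda>\<omega>. S \<omega> a j) \<in> borel_measurable M" for a j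
    unfolding S_def using borel_measurable_martingale_diff[OF T, of m k] by measurable
  have B [measurable]: "B p a n \<in> sets M" for p a n
    unfolding B_def by measurable
  have "AE \<omega> in M. \<exists>a. \<forall>n. \<omega> \<notin> B p a n" for p
  proof -
    let ?C = "\<Inter>a. \<Union>n. B p a n"
    have C: "?C \<in> sets M" by measurable
    have "measure M ?C \<le> \<delta>" if \<delta>: "\<delta> > 0" for \<delta>
    proof -
      \<comment> \<open>The tail of the series for which the maximal inequality gives exactly
        \<delta>.\<close>
      define \<delta>' where "\<delta>' = \<delta> * (1 / real (Suc p))\<^sup>2 / 36"
      have "\<delta>' > 0" using \<delta> by (simp add: \<delta>'_def)
      then obtain a where a: "\<And>n. norm (\<Sum>i\<in>{a..<n}. (norm (wt i))\<^sup>2) < \<delta>'"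
        using sm unfolding summable_Cauchy by blast
      have le: "measure M (B p a n) \<le> \<delta>" for n
      proof -
        have "measure M (B p a n) \<le> 36 * (\<Sum>i\<in>{a..<n}. (norm (wt i))\<^sup>2) / (1 / real (Suc p))\<^sup>2"
          unfolding B_def S_def by (rule kolmogorov_process[OF T]) simp
        also have "\<dots> \<le> 36 * \<delta>' / (1 / real (Suc p))\<^sup>2"
          using a[of n] by (intro divide_right_mono mult_left_mono) auto
        also have "\<dots> = \<delta>" by (simp add: \<delta>'_def del: of_nat_Suc)
        finally show ?thesis .
      qed
      have "incseq (B p a)" unfolding B_def by (intro incseq_SucI) auto
      then have "(\<lambda>n. measure M (B p a n)) \<longlonglongrightarrow> measure M (\<Union>n. B p a n)"
        by (intro finite_Lim_measure_incseq) auto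
      then have "measure M (\<Union>n. B p a n) \<le> \<delta>"
        by (rule LIMSEQ_le_const2) (use le in blast)
      moreover have "measure M ?C \<le> measure M (\<Union>n. B p a n)"
        by (intro finite_measure_mono) auto
      ultimately show ?thesis by simp
    qed
    then have "measure M ?C \<le> 0 + \<delta>" if "\<delta> > 0" for \<delta>
      using that by (simp only: add_0)
    then have "measure M ?C \<le> 0" by (rule field_le_epsilon)
    then have "emeasure M ?C = 0" by (simp add: emeasure_eq_measure measure_le_0_iff)
    then have "AE \<omega> in M. \<omega> \<notin> ?C" using C by (intro AE_not_in) auto
    then show ?thesis by eventually_elim auto
  qed
  then have "AE \<omega> in M. \<forall>p. \<exists>a. \<forall>n. \<omega> \<notin> B p a n" by (simp add: AE_all_countable)
  moreover have "AE \<omega> in M. \<omega> \<in> space M" by (rule AE_space)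
  ultimately show ?thesis
  proof eventually_elim
    case (elim \<omega>)
    define s where "s = (\<lambda>n. \<Sum>i<n. wt i * martingale_diff m k (\<lambda>i. T i \<omega>) i)"
    have split: "s j = s a + S \<omega> a j" if "a \<le> j" for a j
      unfolding s_def S_def atLeast0LessThan[symmetric]
      by (rule sum.atLeastLessThan_concat[symmetric, OF le0 that])
    have "Cauchy s"
    proof (rule metric_CauchyI)
      fix e :: real assume e: "e > 0"
      then obtain p where p: "1 / real (Suc p) < e / 2"
        using nat_approx_posE[of "e / 2"] by auto
      obtain a where a: "\<And>n. \<omega> \<notin> B p a n" using elim by blast
      have small: "norm (S \<omega> a j) < e / 2" if "j \<ge> a" for j
      proof -
        have "\<not> (norm (S \<omega> a j) \<ge> 1 / real (Suc p))"
          using a[of j] elim(2) that unfolding B_def by auto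
        then show ?thesis using p by linarith
      qed
      show "\<exists>N. \<forall>i\<ge>N. \<forall>j\<ge>N. dist (s i) (s j) < e"
      proof (intro exI[of _ a] allI impI)
        fix i j assume ij: "i \<ge> a" "j \<ge> a"
        have "dist (s i) (s j) = norm (S \<omega> a i - S \<omega> a j)"
          by (simp add: dist_norm split[OF ij(1)] split[OF ij(2)])
        also have "\<dots> \<le> norm (S \<omega> a i) + norm (S \<omega> a j)" by (rule norm_triangle_ineq4)
        also have "\<dots> < e" using small[OF ij(1)] small[OF ij(2)] by linarith
        finally show "dist (s i) (s j) < e" .
      qed
    qed
    then show ?case unfolding s_def by (rule Cauchy_convergent)
  qed
qed

text \<open>A Kronecker-type argument without division by the growth product, which may vanish.
  Subtracting from \<open>y\<close> the remainder \<open>r\<close> of the convergent series replaces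
  the driving term by (q - 1) r = o(1 / n), and |q| contracts with rate \<alpha> - Re w.\<close>

lemma growth_recursion_negligible:
  fixes E D :: "nat \<Rightarrow> complex" and w :: complex and \<alpha> :: real
  assumes rec: "\<And>n. E (Suc n) = (1 + w / of_nat (Suc n)) * E n + D n"
    and conv: "convergent (\<lambda>n. \<Sum>i<n. of_real (real (Suc i) powr - \<alpha>) * D i)"
    and lt: "Re w < \<alpha>"
  shows "(\<lambda>n. of_real (real n powr - \<alpha>) * E n) \<longlonglongrightarrow> 0"
proof -
  obtain L where L: "(\<lambda>n. \<Sum>i<n. of_real (real (Suc i) powr - \<alpha>) * D i) \<longlonglongrightarrow> L"
    using conv by (auto simp: convergent_def)
  define r where "r = (\<lambda>n. (\<Sum>i<n. of_real (real (Suc i) powr - \<alpha>) * D i) - L)"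
  have r: "r \<longlonglongrightarrow> 0" unfolding r_def using L by (simp add: LIM_zero)
  define y where "y = (\<lambda>n. of_real (real n powr - \<alpha>) * E n)"
  define p where "p = (\<lambda>n. (real n / real (Suc n)) powr \<alpha>)"
  define q where "q = (\<lambda>n. of_real (p n) * (1 + w / of_nat (Suc n)))"
  define l g where "l = Re w" and "g = (norm w)\<^sup>2"
  have nq: "norm (q n) = (real n / real (Suc n)) powr \<alpha> * sqrt (1 + 2 * l / real (Suc n) + g / (real (Suc n))\<^sup>2)" for n
  proof -
    have "norm (1 + w / of_nat (Suc n)) = sqrt (1 + 2 * l / real (Suc n) + g / (real (Suc n))\<^sup>2)"
      unfolding l_def g_def norm_one_plus_div_sq[symmetric] by simp
    then show ?thesis by (simp add: q_def p_def norm_mult del: of_nat_Suc)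
  qed
  have lim_nq: "(\<lambda>n. real (Suc n) * (norm (q n) - 1)) \<longlonglongrightarrow> - (\<alpha> - l)"
    unfolding nq by real_asymp
  have p1: "(\<lambda>n. real (Suc n) * (p n - 1)) \<longlonglongrightarrow> - \<alpha>" and p2: "p \<longlonglongrightarrow> 1"
    unfolding p_def by real_asymp+
  have lim_q: "(\<lambda>n. of_nat (Suc n) * (q n - 1)) \<longlonglongrightarrow> of_real (- \<alpha>) + w * of_real 1"
  proof -
    have eq: "of_nat (Suc n) * (q n - 1) = of_real (real (Suc n) * (p n - 1)) + w * of_real (p n)" for n
    proof -
      have "of_nat (Suc n) \<noteq> (0::complex)" by (rule of_nat_neq_0)
      then show ?thesis by (simp add: q_def field_simps del: of_nat_Suc)
    qed
    show ?thesis unfolding eq by (intro tendsto_intros p1 p2)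
  qed
  define u where "u = (\<lambda>n. y n - r n)"
  define e where "e = (\<lambda>n. norm (of_nat (Suc n) * (q n - 1)) * norm (r n))"
  have "(\<lambda>n. norm (u n)) \<longlonglongrightarrow> 0"
  proof (rule contraction_tendsto_0[OF lim_nq])
    show "\<alpha> - l > 0" using lt by (simp add: l_def)
    have "e \<longlonglongrightarrow> norm (of_real (- \<alpha>) + w * of_real 1) * norm (0 :: complex)"
      unfolding e_def by (intro tendsto_mult tendsto_norm lim_q r)
    then show "e \<longlonglongrightarrow> 0" by simp
    show "\<forall>\<^sub>F n in sequentially. norm (u (Suc n)) \<le> \<bar>norm (q n)\<bar> * norm (u n) + e n / real (Suc n)"
      using eventually_gt_at_top[of 0]
    proof eventually_elim
      case (elim n)
      have pw: "real (Suc n) powr - \<alpha> = p n * real n powr - \<alpha>"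
        using elim by (simp add: p_def powr_divide powr_minus field_simps)
      have "y (Suc n) = of_real (real (Suc n) powr - \<alpha>) * ((1 + w / of_nat (Suc n)) * E n) +
          of_real (real (Suc n) powr - \<alpha>) * D n"
        by (simp only: y_def rec distrib_left)
      also have "of_real (real (Suc n) powr - \<alpha>) * ((1 + w / of_nat (Suc n)) * E n) = q n * y n"
        by (simp only: pw q_def y_def of_real_mult mult_ac)
      finally have "y (Suc n) = q n * y n + of_real (real (Suc n) powr - \<alpha>) * D n" .
      moreover have "r (Suc n) = r n + of_real (real (Suc n) powr - \<alpha>) * D n"
        by (simp add: r_def)
      ultimately have "u (Suc n) = q n * u n + (q n - 1) * r n"
        by (simp add: u_def algebra_simps)
      then have "norm (u (Suc n)) \<le> norm (q n) * norm (u n) + norm (q n - 1) * norm (r n)"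
        using norm_triangle_ineq[of "q n * u n" "(q n - 1) * r n"] by (simp add: norm_mult)
      moreover have "norm (q n - 1) * norm (r n) = e n / real (Suc n)"
        by (simp add: e_def norm_mult del: of_nat_Suc)
      ultimately show ?case by simp
    qed
  qed simp
  then have "u \<longlonglongrightarrow> 0" by (simp add: tendsto_norm_zero_iff)
  from tendsto_add[OF this r] show ?thesis by (simp add: u_def y_def)
qed

text \<open>The product is \<open>pochhammer (lam m k + 1) n / fact n\<close>, and Euler's limit
  formula applies; the limit is \<open>rGamma (lam m k + 1)\<close> in another form.\<close>

lemma growth_prod_asymptotics:
  "(\<lambda>n. growth_prod m k 0 n / exp (lam m k * of_real (ln (real n)))) \<longlonglongrightarrow> rGamma (lam m k) / lam m k"
proof -
  let ?l = "lam m k"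
  have P: "growth_prod m k 0 n = pochhammer (?l + 1) n / fact n" for n
  proof (induction n)
    case (Suc n)
    have "of_nat (Suc n) \<noteq> (0::complex)" by (rule of_nat_neq_0)
    then have "1 + ?l / of_nat (Suc n) = (?l + 1 + of_nat n) / of_nat (Suc n)"
      by (simp add: field_simps)
    then show ?case
      by (simp add: growth_prod_right Suc pochhammer_rec' mult.commute)
  qed (simp add: growth_prod_def)
  have "(\<lambda>n. rGamma_series ?l n / ?l) \<longlonglongrightarrow> rGamma ?l / ?l"
    using lam_neq_0[of m k] by (intro tendsto_intros)
  moreover have "rGamma_series ?l n / ?l = growth_prod m k 0 n / exp (?l * of_real (ln (real n)))" for n
    using lam_neq_0[of m k] by (simp add: rGamma_series_def P pochhammer_rec)
  ultimately show ?thesis by simp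
qed

text \<open>Here lam is not a negative integer, so no growth factor vanishes, and the product has
  order n^(Re lam) with Re lam > 1/2; its reciprocals are therefore square summable weights.\<close>

lemma leaf_char_leading_converges:
  assumes T: "bst_growth_process M T" and re: "Re (lam m k) > 1 / 2"
  shows "AE \<omega> in M. convergent (\<lambda>n. leaf_char m k (T n \<omega>) / exp (lam m k * of_real (ln (real n))))"
proof -
  let ?l = "lam m k" and ?P = "growth_prod m k 0"
  define c where "c = rGamma ?l / ?l"
  have lnz: "?l \<notin> \<int>\<^sub>\<le>\<^sub>0" using re by (auto elim!: nonpos_Ints_cases)
  then have c: "c \<noteq> 0" using lam_neq_0[of m k] by (simp add: c_def rGamma_nonzero)
  have Pc: "(\<lambda>n. ?P n / exp (?l * of_real (ln (real n)))) \<longlonglongrightarrow> c"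
    unfolding c_def by (rule growth_prod_asymptotics)
  have P0: "?P n \<noteq> 0" for n
  proof -
    have "1 + ?l / of_nat (Suc i) \<noteq> 0" for i
    proof
      assume "1 + ?l / of_nat (Suc i) = 0"
      then have "?l = - of_nat (Suc i)"
        by (simp add: field_simps del: of_nat_Suc) (metis add.commute add_eq_0_iff)
      then have "Re ?l = - real (Suc i)" by simp
      then show False using re by simp
    qed
    then show ?thesis by (simp add: growth_prod_def del: of_nat_Suc)
  qed
  \<comment> \<open>The step from size i to i + 1 is normalised by the product that already includes
    its own factor.\<close>
  define wt where "wt = (\<lambda>i. 1 / ?P (Suc i))"
  let ?S = "\<lambda>\<omega> n. \<Sum>i<n. wt i * martingale_diff m k (\<lambda>i. T i \<omega>) i"
  have "summable (\<lambda>i. (norm (1 / ?P i))\<^sup>2)"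
  proof (rule summable_comparison_test_ev)
    have "(\<lambda>n. norm (?P n / exp (?l * of_real (ln (real n))))) \<longlonglongrightarrow> norm c"
      by (intro tendsto_intros Pc)
    then have "\<forall>\<^sub>F n in sequentially. norm c / 2 < norm (?P n / exp (?l * of_real (ln (real n))))"
      using c by (intro order_tendstoD(1)) auto
    then show "\<forall>\<^sub>F n in sequentially. norm ((norm (1 / ?P n))\<^sup>2) \<le> (2 / norm c)\<^sup>2 * real n powr (- 2 * Re ?l)"
      using eventually_gt_at_top[of 0]
    proof eventually_elim
      case (elim n)
      have "norm (exp (?l * of_real (ln (real n)))) = real n powr Re ?l"
        using elim by (simp add: powr_def mult.commute)
      then have "norm c / 2 * real n powr Re ?l \<le> norm (?P n)"
        using elim by (simp add: norm_divide field_simps)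
      moreover have "norm c / 2 * real n powr Re ?l > 0" using c elim by simp
      ultimately have "1 / norm (?P n) \<le> 1 / (norm c / 2 * real n powr Re ?l)"
        by (intro divide_left_mono mult_pos_pos) (use P0 elim in auto)
      then have "(1 / norm (?P n))\<^sup>2 \<le> (1 / (norm c / 2 * real n powr Re ?l))\<^sup>2"
        by (intro power_mono) auto
      also have "\<dots> = (2 / norm c)\<^sup>2 * (real n powr - Re ?l)\<^sup>2"
        by (simp add: powr_minus power_mult_distrib power_divide field_simps)
      also have "(real n powr - Re ?l)\<^sup>2 = real n powr (- 2 * Re ?l)"
        using elim by (simp add: power2_eq_square flip: powr_add)
      finally show ?case by (simp add: norm_divide)
    qed
    have "summable (\<lambda>n. real n powr (- 2 * Re ?l))"
      using re by (subst summable_real_powr_iff) auto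
    then show "summable (\<lambda>n. (2 / norm c)\<^sup>2 * real n powr (- 2 * Re ?l))"
      by (rule summable_mult)
  qed
  then have "summable (\<lambda>i. (norm (wt i))\<^sup>2)"
    unfolding wt_def by (subst summable_Suc_iff)
  from martingale_series_converges[OF T this, of m k]
  have "AE \<omega> in M. convergent (?S \<omega>)" .
  moreover have "AE \<omega> in M. T 0 \<omega> = Leaf" using T by (simp add: bst_growth_process_def)
  ultimately show ?thesis
  proof eventually_elim
    case (elim \<omega>)
    have E: "leaf_char m k (T n \<omega>) = ?P n * (1 + ?S \<omega> n)" for n
    proof (induction n)
      case 0
      then show ?case using elim(2) by simp
    next
      case (Suc n)
      have "leaf_char m k (T (Suc n) \<omega>) = (1 + ?l / of_nat (Suc n)) * leaf_char m k (T n \<omega>) + martingale_diff m k (\<lambda>i. T i \<omega>) n"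
        by (simp add: martingale_diff_def)
      also have "martingale_diff m k (\<lambda>i. T i \<omega>) n = ?P (Suc n) * (wt n * martingale_diff m k (\<lambda>i. T i \<omega>) n)"
        using P0 by (simp add: wt_def)
      also have "(1 + ?l / of_nat (Suc n)) * leaf_char m k (T n \<omega>) =
          ?P (Suc n) * (1 + ?S \<omega> n)"
        unfolding Suc growth_prod_right[OF le0] by (simp only: mult_ac)
      finally show ?case by (simp add: ring_distribs)
    qed
    obtain S where S: "(?S \<omega>) \<longlonglongrightarrow> S"
      using elim(1) by (auto simp: convergent_def)
    have "(\<lambda>n. ?P n / exp (?l * of_real (ln (real n))) * (1 + ?S \<omega> n)) \<longlonglongrightarrow> c * (1 + S)"
      by (intro tendsto_intros Pc S)
    then show ?case unfolding E convergent_def by (auto simp: mult_ac)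
  qed
qed

text \<open>The weights n^(-\<alpha>) are square summable for every root as soon as \<alpha> > 1/2,
  whereas reciprocals of the growth product need Re lam > 1/2.\<close>

lemma leaf_char_negligible:
  assumes T: "bst_growth_process M T" and \<alpha>: "\<alpha> > 1 / 2" and lt: "Re (lam m k) < \<alpha>"
  shows "AE \<omega> in M. (\<lambda>n. of_real (real n powr - \<alpha>) * leaf_char m k (T n \<omega>)) \<longlonglongrightarrow> 0"
proof -
  define wt where "wt = (\<lambda>i. complex_of_real (real (Suc i) powr - \<alpha>))"
  have "summable (\<lambda>n. real n powr (- 2 * \<alpha>))"
    using \<alpha> by (subst summable_real_powr_iff) auto
  then have "summable (\<lambda>i. real (Suc i) powr (- 2 * \<alpha>))"
    by (subst summable_Suc_iff)
  moreover have "(norm (wt i))\<^sup>2 = real (Suc i) powr (- 2 * \<alpha>)" for i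
    by (simp add: wt_def power2_eq_square del: of_nat_Suc flip: powr_add)
  ultimately have "summable (\<lambda>i. (norm (wt i))\<^sup>2)" by simp
  from martingale_series_converges[OF T this, of m k] show ?thesis
  proof eventually_elim
    case (elim \<omega>)
    show ?case
    proof (rule growth_recursion_negligible[OF _ _ lt])
      show "leaf_char m k (T (Suc n) \<omega>) = (1 + lam m k / of_nat (Suc n)) * leaf_char m k (T n \<omega>) + martingale_diff m k (\<lambda>i. T i \<omega>) n" for n
        by (simp add: martingale_diff_def)
      show "convergent (\<lambda>n. \<Sum>i<n. of_real (real (Suc i) powr - \<alpha>) * martingale_diff m k (\<lambda>i. T i \<omega>) i)"
        using elim by (simp only: wt_def)
    qed
  qed
qed

text \<open>By the triple angle formula c = cos (2 pi / 9) satisfies 4 c^3 - 3 c = -1/2. At 3/4 the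
  cubic has the value -9/16, and for 1/2 \<le> c \<le> 3/4 it is at most that; hence c >
  3/4.\<close>

lemma alpha_gt_half:
  assumes "m \<ge> (9::nat)"
  shows "2 * cos (2 * pi / real m) - 1 > 1 / 2"
proof -
  define c where "c = cos (2 * pi / 9)"
  have "c > 3 / 4"
  proof (rule ccontr)
    assume "\<not> c > 3 / 4"
    then have c: "c \<le> 3 / 4" by simp
    have "cos (pi / 3) \<le> c" unfolding c_def by (intro cos_monotone_0_pi_le) auto
    then have c': "1 / 2 \<le> c" by (simp add: cos_60)
    have "cos (3 * (2 * pi / 9)) = 4 * c ^ 3 - 3 * c" unfolding c_def by (rule cos_treble_cos)
    then have "4 * c ^ 3 - 3 * c = - 1 / 2" using cos_120 by simp
    moreover have "4 * c ^ 3 - 3 * c + 9 / 16 = (c - 3 / 4) * (4 * c\<^sup>2 + 3 * c - 3 / 4)"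
      by (simp add: power2_eq_square power3_eq_cube algebra_simps)
    moreover have "(c - 3 / 4) * (4 * c\<^sup>2 + 3 * c - 3 / 4) \<le> 0"
    proof (rule mult_nonpos_nonneg)
      have "0 \<le> c\<^sup>2" by simp
      then show "0 \<le> 4 * c\<^sup>2 + 3 * c - 3 / 4" using c' by linarith
    qed (use c in simp)
    ultimately show False by simp
  qed
  moreover have "c \<le> cos (2 * pi / real m)"
    unfolding c_def using assms by (intro cos_monotone_0_pi_le) (auto simp: field_simps)
  ultimately show ?thesis by simp
qed

lemma Re_lam_less:
  assumes "k \<in> {2..<m - 1}"
  shows "Re (lam m k) < 2 * cos (2 * pi / real m) - 1"
proof -
  let ?x = "2 * pi * real k / real m"
  have m: "real m > 0" "real k \<ge> 2" "real k \<le> real m - 2" using assms by auto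
  have lo: "2 * pi / real m < ?x"
    using m by (intro divide_strict_right_mono) auto
  have hi: "?x < 2 * pi - 2 * pi / real m"
  proof -
    have "2 * pi * real k < 2 * pi * (real m - 1)" using m by (intro mult_strict_left_mono) auto
    then show ?thesis using m by (simp add: field_simps)
  qed
  have "cos ?x < cos (2 * pi / real m)"
  proof (cases "?x \<le> pi")
    case True
    then show ?thesis using lo m by (intro cos_monotone_0_pi) auto
  next
    case False
    have "cos (2 * pi - ?x) < cos (2 * pi / real m)"
      using False hi m by (intro cos_monotone_0_pi) auto
    then show ?thesis by (simp add: cos_diff)
  qed
  then show ?thesis by (simp add: Re_lam)
qed

lemma depth_count_oscillation:
  fixes T :: "nat \<Rightarrow> 'w \<Rightarrow> unit tree"
  assumes m: "m \<ge> 9" and T: "bst_growth_process M T"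
  defines "\<alpha> \<equiv> 2 * cos (2 * pi / real m) - 1" and "\<beta> \<equiv> 2 * sin (2 * pi / real m)"
  obtains Z :: "'w \<Rightarrow> complex" where "Z \<in> borel_measurable M"
    "AE \<omega> in M. \<forall>j<m. (\<lambda>n. real n powr - \<alpha> * (real (depth_count m j (T n \<omega>)) - real n / real m) -
       Re (cis (\<beta> * ln (real n)) * (Z \<omega> * cnj (zeta m 1 ^ j)))) \<longlonglongrightarrow> 0"
proof -
  note One_nat_def [simp del]
  let ?l = "lam m 1"
  let ?cis = "\<lambda>n. cis (\<beta> * ln (real n))" and ?pow = "\<lambda>n. complex_of_real (real n powr - \<alpha>)"
  have m0: "m > 0" using m by simp
  have l: "?l = Complex \<alpha> \<beta>"
    by (simp add: lam_def zeta_def complex_eq_iff \<alpha>_def \<beta>_def)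
  have half: "\<alpha> > 1 / 2" unfolding \<alpha>_def by (rule alpha_gt_half[OF m])
  have [measurable]: "(\<lambda>\<omega>. leaf_char m k (T n \<omega>)) \<in> borel_measurable M" for k n
    using T by (intro borel_measurable_leaf_char) (simp add: bst_growth_process_def)
  define f where "f = (\<lambda>\<omega> n. leaf_char m 1 (T n \<omega>) / exp (?l * of_real (ln (real n))))"
  \<comment> \<open>1 / (m lam) comes from the Fourier inversion, and the factor 2 from the
    conjugate pair of characters 1 and m - 1.\<close>
  define Z where "Z = (\<lambda>\<omega>. 2 / (of_nat m * ?l) * lim (f \<omega>))"
  let ?dev = "\<lambda>\<omega> j n. real n powr - \<alpha> * (real (depth_count m j (T n \<omega>)) - real n / real m) -
    Re (cis (\<beta> * ln (real n)) * (Z \<omega> * cnj (zeta m 1 ^ j)))"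
  have Z: "Z \<in> borel_measurable M" unfolding Z_def f_def by measurable
  have "AE \<omega> in M. convergent (f \<omega>)"
    unfolding f_def using half by (intro leaf_char_leading_converges[OF T]) (simp add: l)
  moreover have "AE \<omega> in M. \<forall>k\<in>{2..<m - 1}. (\<lambda>n. ?pow n * leaf_char m k (T n \<omega>)) \<longlonglongrightarrow> 0"
    using half Re_lam_less[of _ m] by (intro AE_finite_allI leaf_char_negligible[OF T]) (auto simp: \<alpha>_def)
  moreover have "AE \<omega> in M. \<forall>n. size (T n \<omega>) = n"
    using size_growth_process[OF T] by (simp add: AE_all_countable)
  ultimately have "AE \<omega> in M. \<forall>j<m. ?dev \<omega> j \<longlonglongrightarrow> 0"
  proof eventually_elim
    case (elim \<omega>)
    show ?case
    proof (intro allI impI)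
      fix j assume j: "j < m"
      define E where "E = (\<lambda>k n. leaf_char m k (T n \<omega>))"
      define t where "t = (\<lambda>k n. cnj (zeta m k ^ j) * (E k n - 1) / lam m k / of_nat m)"
      have pw0: "(\<lambda>n. ?pow n) \<longlonglongrightarrow> of_real 0"
        using half by (intro tendsto_of_real) real_asymp
      have X: "real (depth_count m j (T n \<omega>)) - real n / real m =
          2 * Re (t 1 n) + Re (\<Sum>k=2..<m - 1. t k n)" for n
      proof -
        have "complex_of_real (real (depth_count m j (T n \<omega>)) - real n / real m) = (\<Sum>k=1..<m. t k n)"
          using depth_count_eq_leaf_char[OF j, of "T n \<omega>"] elim(3)
          by (simp add: t_def E_def sum_divide_distrib)
        also have "\<dots> = t 1 n + (\<Sum>k=2..<m - 1. t k n) + t (m - 1) n"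
        proof -
          have "{1..<m} = insert 1 (insert (m - 1) {2..<m - 1})" using m by auto
          moreover have "1 \<notin> insert (m - 1) {2..<m - 1}" "m - 1 \<notin> {2..<m - 1}" using m by auto
          ultimately show ?thesis by (simp add: add_ac)
        qed
        also have "t (m - 1) n = cnj (t 1 n)"
        proof -
          have "leaf_char m (m - 1) (T n \<omega>) = cnj (leaf_char m 1 (T n \<omega>))"
            using m0 by (simp add: leaf_char_nth cnj_zeta)
          then show ?thesis using m0 by (simp add: t_def E_def cnj_zeta cnj_lam)
        qed
        finally have eq: "complex_of_real (real (depth_count m j (T n \<omega>)) - real n / real m) =
            t 1 n + (\<Sum>k=2..<m - 1. t k n) + cnj (t 1 n)" .
        show ?thesis using arg_cong[OF eq, of Re] by (simp only: Re_complex_of_real plus_complex.sel) simp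
      qed
      have rest: "(\<lambda>n. ?pow n * (\<Sum>k=2..<m - 1. t k n)) \<longlonglongrightarrow> 0"
      proof -
        have "(\<lambda>n. \<Sum>k=2..<m - 1. cnj (zeta m k ^ j) / lam m k / of_nat m *
            (?pow n * E k n - ?pow n)) \<longlonglongrightarrow>
          (\<Sum>k=2..<m - 1. cnj (zeta m k ^ j) / lam m k / of_nat m * (0 - of_real 0))"
          using elim(2) by (intro tendsto_sum tendsto_mult tendsto_diff tendsto_const pw0) (auto simp: E_def)
        moreover have "?pow n * (\<Sum>k=2..<m - 1. t k n) =
            (\<Sum>k=2..<m - 1. cnj (zeta m k ^ j) / lam m k / of_nat m *
            (?pow n * E k n - ?pow n))" for n
          unfolding sum_distrib_left t_def by (intro sum.cong refl) (simp add: algebra_simps diff_divide_distrib)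
        ultimately show ?thesis by simp
      qed
      define c where "c = cnj (zeta m 1 ^ j) / ?l / of_nat m"
      have lead: "(\<lambda>n. ?pow n * t 1 n - ?cis n * (c * lim (f \<omega>))) \<longlonglongrightarrow> 0"
      proof -
        have "f \<omega> \<longlonglongrightarrow> lim (f \<omega>)" using elim(1) by (simp add: convergent_LIMSEQ_iff)
        then have "(\<lambda>n. f \<omega> n - lim (f \<omega>)) \<longlonglongrightarrow> 0" by (rule LIM_zero)
        then have null: "(\<lambda>n. norm (c * (f \<omega> n - lim (f \<omega>)))) \<longlonglongrightarrow> 0"
          by (intro tendsto_norm_zero tendsto_mult_right_zero)
        have 1: "(\<lambda>n. ?cis n * (c * (f \<omega> n - lim (f \<omega>)))) \<longlonglongrightarrow> 0"
        proof (rule tendsto_norm_zero_cancel)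
          have "norm (?cis n * z) = norm z" for n and z :: complex
            by (simp only: norm_mult norm_cis mult_1_left)
          then show "(\<lambda>n. norm (?cis n * (c * (f \<omega> n - lim (f \<omega>))))) \<longlonglongrightarrow> 0"
            using null by (simp only:)
        qed
        have 2: "(\<lambda>n. c * ?pow n) \<longlonglongrightarrow> 0"
          using pw0 by (intro tendsto_mult_right_zero) (simp only: of_real_0)
        \<comment> \<open>Only for n > 0: at n = 0 the power of 0 is 0, while the exponential is
          1.\<close>
        have "\<forall>\<^sub>F n in sequentially. ?cis n * (c * (f \<omega> n - lim (f \<omega>))) - c * ?pow n =
            ?pow n * t 1 n - ?cis n * (c * lim (f \<omega>))"
          using eventually_gt_at_top[of 0]
        proof eventually_elim
          case (elim n)
          have exp_l: "exp (?l * of_real (ln (real n))) = of_real (real n powr \<alpha>) * ?cis n"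
            using elim by (simp add: l exp_eq_polar powr_def mult.commute)
          have cancel: "z * (x / (p * z)) = x / p" if "z \<noteq> 0" for x p z :: complex
            using that by simp
          have "?cis n * f \<omega> n = E 1 n / of_real (real n powr \<alpha>)"
            unfolding f_def E_def exp_l by (rule cancel[OF cis_neq_zero])
          also have "\<dots> = ?pow n * E 1 n"
            by (simp add: powr_minus divide_inverse mult.commute)
          finally have "?cis n * f \<omega> n = ?pow n * E 1 n" .
          then have "?cis n * (c * f \<omega> n) = c * (?pow n * E 1 n)"
            by (simp only: mult.left_commute)
          moreover have "?pow n * t 1 n = c * (?pow n * E 1 n) - c * ?pow n"
            by (simp add: t_def c_def algebra_simps diff_divide_distrib)
          ultimately show ?case by (simp add: right_diff_distrib)
        qed
        then show ?thesis using tendsto_diff[OF 1 2] by (simp add: tendsto_cong)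
      qed
      have "(\<lambda>n. 2 * Re (?pow n * t 1 n - ?cis n * (c * lim (f \<omega>))) +
          Re (?pow n * (\<Sum>k=2..<m - 1. t k n))) \<longlonglongrightarrow> 2 * Re 0 + Re 0"
        by (intro tendsto_intros lead rest)
      moreover have "2 * Re (?pow n * t 1 n - ?cis n * (c * lim (f \<omega>))) +
          Re (?pow n * (\<Sum>k=2..<m - 1. t k n)) =
          ?dev \<omega> j n" for n
      proof -
        have eq: "?cis n * (Z \<omega> * cnj (zeta m 1 ^ j)) = 2 * (?cis n * (c * lim (f \<omega>)))"
          by (simp add: Z_def c_def mult_ac)
        have "Re (2 * z) = 2 * Re z" for z by simp
        then have Re_eq: "Re (?cis n * (Z \<omega> * cnj (zeta m 1 ^ j))) = 2 * Re (?cis n * (c * lim (f \<omega>)))"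
          unfolding eq by blast
        have "Re (of_real x * z) = x * Re z" for x z by simp
        then show ?thesis
          unfolding X Re_eq
          by (simp only: minus_complex.sel ring_distribs mult.left_commute[of _ 2] diff_add_eq)
      qed
      ultimately show "?dev \<omega> j \<longlonglongrightarrow> 0"
        by simp
    qed
  qed
  with Z that show ?thesis by blast
qed

section \<open>From the oscillation to the stated limits\<close>

lemma cis_rmod_2pi: "cis (x rmod (2 * pi)) = cis x"
proof -
  have "cis (x rmod (2 * pi)) = cis (x - 2 * pi * of_int \<lfloor>x / (2 * pi)\<rfloor>)"
    by (simp add: rmod_def)
  also have "\<dots> = cis x / cis (2 * pi * of_int \<lfloor>x / (2 * pi)\<rfloor>)"
    by (rule cis_divide[symmetric])
  also have "cis (2 * pi * of_int \<lfloor>x / (2 * pi)\<rfloor>) = 1"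
    by (rule cis_multiple_2pi) simp
  finally show ?thesis by simp
qed

lemma of_nat_powr_imaginary:
  "n > 0 \<Longrightarrow> of_nat n powr (\<i> * complex_of_real b) = cis (b * ln (real n))"
  by (simp add: powr_def Ln_of_nat cis_conv_exp mult_ac)

theorem theorem2p7:
  fixes m :: nat and idx :: "'m::finite \<Rightarrow> nat"
    and M :: "'w measure" and T :: "nat \<Rightarrow> 'w \<Rightarrow> unit tree"
  assumes "m \<ge> 2" and "bij_betw idx UNIV {..<m}"
    and "prob_space M" and "\<And>n. random_bst M n (T n)"
  shows "(m \<le> 8 \<longrightarrow>
      (\<exists>N. multivariate_normal 0 (circulant m idx (Sigma_row m)) N \<and>
          converges_in_distribution M
            (\<lambda>n \<omega>. real n powr (-1/2) *\<^sub>R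
               (depth_vec m idx (T n \<omega>) - (real n / real m) *\<^sub>R 1)) N)) \<and>
    (m \<ge> 9 \<longrightarrow> bst_growth_process M T \<longrightarrow>
      (let \<alpha> = 2 * cos (2 * pi / real m) - 1;
           \<beta> = 2 * sin (2 * pi / real m);
           Y = (\<lambda>n \<omega>. real n powr (-\<alpha>) *\<^sub>R
                  (depth_vec m idx (T n \<omega>) - (real n / real m) *\<^sub>R (1 :: real ^ 'm)))
       in \<alpha> > 1/2 \<and>
          (\<exists>Z :: 'w \<Rightarrow> complex. Z \<in> borel_measurable M \<and>
             (let W = (\<lambda>\<omega>. \<chi> k. Z \<omega> * exp (- (2 * pi * real (idx k) * \<i> / real m)))
                        :: 'w \<Rightarrow> complex ^ 'm
              in AE \<omega> in M.
                   (\<lambda>n. Y n \<omega> - (\<chi> k. Re (of_nat n powr (\<i> * \<beta>) * W \<omega> $ k))) \<longlonglongrightarrow> 0) \<and>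
             (\<forall>(\<phi> :: nat \<Rightarrow> nat) \<gamma>. strict_mono \<phi> \<and> \<gamma> \<in> {0..2 * pi} \<and>
                  (\<lambda>i. (\<beta> * ln (real (\<phi> i))) rmod (2 * pi)) \<longlonglongrightarrow> \<gamma> \<longrightarrow>
                converges_in_distribution M (\<lambda>i. Y (\<phi> i))
                  (distr M borel
                     (\<lambda>\<omega>. \<chi> k. Re (exp (\<i> * (\<gamma> - 2 * pi * real (idx k) / real m)) * Z \<omega>)))))))"
proof (intro conjI impI, goal_cases)
  case 1
  then show ?case by (intro depth_vec_normal_limit assms)
next
  case 2
  note m = 2(1) and process = 2(2)
  define \<alpha> \<beta> where "\<alpha> = 2 * cos (2 * pi / real m) - 1" and "\<beta> = 2 * sin (2 * pi / real m)"
  define Y where "Y = (\<lambda>n \<omega>. real n powr (-\<alpha>) *\<^sub>R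
    (depth_vec m idx (T n \<omega>) - (real n / real m) *\<^sub>R (1 :: real ^ 'm)))"
  interpret prob_space M by fact
  have m0: "m > 0" using m by simp
  have lt: "idx k < m" for k using bij_betwE[OF assms(2)] by auto
  obtain Z :: "'w \<Rightarrow> complex" where Z [measurable]: "Z \<in> borel_measurable M"
    and osc: "AE \<omega> in M. \<forall>j<m. (\<lambda>n. real n powr - \<alpha> * (real (depth_count m j (T n \<omega>)) - real n / real m) -
       Re (cis (\<beta> * ln (real n)) * (Z \<omega> * cnj (zeta m 1 ^ j)))) \<longlonglongrightarrow> 0"
    using depth_count_oscillation[OF m process] unfolding \<alpha>_def \<beta>_def by blast
  have root: "cnj (zeta m 1 ^ j) = cis (- (2 * pi * real j / real m))" for j
    by (simp add: zeta_power cis_cnj) (simp add: zeta_def cis_cnj)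
  have Y: "Y n \<omega> $ k = real n powr - \<alpha> * (real (depth_count m (idx k) (T n \<omega>)) - real n / real m)" for n \<omega> k
    by (simp add: Y_def depth_vec_def)
  have Y_meas [measurable]: "Y n \<in> borel_measurable M" for n
  proof -
    have "T n \<in> measurable M (count_space UNIV)" using assms(4)[of n] by (simp add: random_bst_def)
    then show ?thesis unfolding Y_def by (rule measurable_compose) simp
  qed
  let ?E = "\<lambda>\<omega> n. Y n \<omega> - (\<chi> k. Re (of_nat n powr (\<i> * \<beta>) *
      (\<chi> k. Z \<omega> * exp (- (2 * pi * real (idx k) * \<i> / real m))) $ k))"
  have as_conv: "AE \<omega> in M. (\<lambda>n. ?E \<omega> n) \<longlonglongrightarrow> 0"
    using osc
  proof eventually_elim
    case (elim \<omega>)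
    show ?case
    proof (rule vec_tendstoI)
      fix k
      have ex: "exp (- (2 * pi * real (idx k) * \<i> / real m)) = cnj (zeta m 1 ^ idx k)"
        unfolding root by (simp add: cis_conv_exp mult_ac)
      have "\<forall>\<^sub>F n in sequentially. real n powr - \<alpha> * (real (depth_count m (idx k) (T n \<omega>)) - real n / real m) -
           Re (cis (\<beta> * ln (real n)) * (Z \<omega> * cnj (zeta m 1 ^ idx k))) =
         (?E \<omega> n) $ k"
        using eventually_gt_at_top[of 0]
        by eventually_elim (simp only: Y of_nat_powr_imaginary vec_lambda_beta vector_minus_component ex)
      with elim lt[of k] show "(\<lambda>n. (?E \<omega> n) $ k) \<longlonglongrightarrow> 0 $ k"
        unfolding zero_index by (blast intro: Lim_transform_eventually)
    qed
  qed
  have distr_conv: "converges_in_distribution M (\<lambda>i. Y (\<phi> i))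
      (distr M borel (\<lambda>\<omega>. \<chi> k. Re (exp (\<i> * (\<gamma> - 2 * pi * real (idx k) / real m)) * Z \<omega>)))"
    if \<phi>: "strict_mono \<phi>" and \<gamma>: "(\<lambda>i. (\<beta> * ln (real (\<phi> i))) rmod (2 * pi)) \<longlonglongrightarrow> \<gamma>" for \<phi> \<gamma>
  proof -
    define F where "F = (\<lambda>\<omega>. (\<chi> k. Re (exp (\<i> * (\<gamma> - 2 * pi * real (idx k) / real m)) * Z \<omega>)) :: real ^ 'm)"
    have F [measurable]: "F \<in> borel_measurable M"
      unfolding F_def by (rule borel_measurable_vec_lambda) measurable
    \<comment> \<open>Once the phase converges modulo 2 pi, the oscillating term converges
      pointwise. Convergence in distribution then follows from almost sure convergence by dominated
      convergence.\<close>
    have conv: "AE \<omega> in M. (\<lambda>i. Y (\<phi> i) \<omega>) \<longlonglongrightarrow> F \<omega>"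
      using osc
    proof eventually_elim
      case (elim \<omega>)
      show ?case
      proof (rule vec_tendstoI)
        fix k
        let ?r = "Z \<omega> * cnj (zeta m 1 ^ idx k)"
        have "(\<lambda>i. cis ((\<beta> * ln (real (\<phi> i))) rmod (2 * pi))) \<longlonglongrightarrow> cis \<gamma>"
          unfolding cis_conv_exp by (intro tendsto_intros \<gamma>)
        then have cis: "(\<lambda>i. cis (\<beta> * ln (real (\<phi> i)))) \<longlonglongrightarrow> cis \<gamma>"
          by (simp only: cis_rmod_2pi)
        have "(\<lambda>n. Y n \<omega> $ k - Re (cis (\<beta> * ln (real n)) * ?r)) \<longlonglongrightarrow> 0"
          using elim lt[of k] unfolding Y by blast
        from LIMSEQ_subseq_LIMSEQ[OF this \<phi>]
        have "(\<lambda>i. Y (\<phi> i) \<omega> $ k - Re (cis (\<beta> * ln (real (\<phi> i))) * ?r)) \<longlonglongrightarrow> 0"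
          by (simp only: o_def)
        moreover have "(\<lambda>i. Re (cis (\<beta> * ln (real (\<phi> i))) * ?r)) \<longlonglongrightarrow> Re (cis \<gamma> * ?r)"
          by (intro tendsto_intros cis)
        ultimately have "(\<lambda>i. (Y (\<phi> i) \<omega> $ k - Re (cis (\<beta> * ln (real (\<phi> i))) * ?r)) +
            Re (cis (\<beta> * ln (real (\<phi> i))) * ?r)) \<longlonglongrightarrow> 0 + Re (cis \<gamma> * ?r)"
          by (rule tendsto_add)
        moreover have "F \<omega> $ k = Re (cis \<gamma> * ?r)"
        proof -
          have "exp (\<i> * (\<gamma> - 2 * pi * real (idx k) / real m)) = cis (\<gamma> + - (2 * pi * real (idx k) / real m))"
            by (simp add: cis_conv_exp)
          also have "\<dots> = cis \<gamma> * cnj (zeta m 1 ^ idx k)"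
            unfolding root by (rule cis_mult[symmetric])
          finally show ?thesis unfolding F_def vec_lambda_beta by (simp only: mult_ac)
        qed
        ultimately show "(\<lambda>i. Y (\<phi> i) \<omega> $ k) \<longlonglongrightarrow> F \<omega> $ k"
          by (simp only: diff_add_cancel add_0)
      qed
    qed
    show ?thesis
      unfolding converges_in_distribution_def F_def[symmetric]
    proof (intro allI impI, elim conjE)
      fix f :: "real ^ 'm \<Rightarrow> real"
      assume f: "continuous_on UNIV f" and "bounded (range f)"
      then obtain B where B: "\<And>x. \<bar>f x\<bar> \<le> B" by (auto simp: bounded_iff)
      have [measurable]: "f \<in> borel_measurable borel"
        using f by (rule borel_measurable_continuous_onI)
      have "(\<lambda>i. \<integral>\<omega>. f (Y (\<phi> i) \<omega>) \<partial>M) \<longlonglongrightarrow> (\<integral>\<omega>. f (F \<omega>) \<partial>M)"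
      proof (rule integral_dominated_convergence[where w = "\<lambda>_. B"])
        show "AE \<omega> in M. (\<lambda>i. f (Y (\<phi> i) \<omega>)) \<longlonglongrightarrow> f (F \<omega>)"
          using conv by eventually_elim (rule continuous_on_tendsto_compose[OF f]; simp)
        show "AE \<omega> in M. norm (f (Y (\<phi> i) \<omega>)) \<le> B" for i using B by simp
        show "(\<lambda>\<omega>. f (F \<omega>)) \<in> borel_measurable M" by measurable
        show "(\<lambda>\<omega>. f (Y (\<phi> i) \<omega>)) \<in> borel_measurable M" for i
          by (rule measurable_compose[OF Y_meas]) measurable
      qed simp
      then show "(\<lambda>i. \<integral>\<omega>. f (Y (\<phi> i) \<omega>) \<partial>M) \<longlonglongrightarrow> (\<integral>x. f x \<partial>distr M borel F)"
        by (subst integral_distr) simp_all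
    qed
  qed
  show ?case
    unfolding Let_def \<alpha>_def[symmetric] \<beta>_def[symmetric]
  proof (intro conjI exI[of _ Z] allI impI)
    show "1 / 2 < \<alpha>" unfolding \<alpha>_def by (rule alpha_gt_half[OF m])
  qed (use Z as_conv[unfolded Y_def] distr_conv[unfolded Y_def] in blast)+
qed

end
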